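(* Let $N\ge 2$, let $\Omega\subset\mathbb{R}^N$ be a bounded domain with $C^{1,1}$ boundary, and let $p\ge 2$, $s\in(0,1)$ with $ps<N$. Let $g\in C^0(\mathbb{R})\cap BV_{\rm loc}(\mathbb{R})$, and let $u\in W^{s,p}_0(\Omega)\cap C^0(\overline\Omega)$, $u\not\equiv 0$, satisfy $$(-\Delta)_p^s\,u+g(u)\ge g(0)\ \text{ weakly in }\Omega,\qquad u\ge 0\ \text{ in }\Omega.$$ Then $$\inf_\Omega\frac{u}{\mathrm{d}_\Omega^s}>0.$$ In particular, if $u\in C_s^0(\overline\Omega)$, then $u\in\mathrm{int}(C_s^0(\overline\Omega)_+)$.
   Context: Functions on $\Omega$ are identified with their extension by $0$ to $\mathbb{R}^N$; $\Omega^c=\mathbb{R}^N\setminus\Omega$; $\mathrm{d}_\Omega(x)=\mathrm{dist}(x,\Omega^c)$. $BV_{\rm loc}(\mathbb{R})$ denotes functions of bounded variation on every compact interval. Function spaces: $[u]_{s,p}=\Big(\iint_{\mathbb{R}^N\times\mathbb{R}^N}\frac{|u(x)-u(y)|^p}{|x-y|^{N+ps}}\,dx\,dy\Big)^{1/p}$, $W^{s,p}(\mathbb{R}^N)=\{u\in L^p(\mathbb{R}^N):[u]_{s,p}<\infty\}$, and $W^{s,p}_0(\Omega)=\{u\in W^{s,p}(\mathbb{R}^N): u=0\text{ a.e. in }\Omega^c\}$ with norm $\|u\|=[u]_{s,p}$; $W^{s,p}_0(\Omega)_+$ is the set of its nonnegative elements. $C_s^0(\overline\Omega)=\{u\in C^0(\overline\Omega):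 u/\mathrm{d}_\Omega^s\text{ has a continuous extension to }\overline\Omega\}$ with norm $\|u\|_{0,s}=\|u/\mathrm{d}_\Omega^s\|_\infty$; $C_s^0(\overline\Omega)_+$ is its cone of nonnegative functions, whose interior is $\mathrm{int}(C_s^0(\overline\Omega)_+)=\{u\in C_s^0(\overline\Omega):\inf_\Omega u/\mathrm{d}_\Omega^s>0\}$. Fractional $p$-Laplacian: for $u,\varphi\in W^{s,p}_0(\Omega)$, $$\langle(-\Delta)_p^s\,u,\varphi\rangle=\iint_{\mathbb{R}^N\times\mathbb{R}^N}\frac{|u(x)-u(y)|^{p-2}(u(x)-u(y))(\varphi(x)-\varphi(y))}{|x-y|^{N+ps}}\,dx\,dy.$$ The inequality $(-\Delta)_p^s\,u+g(u)\ge g(0)$ weakly in $\Omega$ means $\langle(-\Delta)_p^s\,u,\varphi\rangle+\int_\Omega g(u)\varphi\,dx\ge\int_\Omega g(0)\varphi\,dx$ for all $\varphi\in W^{s,p}_0(\Omega)_+$. *)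

theory Defs
  imports "HOL-Analysis.Analysis"
begin

text \<open>
  The ambient space \<open>\<real>\<^sup>N\<close> is a type \<^typ>\<open>'a::euclidean_space\<close> with \<open>N = DIM('a)\<close>.
  Functions on \<open>\<real>\<^sup>N\<close> are total and Lebesgue measurable; almost-everywhere classes are
  represented by arbitrary representatives.
\<close>

subsection \<open>Domains with boundary of class \<open>C\<^sup>1\<^sup>,\<^sup>1\<close>\<close>

text \<open>
  Near each boundary point the set is the strict epigraph, in some direction \<open>e\<close>, of a
  function \<open>\<gamma>\<close> on the hyperplane orthogonal to \<open>e\<close> that is differentiable with Lipschitz
  gradient \<open>D\<close>.  A function on that hyperplane is regarded as one on the whole space
  (compose with the orthogonal projection); only its values on the hyperplane are used.
\<close>

definition C11_boundary :: "'a::euclidean_space set \<Rightarrow> bool" where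
  "C11_boundary \<Omega> \<longleftrightarrow>
     (\<forall>x0\<in>frontier \<Omega>. \<exists>r>0. \<exists>e \<gamma> D L.
        norm e = 1 \<and> (\<forall>z. GDERIV \<gamma> z :> D z) \<and> L-lipschitz_on UNIV D \<and>
        \<Omega> \<inter> ball x0 r = {y \<in> ball x0 r. \<gamma> (y - (y \<bullet> e) *\<^sub>R e) < y \<bullet> e})"

definition bounded_C11_domain :: "'a::euclidean_space set \<Rightarrow> bool" where
  "bounded_C11_domain \<Omega> \<longleftrightarrow>
     open \<Omega> \<and> connected \<Omega> \<and> \<Omega> \<noteq> {} \<and> bounded \<Omega> \<and> C11_boundary \<Omega>"


subsection \<open>Functions of locally bounded variation on the line\<close>

definition BV_on :: "real \<Rightarrow> real \<Rightarrow> (real \<Rightarrow> real) \<Rightarrow> bool" where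
  "BV_on a b g \<longleftrightarrow>
     (\<exists>B. \<forall>n t. mono_on {..n} t \<longrightarrow> t ` {..n} \<subseteq> {a..b} \<longrightarrow>
        (\<Sum>i<n::nat. \<bar>g (t (Suc i)) - g (t i)\<bar>) \<le> B)"

definition BV_loc :: "(real \<Rightarrow> real) \<Rightarrow> bool" where
  "BV_loc g \<longleftrightarrow> (\<forall>a b. BV_on a b g)"


subsection \<open>Fractional Sobolev spaces and the fractional \<open>p\<close>-Laplacian\<close>

text \<open>
  \<open>gagliardo_pow s p u\<close> is \<open>[u]\<^bsub>s,p\<^esub>\<close> raised to the power \<open>p\<close>, as an extended nonnegative
  real.  On the diagonal the integrand is \<open>0 / 0 = 0\<close>, which is harmless since the diagonal
  is a null set.
\<close>

definition gagliardo_pow :: "real \<Rightarrow> real \<Rightarrow> ('a::euclidean_space \<Rightarrow> real) \<Rightarrow> ennreal" where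
  "gagliardo_pow s p u =
     (\<integral>\<^sup>+(x, y). ennreal (\<bar>u x - u y\<bar> powr p / norm (x - y) powr (real DIM('a) + p * s))
        \<partial>(lebesgue \<Otimes>\<^sub>M lebesgue))"

definition Wsp :: "real \<Rightarrow> real \<Rightarrow> ('a::euclidean_space \<Rightarrow> real) set" where
  "Wsp s p = {u. u \<in> borel_measurable lebesgue \<and>
                 (\<integral>\<^sup>+x. ennreal (\<bar>u x\<bar> powr p) \<partial>lebesgue) < \<infinity> \<and>
                 gagliardo_pow s p u < \<infinity>}"

definition Wsp0 :: "real \<Rightarrow> real \<Rightarrow> 'a::euclidean_space set \<Rightarrow> ('a \<Rightarrow> real) set" where
  "Wsp0 s p \<Omega> = {u \<in> Wsp s p. AE x in lebesgue. x \<notin> \<Omega> \<longrightarrow> u x = 0}"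

definition Wsp0_pos :: "real \<Rightarrow> real \<Rightarrow> 'a::euclidean_space set \<Rightarrow> ('a \<Rightarrow> real) set" where
  "Wsp0_pos s p \<Omega> = {u \<in> Wsp0 s p \<Omega>. AE x in lebesgue. 0 \<le> u x}"

text \<open>
  For \<open>u\<close> and \<open>\<phi>\<close> in \<^term>\<open>Wsp s p\<close> the integrand below is integrable by Hoelder's
  inequality.
\<close>

definition frac_p_laplacian ::
  "real \<Rightarrow> real \<Rightarrow> ('a::euclidean_space \<Rightarrow> real) \<Rightarrow> ('a \<Rightarrow> real) \<Rightarrow> real" where
  "frac_p_laplacian s p u \<phi> =
     (\<integral>(x, y). \<bar>u x - u y\<bar> powr (p - 2) * (u x - u y) * (\<phi> x - \<phi> y)
                  / norm (x - y) powr (real DIM('a) + p * s)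
        \<partial>(lebesgue \<Otimes>\<^sub>M lebesgue))"

definition weak_supersolution ::
  "real \<Rightarrow> real \<Rightarrow> 'a::euclidean_space set \<Rightarrow> (real \<Rightarrow> real) \<Rightarrow> ('a \<Rightarrow> real) \<Rightarrow> bool" where
  "weak_supersolution s p \<Omega> g u \<longleftrightarrow>
     (\<forall>\<phi>\<in>Wsp0_pos s p \<Omega>.
        frac_p_laplacian s p u \<phi> + (LINT x:\<Omega>|lebesgue. g (u x) * \<phi> x)
          \<ge> (LINT x:\<Omega>|lebesgue. g 0 * \<phi> x))"


subsection \<open>Weighted continuous functions\<close>

abbreviation bdist :: "'a::euclidean_space set \<Rightarrow> 'a \<Rightarrow> real" where
  "bdist \<Omega> x \<equiv> infdist x (- \<Omega>)"

definition C0s :: "real \<Rightarrow> 'a::euclidean_space set \<Rightarrow> ('a \<Rightarrow> real) set" where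
  "C0s s \<Omega> = {u. continuous_on (closure \<Omega>) u \<and>
     (\<exists>v. continuous_on (closure \<Omega>) v \<and> (\<forall>x\<in>\<Omega>. v x = u x / bdist \<Omega> x powr s))}"

definition norm_C0s :: "real \<Rightarrow> 'a::euclidean_space set \<Rightarrow> ('a \<Rightarrow> real) \<Rightarrow> real" where
  "norm_C0s s \<Omega> u = (SUP x\<in>\<Omega>. \<bar>u x / bdist \<Omega> x powr s\<bar>)"

definition C0s_pos :: "real \<Rightarrow> 'a::euclidean_space set \<Rightarrow> ('a \<Rightarrow> real) set" where
  "C0s_pos s \<Omega> = {u \<in> C0s s \<Omega>. \<forall>x\<in>closure \<Omega>. 0 \<le> u x}"

text \<open>
  The interior of the cone in the norm topology; \<open>int_C0s_pos_eq\<close> below is the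
  description of it by \<open>inf u / d\<^sup>s > 0\<close>.
\<close>

definition int_C0s_pos :: "real \<Rightarrow> 'a::euclidean_space set \<Rightarrow> ('a \<Rightarrow> real) set" where
  "int_C0s_pos s \<Omega> = {u \<in> C0s_pos s \<Omega>. \<exists>\<epsilon>>0. \<forall>v\<in>C0s s \<Omega>.
     norm_C0s s \<Omega> (\<lambda>x. v x - u x) < \<epsilon> \<longrightarrow> v \<in> C0s_pos s \<Omega>}"

lemma bdist_pos:
  fixes \<Omega> :: "'a::euclidean_space set"
  assumes "open \<Omega>" "bounded \<Omega>" "x \<in> \<Omega>"
  shows "0 < bdist \<Omega> x"
proof -
  have "- \<Omega> \<noteq> {}"
    using assms(2) not_bounded_UNIV[where 'a='a] by (metis double_compl Compl_empty_eq)
  then show ?thesis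
    using assms by (simp add: infdist_pos_not_in_closed closed_Compl)
qed

lemma C0s_diff:
  assumes "u \<in> C0s s \<Omega>" "v \<in> C0s s \<Omega>"
  shows "(\<lambda>x. v x - u x) \<in> C0s s \<Omega>"
proof -
  obtain u' v' where
    "continuous_on (closure \<Omega>) u'" "\<forall>x\<in>\<Omega>. u' x = u x / bdist \<Omega> x powr s"
    "continuous_on (closure \<Omega>) v'" "\<forall>x\<in>\<Omega>. v' x = v x / bdist \<Omega> x powr s"
    using assms unfolding C0s_def by blast
  then have "continuous_on (closure \<Omega>) (\<lambda>x. v' x - u' x)
     \<and> (\<forall>x\<in>\<Omega>. v' x - u' x = (v x - u x) / bdist \<Omega> x powr s)"
    by (auto intro!: continuous_intros simp: diff_divide_distrib)
  then show ?thesis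
    using assms unfolding C0s_def by (auto intro!: continuous_intros)
qed

lemma norm_C0s_upper:
  fixes \<Omega> :: "'a::euclidean_space set"
  assumes "bounded \<Omega>" "u \<in> C0s s \<Omega>" "x \<in> \<Omega>"
  shows "\<bar>u x / bdist \<Omega> x powr s\<bar> \<le> norm_C0s s \<Omega> u"
proof -
  obtain v where v: "continuous_on (closure \<Omega>) v" "\<forall>x\<in>\<Omega>. v x = u x / bdist \<Omega> x powr s"
    using assms unfolding C0s_def by blast
  have "bounded (v ` closure \<Omega>)"
    using assms(1) v(1) by (intro compact_imp_bounded compact_continuous_image) auto
  then obtain B where "\<forall>x\<in>closure \<Omega>. norm (v x) \<le> B"
    unfolding bounded_iff by auto
  then have "\<bar>u x / bdist \<Omega> x powr s\<bar> \<le> B" if "x \<in> \<Omega>" for x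
    using v(2) that closure_subset[of \<Omega>] by (metis real_norm_def subsetD)
  then have "bdd_above ((\<lambda>x. \<bar>u x / bdist \<Omega> x powr s\<bar>) ` \<Omega>)"
    by (intro bdd_aboveI2[where M = B])
  then show ?thesis
    unfolding norm_C0s_def using assms(3) by (rule cSUP_upper2) simp
qed

lemma int_C0s_pos_eq:
  fixes \<Omega> :: "'a::euclidean_space set"
  assumes \<Omega>: "open \<Omega>" "bounded \<Omega>" "\<Omega> \<noteq> {}" and s: "0 < s"
  shows "int_C0s_pos s \<Omega> = {u \<in> C0s_pos s \<Omega>. 0 < (INF x\<in>\<Omega>. u x / bdist \<Omega> x powr s)}"
proof (intro set_eqI iffI)
  fix u assume "u \<in> int_C0s_pos s \<Omega>"
  then obtain \<epsilon> where u: "u \<in> C0s_pos s \<Omega>" and "\<epsilon> > 0"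
    and \<epsilon>: "\<And>v. v \<in> C0s s \<Omega> \<Longrightarrow> norm_C0s s \<Omega> (\<lambda>x. v x - u x) < \<epsilon> \<Longrightarrow> v \<in> C0s_pos s \<Omega>"
    unfolding int_C0s_pos_def by blast
  have pos: "0 < bdist \<Omega> x powr s" if "x \<in> \<Omega>" for x
    using bdist_pos[OF \<Omega>(1,2) that] by simp
  define w where "w = (\<lambda>x. \<epsilon> / 2 * bdist \<Omega> x powr s)"
  have "continuous_on (closure \<Omega>) w"
    unfolding w_def using s
    by (intro continuous_on_mult_left continuous_on_powr' continuous_on_infdist continuous_on_id
        continuous_on_const) (auto simp: infdist_nonneg)
  then have w: "w \<in> C0s s \<Omega>"
    unfolding C0s_def w_def using pos
    by (auto intro!: exI[of _ "\<lambda>_. \<epsilon> / 2"] continuous_intros simp: less_imp_neq)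
  have uw: "(\<lambda>x. u x - w x) \<in> C0s s \<Omega>"
    using C0s_diff w u by (auto simp: C0s_pos_def)
  have "norm_C0s s \<Omega> (\<lambda>x. (u x - w x) - u x) = (SUP x\<in>\<Omega>. \<epsilon> / 2)"
    unfolding norm_C0s_def w_def using pos \<open>\<epsilon> > 0\<close> by (intro SUP_cong) (auto simp: less_imp_neq)
  also have "\<dots> < \<epsilon>"
    using \<open>\<epsilon> > 0\<close> \<Omega>(3) by simp
  finally have "(\<lambda>x. u x - w x) \<in> C0s_pos s \<Omega>"
    using \<epsilon>[OF uw] by simp
  then have "\<epsilon> / 2 \<le> u x / bdist \<Omega> x powr s" if "x \<in> \<Omega>" for x
    using that pos[OF that] closure_subset[of \<Omega>]
    by (auto simp: C0s_pos_def w_def pos_le_divide_eq)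
  then have "\<epsilon> / 2 \<le> (INF x\<in>\<Omega>. u x / bdist \<Omega> x powr s)"
    using \<Omega>(3) by (intro cINF_greatest) auto
  then show "u \<in> {u \<in> C0s_pos s \<Omega>. 0 < (INF x\<in>\<Omega>. u x / bdist \<Omega> x powr s)}"
    using u \<open>\<epsilon> > 0\<close> by auto
next
  fix u assume "u \<in> {u \<in> C0s_pos s \<Omega>. 0 < (INF x\<in>\<Omega>. u x / bdist \<Omega> x powr s)}"
  then have u: "u \<in> C0s_pos s \<Omega>" and m: "0 < (INF x\<in>\<Omega>. u x / bdist \<Omega> x powr s)" (is "0 < ?m")
    by auto
  have bdd: "bdd_below ((\<lambda>x. u x / bdist \<Omega> x powr s) ` \<Omega>)"
    using u closure_subset[of \<Omega>]
    by (intro bdd_belowI2[where m = 0]) (auto simp: C0s_pos_def)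
  have "v \<in> C0s_pos s \<Omega>" if v: "v \<in> C0s s \<Omega>" and d: "norm_C0s s \<Omega> (\<lambda>x. v x - u x) < ?m" for v
  proof -
    have "0 \<le> v x" if x: "x \<in> \<Omega>" for x
    proof -
      have "\<bar>(v x - u x) / bdist \<Omega> x powr s\<bar> \<le> norm_C0s s \<Omega> (\<lambda>x. v x - u x)"
        using norm_C0s_upper[OF \<Omega>(2) C0s_diff x] u v by (auto simp: C0s_pos_def)
      also have "\<dots> < u x / bdist \<Omega> x powr s"
        using d cINF_lower[OF bdd x] by simp
      finally have "0 < v x / bdist \<Omega> x powr s"
        by (simp add: diff_divide_distrib abs_if split: if_splits)
      then show ?thesis
        by (simp add: zero_less_divide_iff)
    qed
    then have "0 \<le> v x" if "x \<in> closure \<Omega>" for x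
      using continuous_ge_on_closure[of \<Omega> v x 0] v that by (auto simp: C0s_def)
    then show ?thesis
      using v by (simp add: C0s_pos_def)
  qed
  then show "u \<in> int_C0s_pos s \<Omega>"
    unfolding int_C0s_pos_def using u m by blast
qed

end

theory Submission
  imports Defs
begin

text \<open>
  The bound is obtained by comparing \<open>u\<close> from below, on every ball contained in \<open>\<Omega>\<close> and away from
  a fixed small ball where \<open>u\<close> is bounded below, with a small multiple of the profile
  \<open>(R\<^sup>2 - |y - z|\<^sup>2)\<close> to the power \<open>s\<close>, extended by \<open>0\<close> outside the ball of centre \<open>z\<close> and radius \<open>R\<close>.
  Such a comparison needs an upper bound for the nonlinear operator on the profile, and this bound is
  reduced to one dimension.

  On every line through the ball the profile restricts to a constant times the profile of an
  interval, \<open>(l\<^sup>2 - t\<^sup>2)\<close> to the power \<open>s\<close>, and Lebesgue measure on the space disintegrates along the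
  lines through a point (\<open>nn_integral_radial\<close>).  On an interval, \<open>l\<^sup>2 - t\<^sup>2\<close> lies below each of its
  tangents.  The positive part of a tangent to the power \<open>s\<close> is a half-line profile, for which the
  truncated operator is nonpositive (\<open>halfline_profile\<close>): inversion about the point of evaluation
  exchanges the contributions of the points below and above it up to an exact derivative.  The price
  of replacing the parabola by its tangent is controlled by an integrable weight whose integral does
  not depend on the position of the point (\<open>tangent_error\<close>).  An interval of half-length \<open>l\<close> scales
  with the factor \<open>l\<close> to the power \<open>s(p - 2)\<close>, which stays bounded for short chords because \<open>p \<ge> 2\<close>.
  Hence the truncated operators of the ball profile are bounded above, uniformly in the ball, the
  point and the truncation (\<open>truncated_ball_profile_le\<close>).

  In the comparison (\<open>barrier_comparison\<close>) the test function is the positive part \<open>\<phi>\<close> of \<open>\<eta>v - u\<close>,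
  where \<open>v\<close> is a Lipschitz version of the profile.  Since \<open>v\<close> vanishes on the small ball while \<open>u\<close> is
  bounded below there, the nonlocal interaction with that ball gives a term \<open>-c\<integral>\<phi>\<close> with \<open>c > 0\<close> independent of \<open>\<eta>\<close>.
  It beats the operator of \<open>\<eta>v\<close>, which is of order \<open>\<eta>\<close> to the power \<open>p - 1\<close>, and also \<open>g(u) - g(0)\<close>,
  which is small wherever \<open>\<phi> > 0\<close>, since there \<open>0 \<le> u < \<eta>v\<close>.  So \<open>\<phi> = 0\<close> for small \<open>\<eta>\<close>, with the same
  \<open>\<eta>\<close> for all balls of bounded radius.

  Balls around interior points give positivity of \<open>u\<close> in \<open>\<Omega>\<close>.  Near a boundary point the regularity
  of the boundary gives balls of one fixed radius with \<open>R\<^sup>2 - |x - z|\<^sup>2\<close> at least a multiple of the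
  distance of \<open>x\<close> to the complement (\<open>interior_balls_near_boundary_point\<close>), hence the bound by the
  \<open>s\<close>-th power of the distance.  Compactness of the closure of \<open>\<Omega>\<close> makes the local bounds uniform.
\<close>

section \<open>The odd power\<close>

text \<open>
  The odd increasing function with absolute value \<open>|a|\<close> to the power \<open>p - 1\<close>, written with the factors
  of the integrand of \<^const>\<open>frac_p_laplacian\<close>, so that the two agree also for \<open>p = 2\<close> and \<open>a = 0\<close>,
  where \<open>0 powr 0 = 0\<close>.
\<close>

definition Jp :: "real \<Rightarrow> real \<Rightarrow> real" where
  "Jp p a = \<bar>a\<bar> powr (p - 2) * a"

lemma Jp_nonneg_eq: "0 \<le> a \<Longrightarrow> Jp p a = a powr (p - 1)"
  using powr_add[of a "p - 2" 1] by (cases "a = 0") (auto simp: Jp_def)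

lemma Jp_minus: "Jp p (- a) = - Jp p a"
  by (simp add: Jp_def)

lemma Jp_0 [simp]: "Jp p 0 = 0"
  by (simp add: Jp_def)

lemma Jp_nonneg: "0 \<le> a \<Longrightarrow> 0 \<le> Jp p a"
  by (simp add: Jp_def)

lemma Jp_abs: "\<bar>Jp p a\<bar> = \<bar>a\<bar> powr (p - 1)"
  using Jp_nonneg_eq[of "\<bar>a\<bar>" p] by (simp add: Jp_def abs_mult)

lemma Jp_mono:
  assumes "1 \<le> p" "a \<le> b"
  shows "Jp p a \<le> Jp p b"
proof -
  consider "0 \<le> a" | "a < 0" "0 \<le> b" | "b < 0" by linarith
  then show ?thesis
  proof cases
    case 1
    then show ?thesis using assms by (simp add: Jp_nonneg_eq powr_mono2)
  next
    case 2
    then have "Jp p a \<le> 0" using Jp_nonneg[of "- a" p] by (simp add: Jp_minus)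
    then show ?thesis using Jp_nonneg[OF 2(2), of p] by linarith
  next
    case 3
    then have "Jp p (- b) \<le> Jp p (- a)" using assms by (simp add: Jp_nonneg_eq powr_mono2)
    then show ?thesis by (simp add: Jp_minus)
  qed
qed

lemma Jp_scale: "0 \<le> c \<Longrightarrow> Jp p (c * a) = c powr (p - 1) * Jp p a"
  using Jp_nonneg_eq[of c p] by (auto simp: Jp_def abs_mult powr_mult)

lemma Jp_borel [measurable]: "Jp p \<in> borel_measurable borel"
  unfolding Jp_def by measurable

lemma powr_diff_le:
  fixes a b q :: real
  assumes "1 \<le> q" "0 \<le> a" "a \<le> b"
  shows "b powr q - a powr q \<le> q * b powr (q - 1) * (b - a)"
proof (cases "a = b")
  case False
  then have "a < b" using assms by simp
  have "\<exists>l z. z > a \<and> z < b \<and> ((\<lambda>x. x powr q) has_real_derivative l) (at z)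
      \<and> b powr q - a powr q = (b - a) * l"
    using \<open>a < b\<close> assms
    by (intro MVT continuous_on_powr' continuous_on_id continuous_on_const)
      (auto intro!: derivative_eq_intros exI simp: real_differentiable_def)
  then obtain l z where z: "z > a" "z < b" "((\<lambda>x. x powr q) has_real_derivative l) (at z)"
      "b powr q - a powr q = (b - a) * l"
    by blast
  have "((\<lambda>x. x powr q) has_real_derivative q * z powr (q - 1)) (at z)"
    using z assms by (auto intro!: derivative_eq_intros)
  then have "l = q * z powr (q - 1)" using z(3) DERIV_unique by blast
  moreover have "z powr (q - 1) \<le> b powr (q - 1)" using z assms by (intro powr_mono2) auto
  ultimately have "l \<le> q * b powr (q - 1)" using assms by (simp add: mult_left_mono)
  then show ?thesis using z(4) \<open>a < b\<close> by (simp add: mult.commute mult_left_mono)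
qed auto

lemma Jp_diff_le:
  assumes p: "2 \<le> p" and ab: "a \<le> b" "\<bar>a\<bar> \<le> M" "\<bar>b\<bar> \<le> M"
  shows "Jp p b - Jp p a \<le> (p - 1) * M powr (p - 2) * (b - a)"
proof -
  have pos: "Jp p d - Jp p c \<le> (p - 1) * M powr (p - 2) * (d - c)" if "0 \<le> c" "c \<le> d" "d \<le> M" for c d
  proof -
    have "Jp p d - Jp p c \<le> (p - 1) * d powr (p - 2) * (d - c)"
      using powr_diff_le[of "p - 1" c d] that p by (simp add: Jp_nonneg_eq)
    also have "\<dots> \<le> (p - 1) * M powr (p - 2) * (d - c)"
      using that p by (intro mult_right_mono mult_left_mono powr_mono2) auto
    finally show ?thesis .
  qed
  consider "0 \<le> a" | "a < 0" "0 \<le> b" | "b < 0" by linarith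
  then show ?thesis
  proof cases
    case 1
    then show ?thesis using pos[of a b] ab by simp
  next
    case 2
    have "Jp p b - Jp p a = (Jp p b - Jp p 0) + (Jp p (- a) - Jp p 0)" by (simp add: Jp_minus)
    also have "\<dots> \<le> (p - 1) * M powr (p - 2) * (b - 0) + (p - 1) * M powr (p - 2) * (- a - 0)"
      using 2 ab by (intro add_mono pos) auto
    finally show ?thesis by (simp add: algebra_simps)
  next
    case 3
    then show ?thesis using pos[of "- b" "- a"] ab by (simp add: Jp_minus algebra_simps)
  qed
qed

section \<open>Powers with exponent at most one\<close>

lemma powr_le_self_of_le_1:
  fixes x s :: real
  assumes "0 \<le> x" "x \<le> 1" "0 < s" "s \<le> 1"
  shows "x \<le> x powr s"
  using powr_mono'[of s 1 x] assms by simp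

lemma powr_add_subadditive:
  fixes a b s :: real
  assumes "0 \<le> a" "0 \<le> b" "0 < s" "s \<le> 1"
  shows "(a + b) powr s \<le> a powr s + b powr s"
proof (cases "a + b = 0")
  case False
  then have c: "0 < a + b" using assms by simp
  have "1 = a / (a + b) + b / (a + b)" using c by (simp add: add_divide_distrib[symmetric])
  also have "\<dots> \<le> (a / (a + b)) powr s + (b / (a + b)) powr s"
    using assms c by (intro add_mono powr_le_self_of_le_1) auto
  also have "\<dots> = (a powr s + b powr s) / (a + b) powr s"
    using assms c by (simp add: powr_divide add_divide_distrib)
  finally show ?thesis using c by (simp add: pos_le_divide_eq)
qed (use assms in auto)

lemma powr_diff_abs_le:
  fixes X Y s :: real
  assumes "0 \<le> X" "0 \<le> Y" "0 < s" "s \<le> 1"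
  shows "\<bar>X powr s - Y powr s\<bar> \<le> \<bar>X - Y\<bar> powr s"
  using powr_add_subadditive[of Y "X - Y" s] powr_add_subadditive[of X "Y - X" s]
    powr_mono2[of s X Y] powr_mono2[of s Y X] assms
  by (cases "X \<le> Y") (auto simp: abs_if)

text \<open>
  Concavity at \<open>X\<close>, in a form that remains valid when \<open>X - D\<close> has become negative.  This makes it
  possible to treat points on both sides of an end point of an interval at once.
\<close>

lemma powr_diff_le_tangent:
  fixes X D s :: real
  assumes "0 < X" "0 \<le> D" "0 < s" "s \<le> 1"
  shows "X powr s - (max 0 (X - D)) powr s \<le> X powr (s - 1) * D"
proof (cases "D \<le> X")
  case True
  have "(X - D) / X \<le> ((X - D) / X) powr s"
    using assms True by (intro powr_le_self_of_le_1) auto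
  also have "\<dots> = (X - D) powr s / X powr s" using assms True by (simp add: powr_divide)
  finally have "(X - D) / X * X powr s \<le> (X - D) powr s"
    using assms by (simp add: pos_le_divide_eq)
  moreover have "(X - D) / X * X powr s = X powr s - X powr (s - 1) * D"
    using assms by (simp add: powr_diff field_simps)
  ultimately show ?thesis using True by simp
next
  case False
  have "X powr s = X powr (s - 1) * X" using assms by (simp add: powr_diff)
  also have "\<dots> \<le> X powr (s - 1) * D" using False by (intro mult_left_mono) auto
  finally show ?thesis using False by (simp add: max_def)
qed

lemma has_bochner_integral_of_has_integral_nonneg:
  fixes f :: "real \<Rightarrow> real"
  assumes "(f has_integral r) S" "\<And>x. x \<in> S \<Longrightarrow> 0 \<le> f x" "0 \<le> r"
    and [measurable]: "f \<in> borel_measurable borel" "S \<in> sets borel"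
  shows "has_bochner_integral lborel (\<lambda>x. indicator S x * f x) r"
proof (rule has_bochner_integral_nn_integral)
  show "AE x in lborel. 0 \<le> indicator S x * f x"
    using assms(2) by (auto simp: indicator_def)
  show "(\<integral>\<^sup>+ x. ennreal (indicator S x * f x) \<partial>lborel) = ennreal r"
    using nn_integral_has_integral_lebesgue[OF assms(2,1)] .
qed (use assms in auto)

lemma has_bochner_integral_powr_tail:
  fixes a e :: real
  assumes "e < -1" "a > 0"
  shows "has_bochner_integral lborel (\<lambda>r. indicator {a..} r * r powr e) (a powr (e + 1) / (- (e + 1)))"
proof -
  have "((\<lambda>r. r powr e) has_integral (a powr (e + 1) / (- (e + 1)))) {a..}"
    using has_integral_powr_to_inf[OF assms] by (metis minus_divide_left minus_divide_right)
  then show ?thesis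
    using assms by (intro has_bochner_integral_of_has_integral_nonneg) (auto simp: divide_nonneg_nonpos)
qed

lemma has_bochner_integral_powr_near_0:
  fixes c e :: real
  assumes "-1 < e" "0 \<le> c"
  shows "has_bochner_integral lborel (\<lambda>r. indicator {0..c} r * r powr e) (c powr (e + 1) / (e + 1))"
  using assms by (intro has_bochner_integral_of_has_integral_nonneg has_integral_powr_from_0) auto

section \<open>The half-line profile\<close>

text \<open>
  For the function \<open>x \<mapsto> x\<^sup>s\<close> on the positive half-line, extended by \<open>0\<close>, and the point \<open>1\<close>, the two defects
  are, up to sign and kernel, the contributions of the points \<open>1 - r\<close> and \<open>1 + r\<close> to the operator at \<open>1\<close>.
\<close>

definition defect_below :: "real \<Rightarrow> real \<Rightarrow> real \<Rightarrow> real" where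
  "defect_below s p r = (1 - (max 0 (1 - r)) powr s) powr (p - 1)"

definition defect_above :: "real \<Rightarrow> real \<Rightarrow> real \<Rightarrow> real" where
  "defect_above s p r = ((1 + r) powr s - 1) powr (p - 1)"

text \<open>
  The \<open>p\<close>-th power of \<open>(1 - x\<^sup>s) / (1 - x)\<^sup>s\<close> at \<open>x = 1 - \<rho>\<close>.  Its derivative is what remains of the
  difference of the two defects after an inversion.
\<close>

definition ratio_pow :: "real \<Rightarrow> real \<Rightarrow> real \<Rightarrow> real" where
  "ratio_pow s p \<rho> = (1 - (1 - \<rho>) powr s) powr p * \<rho> powr (- (p * s))"

locale frac_exponents =
  fixes s p :: real
  assumes s: "0 < s" "s < 1" and p: "2 \<le> p"
begin

lemma powr_one_minus_bounds:
  assumes "0 < \<rho>" "\<rho> < 1"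
  shows "0 < 1 - (1 - \<rho>) powr s" "1 - (1 - \<rho>) powr s \<le> \<rho>"
proof -
  have "(1 - \<rho>) powr s < 1 powr s" using assms s by (intro powr_less_mono2) auto
  then show "0 < 1 - (1 - \<rho>) powr s" by simp
  show "1 - (1 - \<rho>) powr s \<le> \<rho>"
    using powr_le_self_of_le_1[of "1 - \<rho>" s] assms s by simp
qed

lemma ratio_pow_deriv:
  assumes r: "0 < \<rho>" "\<rho> < 1"
  shows "(ratio_pow s p has_real_derivative
    p * s * ((1 - (1 - \<rho>) powr s) powr (p - 1) * \<rho> powr (- 1 - p * s) * ((1 - \<rho>) powr (s - 1) - 1))) (at \<rho>)"
proof -
  let ?a = "1 - (1 - \<rho>) powr s"
  have a: "0 < ?a" using powr_one_minus_bounds r by auto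
  have e1: "?a powr p = ?a powr (p - 1) * ?a"
    using a powr_add[of ?a "p - 1" 1] by simp
  have e2: "\<rho> powr (- (p * s)) = \<rho> powr (- 1 - p * s) * \<rho>"
    using r powr_add[of \<rho> "- 1 - p * s" 1] by simp
  have e3: "(1 - \<rho>) powr s = (1 - \<rho>) powr (s - 1) * (1 - \<rho>)"
    using r powr_add[of "1 - \<rho>" "s - 1" 1] by simp
  have "(ratio_pow s p has_real_derivative
     p * ?a powr (p - 1) * (s * (1 - \<rho>) powr (s - 1)) * \<rho> powr (- (p * s))
      + ?a powr p * (- (p * s) * \<rho> powr (- (p * s) - 1))) (at \<rho>)"
  proof -
    have d: "((\<lambda>\<rho>. 1 - (1 - \<rho>) powr s) has_real_derivative s * (1 - \<rho>) powr (s - 1)) (at \<rho>)"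
      using DERIV_diff[OF DERIV_const DERIV_fun_powr[OF DERIV_diff[OF DERIV_const DERIV_ident], of 1 \<rho> s], of 1] r
      by simp
    show ?thesis
      unfolding ratio_pow_def
      using DERIV_mult[OF DERIV_fun_powr[OF d a, of p] DERIV_fun_powr[OF DERIV_ident r(1), of "- (p * s)"]]
      by (simp add: algebra_simps)
  qed
  moreover have "p * ?a powr (p - 1) * (s * (1 - \<rho>) powr (s - 1)) * \<rho> powr (- (p * s))
      + ?a powr p * (- (p * s) * \<rho> powr (- (p * s) - 1))
     = p * s * (?a powr (p - 1) * \<rho> powr (- 1 - p * s)) * ((1 - \<rho>) powr (s - 1) * \<rho> - ?a)"
  proof -
    have "- (p * s) - 1 = - 1 - p * s" by simp
    then show ?thesis unfolding e1 e2 by (simp only:) (simp add: algebra_simps)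
  qed
  moreover have "(1 - \<rho>) powr (s - 1) * \<rho> - ?a = (1 - \<rho>) powr (s - 1) - 1"
    unfolding e3 by (simp add: algebra_simps)
  ultimately show ?thesis by (simp add: mult.assoc)
qed

lemma defect_borel [measurable]:
  "defect_below s p \<in> borel_measurable borel" "defect_above s p \<in> borel_measurable borel"
  unfolding defect_below_def defect_above_def by measurable

lemma defect_below_le_1: "0 \<le> r \<Longrightarrow> defect_below s p r \<le> 1"
  unfolding defect_below_def
  using s p powr_mono2[of s "max 0 (1 - r)" 1] by (intro powr_le1) auto

lemma defect_above_le:
  assumes "0 \<le> r" shows "defect_above s p r \<le> r powr (s * (p - 1))"
proof -
  have "(1 + r) powr s - 1 \<le> r powr s" using powr_add_subadditive[of 1 r s] assms s by simp
  moreover have "1 powr s \<le> (1 + r) powr s" using assms s by (intro powr_mono2) auto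
  ultimately show ?thesis
    unfolding defect_above_def powr_powr[symmetric] using p by (intro powr_mono2) auto
qed

lemma integrable_defect_below:
  assumes "0 < \<delta>"
  shows "integrable lborel (\<lambda>r. indicator {\<delta>..} r * (defect_below s p r * r powr (- 1 - p * s)))"
proof (rule Bochner_Integration.integrable_bound)
  show "integrable lborel (\<lambda>r. indicator {\<delta>..} r * r powr (- 1 - p * s))"
    using has_bochner_integral_powr_tail[of "- 1 - p * s" \<delta>] assms s p
    by (auto simp: has_bochner_integral_iff)
  show "AE r in lborel. norm (indicator {\<delta>..} r * (defect_below s p r * r powr (- 1 - p * s)))
      \<le> norm (indicator {\<delta>..} r * r powr (- 1 - p * s))"
    using defect_below_le_1 assms
    by (auto simp: indicator_def defect_below_def abs_mult mult_left_le_one_le)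
qed measurable

lemma integrable_defect_above:
  assumes "0 < \<delta>"
  shows "integrable lborel (\<lambda>r. indicator {\<delta>..} r * (defect_above s p r * r powr (- 1 - p * s)))"
proof (rule Bochner_Integration.integrable_bound)
  show "integrable lborel (\<lambda>r. indicator {\<delta>..} r * r powr (- 1 - s))"
    using has_bochner_integral_powr_tail[of "- 1 - s" \<delta>] assms s p
    by (auto simp: has_bochner_integral_iff)
  have "defect_above s p r * r powr (- 1 - p * s) \<le> r powr (- 1 - s)" if "\<delta> \<le> r" for r
  proof -
    have "defect_above s p r * r powr (- 1 - p * s) \<le> r powr (s * (p - 1)) * r powr (- 1 - p * s)"
      using defect_above_le that assms by (intro mult_right_mono) auto
    also have "\<dots> = r powr (- 1 - s)" by (simp add: powr_add[symmetric] algebra_simps)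
    finally show ?thesis .
  qed
  then show "AE r in lborel. norm (indicator {\<delta>..} r * (defect_above s p r * r powr (- 1 - p * s)))
      \<le> norm (indicator {\<delta>..} r * r powr (- 1 - s))"
    by (auto simp: indicator_def abs_mult defect_above_def)
qed measurable

text \<open>
  The substitution \<open>1 + r = 1 / (1 - \<rho>)\<close> is the inversion \<open>x \<mapsto> 1 / x\<close>, which exchanges the points above
  and below \<open>1\<close>.  It turns the upper defect into the lower one times \<open>(1 - \<rho>) powr (s - 1)\<close>.
\<close>

lemma defect_above_inversion:
  assumes "0 < \<rho>" "\<rho> < 1"
  shows "defect_above s p (\<rho> / (1 - \<rho>)) * (\<rho> / (1 - \<rho>)) powr (- 1 - p * s) * (1 / (1 - \<rho>)\<^sup>2)
     = (1 - (1 - \<rho>) powr s) powr (p - 1) * \<rho> powr (- 1 - p * s) * (1 - \<rho>) powr (s - 1)"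
proof -
  let ?q = "1 - \<rho>"
  have q: "0 < ?q" using assms by simp
  have "1 + \<rho> / ?q = 1 / ?q" using q by (simp add: field_simps)
  then have "(1 + \<rho> / ?q) powr s - 1 = (1 - ?q powr s) * ?q powr (- s)"
    using q by (simp add: powr_divide powr_minus field_simps)
  then have e1: "defect_above s p (\<rho> / ?q) = (1 - ?q powr s) powr (p - 1) * ?q powr (- s * (p - 1))"
    unfolding defect_above_def using powr_one_minus_bounds assms
    by (simp add: powr_mult powr_powr)
  have e2: "(\<rho> / ?q) powr (- 1 - p * s) = \<rho> powr (- 1 - p * s) * ?q powr (1 + p * s)"
    using assms q powr_minus_divide[of ?q "- 1 - p * s"] by (simp add: powr_divide add.commute)
  have e3: "1 / ?q\<^sup>2 = ?q powr (- 2)"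
    using q by (simp add: powr_minus powr_numeral inverse_eq_divide)
  have "- s * (p - 1) + (1 + p * s) + - 2 = s - 1" by (simp add: algebra_simps)
  then have e4: "?q powr (- s * (p - 1)) * ?q powr (1 + p * s) * ?q powr (- 2) = ?q powr (s - 1)"
    by (simp only: powr_add[symmetric])
  have "(1 - ?q powr s) powr (p - 1) * ?q powr (- s * (p - 1)) * (\<rho> powr (- 1 - p * s) * ?q powr (1 + p * s)) * ?q powr (- 2)
     = (1 - ?q powr s) powr (p - 1) * \<rho> powr (- 1 - p * s) * (?q powr (- s * (p - 1)) * ?q powr (1 + p * s) * ?q powr (- 2))"
    by (simp only: ac_simps)
  then show ?thesis unfolding e1 e2 e3 e4 .
qed

text \<open>
  The truncated operator of the half-line profile at the point \<open>1\<close>, with the contributions of \<open>1 - r\<close> and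
  \<open>1 + r\<close> under one integral, so that they can cancel as \<open>\<delta>\<close> tends to \<open>0\<close>.
\<close>

definition halfline_operator :: "real \<Rightarrow> real" where
  "halfline_operator \<delta> =
    (\<integral>r. indicator {\<delta>..} r * ((defect_below s p r - defect_above s p r) * r powr (- 1 - p * s)) \<partial>lborel)"

text \<open>
  Inversion maps \<open>[\<delta>, b]\<close> to \<open>[\<delta> / (1 - \<delta>), b / (1 - b)]\<close>.  As \<open>\<delta> / (1 - \<delta>) \<ge> \<delta>\<close>, restricting the integral of
  the upper defect to the image only decreases it; after the substitution the difference of the two
  integrals is that of an exact derivative.  The remaining terms come from the points of \<open>[0, 1 - b]\<close>
  and of the negative half-line.
\<close>

lemma truncated_halfline_le_ratio_pow:
  assumes d: "0 < \<delta>" "\<delta> < b" "b < 1"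
  shows "halfline_operator \<delta>
    \<le> (1 - b) * b powr (- 1 - p * s) + 1 / (p * s) - (ratio_pow s p b - ratio_pow s p \<delta>) / (p * s)"
proof -
  let ?k = "\<lambda>r::real. r powr (- 1 - p * s)"
  define a where "a = (\<lambda>\<rho>. (1 - (1 - \<rho>) powr s) powr (p - 1) * \<rho> powr (- 1 - p * s))"
  define w where "w = (\<lambda>\<rho>. (1 - \<rho>) powr (s - 1))"
  let ?g = "\<lambda>\<rho>::real. \<rho> / (1 - \<rho>)"
  have ps: "0 < p * s" using s p by simp
  have bnd: "0 < 1 - (1 - \<rho>) powr s" if "\<rho> \<in> {\<delta>..b}" for \<rho>
    using powr_one_minus_bounds[of \<rho>] that d by auto
  have cont_a: "continuous_on {\<delta>..b} a"
    unfolding a_def using bnd d by (intro continuous_intros) (auto simp: less_imp_neq)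
  have cont_w: "continuous_on {\<delta>..b} w"
    unfolding w_def using d by (intro continuous_intros) auto
  have int_a: "integrable lborel (\<lambda>\<rho>. indicator {\<delta>..b} \<rho> * a \<rho>)"
    and int_aw: "integrable lborel (\<lambda>\<rho>. indicator {\<delta>..b} \<rho> * (a \<rho> * w \<rho>))"
    using borel_integrable_compact[OF compact_Icc cont_a]
      borel_integrable_compact[OF compact_Icc continuous_on_mult[OF cont_a cont_w]] by auto
  have int_k: "has_bochner_integral lborel (\<lambda>r. indicator {1..} r * ?k r) (1 / (p * s))"
    using has_bochner_integral_powr_tail[of "- 1 - p * s" 1] ps by simp
  have int_c: "has_bochner_integral lborel (\<lambda>r. indicator {b..1} r * b powr (- 1 - p * s)) ((1 - b) * b powr (- 1 - p * s))"
    using d has_bochner_integral_mult_left[OF has_bochner_integral_real_indicator[of "{b..1}" lborel], of "b powr (- 1 - p * s)"]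
    by simp
  have "(\<integral>r. indicator {\<delta>..} r * (defect_below s p r * ?k r) \<partial>lborel)
    \<le> (\<integral>r. indicator {\<delta>..b} r * a r + indicator {b..1} r * b powr (- 1 - p * s) + indicator {1..} r * ?k r \<partial>lborel)"
  proof (rule integral_mono)
    fix r
    consider "r < \<delta>" | "r \<in> {\<delta>..b}" | "b < r" "r \<le> 1" | "1 < r" by fastforce
    then show "indicator {\<delta>..} r * (defect_below s p r * ?k r)
      \<le> indicator {\<delta>..b} r * a r + indicator {b..1} r * b powr (- 1 - p * s) + indicator {1..} r * ?k r"
    proof cases
      case 3
      have "defect_below s p r * ?k r \<le> 1 * b powr (- 1 - p * s)"
        using 3 d ps defect_below_le_1[of r]
        by (intro mult_mono powr_mono2') (auto simp: defect_below_def)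
      then show ?thesis using 3 d by (auto simp: indicator_def)
    next
      case 4
      then show ?thesis using d defect_below_le_1[of r] by (auto simp: mult_left_le_one_le defect_below_def)
    qed (use d in \<open>auto simp: defect_below_def a_def indicator_def\<close>)
  qed (use int_a int_k int_c integrable_defect_below d in \<open>auto simp: has_bochner_integral_iff\<close>)
  also have "\<dots> = (\<integral>r. indicator {\<delta>..b} r * a r \<partial>lborel) + (1 - b) * b powr (- 1 - p * s) + 1 / (p * s)"
    using int_a int_k int_c by (simp add: has_bochner_integral_iff)
  finally have A: "(\<integral>r. indicator {\<delta>..} r * (defect_below s p r * ?k r) \<partial>lborel)
    \<le> (\<integral>r. indicator {\<delta>..b} r * a r \<partial>lborel) + (1 - b) * b powr (- 1 - p * s) + 1 / (p * s)" .

  have g_ge: "\<delta> \<le> ?g \<delta>" "0 < ?g \<delta>" using d by (auto simp: field_simps)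
  have int_B': "integrable lborel (\<lambda>r. indicator {?g \<delta>..?g b} r * (defect_above s p r * ?k r))"
  proof (rule Bochner_Integration.integrable_bound[OF integrable_defect_above[OF d(1)]])
    show "AE r in lborel. norm (indicator {?g \<delta>..?g b} r * (defect_above s p r * ?k r))
       \<le> norm (indicator {\<delta>..} r * (defect_above s p r * ?k r))"
      using g_ge by (auto simp: indicator_def)
  qed measurable
  have "(\<integral>r. (defect_above s p r * ?k r) * indicator {?g \<delta>..?g b} r \<partial>lborel)
    = (\<integral>\<rho>. (defect_above s p (?g \<rho>) * ?k (?g \<rho>)) * (1 / (1 - \<rho>)\<^sup>2) * indicator {\<delta>..b} \<rho> \<partial>lborel)"
  proof (rule integral_substitution(2))
    show "set_integrable lborel {?g \<delta>..?g b} (\<lambda>r. defect_above s p r * ?k r)"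
      using int_B' by (simp add: set_integrable_def)
    show "(?g has_real_derivative 1 / (1 - x)\<^sup>2) (at x)" if "x \<in> {\<delta>..b}" for x
      using that d by (auto intro!: derivative_eq_intros simp: power2_eq_square field_simps)
    show "continuous_on {\<delta>..b} (\<lambda>x. 1 / (1 - x)\<^sup>2)" using d by (intro continuous_intros) auto
  qed (use d in auto)
  also have "\<dots> = (\<integral>\<rho>. indicator {\<delta>..b} \<rho> * (a \<rho> * w \<rho>) \<partial>lborel)"
  proof (rule Bochner_Integration.integral_cong[OF refl])
    fix \<rho>
    show "(defect_above s p (?g \<rho>) * ?k (?g \<rho>)) * (1 / (1 - \<rho>)\<^sup>2) * indicator {\<delta>..b} \<rho>
      = indicator {\<delta>..b} \<rho> * (a \<rho> * w \<rho>)"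
      using defect_above_inversion[of \<rho>] d unfolding a_def w_def
      by (cases "\<rho> \<in> {\<delta>..b}") auto
  qed
  finally have sub: "(\<integral>r. indicator {?g \<delta>..?g b} r * (defect_above s p r * ?k r) \<partial>lborel)
    = (\<integral>\<rho>. indicator {\<delta>..b} \<rho> * (a \<rho> * w \<rho>) \<partial>lborel)" by (simp add: mult.commute)
  have B: "(\<integral>\<rho>. indicator {\<delta>..b} \<rho> * (a \<rho> * w \<rho>) \<partial>lborel)
      \<le> (\<integral>r. indicator {\<delta>..} r * (defect_above s p r * ?k r) \<partial>lborel)"
    unfolding sub[symmetric]
    using int_B' integrable_defect_above[OF d(1)] g_ge
    by (intro integral_mono) (auto simp: indicator_def defect_above_def)

  have "(\<integral>x. (p * s * (a x * (w x - 1))) * indicator {\<delta>..b} x \<partial>lborel) = ratio_pow s p b - ratio_pow s p \<delta>"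
  proof (rule integral_FTC_Icc_real)
    show "DERIV (ratio_pow s p) x :> p * s * (a x * (w x - 1))" if "\<delta> \<le> x" "x \<le> b" for x
      unfolding a_def w_def using ratio_pow_deriv[of x] that d by simp
    show "isCont (\<lambda>x. p * s * (a x * (w x - 1))) x" if "\<delta> \<le> x" "x \<le> b" for x
      unfolding a_def w_def using that d bnd[of x] by (intro continuous_intros) (auto simp: less_imp_neq)
  qed (use d in auto)
  moreover have "(\<integral>x. (p * s * (a x * (w x - 1))) * indicator {\<delta>..b} x \<partial>lborel)
     = (\<integral>x. p * s * (indicator {\<delta>..b} x * (a x * w x) - indicator {\<delta>..b} x * a x) \<partial>lborel)"
    by (intro Bochner_Integration.integral_cong) (auto simp: algebra_simps)
  ultimately have "p * s * ((\<integral>\<rho>. indicator {\<delta>..b} \<rho> * (a \<rho> * w \<rho>) \<partial>lborel) - (\<integral>r. indicator {\<delta>..b} r * a r \<partial>lborel))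
     = ratio_pow s p b - ratio_pow s p \<delta>"
    using int_a int_aw by simp
  then have C: "(\<integral>\<rho>. indicator {\<delta>..b} \<rho> * (a \<rho> * w \<rho>) \<partial>lborel) - (\<integral>r. indicator {\<delta>..b} r * a r \<partial>lborel)
     = (ratio_pow s p b - ratio_pow s p \<delta>) / (p * s)"
    using ps by (metis nonzero_mult_div_cancel_left less_irrefl)
  have "(\<integral>r. indicator {\<delta>..} r * ((defect_below s p r - defect_above s p r) * ?k r) \<partial>lborel)
    = (\<integral>r. indicator {\<delta>..} r * (defect_below s p r * ?k r) \<partial>lborel)
      - (\<integral>r. indicator {\<delta>..} r * (defect_above s p r * ?k r) \<partial>lborel)"
    using integrable_defect_above[OF d(1)] integrable_defect_below[OF d(1)]
    by (subst Bochner_Integration.integral_diff[symmetric]) (auto simp: algebra_simps)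
  then show ?thesis unfolding halfline_operator_def using A B C by linarith
qed

text \<open>
  As \<open>b\<close> tends to \<open>1\<close>, the boundary value \<open>1\<close> of \<^const>\<open>ratio_pow\<close> cancels the contribution
  \<open>1 / (p * s)\<close> of the negative half-line.
\<close>

lemma truncated_halfline_le:
  assumes d: "0 < \<delta>" "\<delta> < 1"
  shows "halfline_operator \<delta>
    \<le> \<delta> powr (p * (1 - s)) / (p * s)"
proof -
  have ps: "0 < p * s" using s p by simp
  have "((\<lambda>b. (1 - b) * b powr (- 1 - p * s) + 1 / (p * s) - (ratio_pow s p b - ratio_pow s p \<delta>) / (p * s))
     \<longlongrightarrow> (1 - 1) * 1 powr (- 1 - p * s) + 1 / (p * s)
        - ((1 - 0 powr s) powr p * 1 powr (- (p * s)) - ratio_pow s p \<delta>) / (p * s)) (at_left 1)"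
  proof -
    have "((\<lambda>b::real. (1 - b) powr s) \<longlongrightarrow> 0 powr s) (at_left 1)"
    proof (rule tendsto_powr')
      show "((\<lambda>b::real. 1 - b) \<longlongrightarrow> 0) (at_left 1)" by (auto intro!: tendsto_eq_intros)
      show "(0::real) \<noteq> 0 \<or> (s > 0 \<and> eventually (\<lambda>b::real. 0 \<le> 1 - b) (at_left 1))"
        using s eventually_at_left_real[of 0 1] by (auto elim!: eventually_mono)
    qed auto
    then have "(ratio_pow s p \<longlongrightarrow> (1 - 0 powr s) powr p * 1 powr (- (p * s))) (at_left 1)"
      unfolding ratio_pow_def[abs_def] using s
      by (intro tendsto_mult tendsto_powr[OF tendsto_diff[OF tendsto_const]]
          tendsto_powr[OF tendsto_ident_at] tendsto_const) auto
    then show ?thesis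
      using ps by (intro tendsto_add tendsto_mult tendsto_powr tendsto_diff tendsto_divide
          tendsto_const tendsto_ident_at) auto
  qed
  moreover have "\<forall>\<^sub>F b in at_left 1. halfline_operator \<delta>
      \<le> (1 - b) * b powr (- 1 - p * s) + 1 / (p * s) - (ratio_pow s p b - ratio_pow s p \<delta>) / (p * s)"
    using eventually_at_left_real[OF d(2)] truncated_halfline_le_ratio_pow[OF d(1)]
    by (auto elim!: eventually_mono)
  ultimately have "halfline_operator \<delta>
      \<le> (1 - 1) * 1 powr (- 1 - p * s) + 1 / (p * s)
        - ((1 - 0 powr s) powr p * 1 powr (- (p * s)) - ratio_pow s p \<delta>) / (p * s)"
    by (intro tendsto_lowerbound) auto
  also have "\<dots> = ratio_pow s p \<delta> / (p * s)" using s by (simp add: diff_divide_distrib)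
  also have "\<dots> \<le> \<delta> powr (p * (1 - s)) / (p * s)"
  proof (intro divide_right_mono)
    have "ratio_pow s p \<delta> \<le> \<delta> powr p * \<delta> powr (- (p * s))"
      unfolding ratio_pow_def using powr_one_minus_bounds[of \<delta>] d p
      by (intro mult_right_mono powr_mono2) auto
    also have "\<dots> = \<delta> powr (p * (1 - s))" by (simp add: powr_add[symmetric] algebra_simps)
    finally show "ratio_pow s p \<delta> \<le> \<delta> powr (p * (1 - s))" .
  qed (use ps in auto)
  finally show ?thesis .
qed

lemma defect_below_minus_above_sign:
  assumes "0 < r" "(1 + r) powr s \<le> 2"
  shows "defect_above s p r \<le> defect_below s p r"
proof -
  have "(1 + r) powr s + (max 0 (1 - r)) powr s \<le> 2"
  proof (cases "r \<le> 1")
    case True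
    have bern: "x powr s \<le> s * x + (1 - s)" if "0 \<le> x" for x
      using Youngs_inequality_0[of s "1 - s" x 1] that s by (cases "x = 0") auto
    show ?thesis
      using bern[of "1 + r"] bern[of "1 - r"] True assms(1) by (simp add: max_def algebra_simps)
  qed (use assms in auto)
  moreover have "1 powr s \<le> (1 + r) powr s" using assms s by (intro powr_mono2) auto
  ultimately show ?thesis
    unfolding defect_below_def defect_above_def using p by (intro powr_mono2) auto
qed

text \<open>
  By concavity the integrand is nonnegative as long as \<open>(1 + r) powr s \<le> 2\<close>, and it is nonpositive
  afterwards.  In the first range the truncated integrals thus increase as the truncation parameter
  decreases, and their upper bounds tend to \<open>0\<close>.
\<close>

lemma truncated_halfline_nonpos:
  assumes d: "0 < \<delta>"
  shows "halfline_operator \<delta> \<le> 0"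
proof -
  let ?f = "\<lambda>r. (defect_below s p r - defect_above s p r) * r powr (- 1 - p * s)"
  have ps: "0 < p * s" using s p by simp
  have int: "integrable lborel (\<lambda>r. indicator {\<delta>..} r * ?f r)" if "0 < \<delta>" for \<delta>
    using Bochner_Integration.integrable_diff[OF integrable_defect_below[OF that] integrable_defect_above[OF that]]
    by (simp add: algebra_simps)
  have anti: "halfline_operator \<delta> \<le> halfline_operator \<epsilon>" if "0 < \<epsilon>" "\<epsilon> \<le> \<delta>" "(1 + \<delta>) powr s \<le> 2" for \<epsilon> \<delta>
    unfolding halfline_operator_def
  proof (rule integral_mono)
    fix r
    have "0 \<le> ?f r" if "\<epsilon> \<le> r" "r \<le> \<delta>"
      using that \<open>0 < \<epsilon>\<close> s powr_mono2[of s "1 + r" "1 + \<delta>"] \<open>(1 + \<delta>) powr s \<le> 2\<close>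
      by (intro mult_nonneg_nonneg) (auto intro!: defect_below_minus_above_sign)
    then show "indicator {\<delta>..} r * ?f r \<le> indicator {\<epsilon>..} r * ?f r"
      using \<open>\<epsilon> \<le> \<delta>\<close> by (auto simp: indicator_def)
  qed (use int that in auto)
  show ?thesis
  proof (cases "(1 + \<delta>) powr s \<le> 2")
    case True
    have "halfline_operator \<delta> \<le> \<epsilon> powr (p * (1 - s)) / (p * s)" if "0 < \<epsilon>" "\<epsilon> < min \<delta> 1" for \<epsilon>
      using anti[of \<epsilon> \<delta>] truncated_halfline_le[of \<epsilon>] that True by simp
    then have "\<forall>\<^sub>F \<epsilon> in at_right 0. halfline_operator \<delta> \<le> \<epsilon> powr (p * (1 - s)) / (p * s)"
      using eventually_at_right_real[of 0 "min \<delta> 1"] d by (auto elim!: eventually_mono)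
    moreover have "((\<lambda>\<epsilon>. \<epsilon> powr (p * (1 - s)) / (p * s)) \<longlongrightarrow> 0 powr (p * (1 - s)) / (p * s)) (at_right 0)"
    proof (intro tendsto_divide tendsto_powr' tendsto_const)
      show "((\<lambda>x. x) \<longlongrightarrow> (0::real)) (at_right 0)" by (rule tendsto_ident_at)
      show "(0::real) \<noteq> 0 \<or> (p * (1 - s) > 0 \<and> eventually (\<lambda>b::real. 0 \<le> b) (at_right 0))"
        using s p eventually_at_right_real[of 0 1] by (auto elim!: eventually_mono)
    qed (use ps in auto)
    ultimately show ?thesis by (intro tendsto_lowerbound[where F = "at_right 0"]) auto
  next
    case False
    have "?f r \<le> 0" if "\<delta> \<le> r" for r
    proof -
      have "(1 + \<delta>) powr s \<le> (1 + r) powr s" using that d s by (intro powr_mono2) auto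
      then have "1 \<le> defect_above s p r"
        unfolding defect_above_def using False p by (intro ge_one_powr_ge_zero) auto
      then show ?thesis
        using defect_below_le_1[of r] that d by (auto intro!: mult_nonpos_nonneg)
    qed
    then have "halfline_operator \<delta> \<le> (\<integral>r. 0 \<partial>(lborel :: real measure))"
      unfolding halfline_operator_def
      using int[OF d] by (intro integral_mono) (auto simp: indicator_def)
    then show ?thesis by simp
  qed
qed

text \<open>
  The operator of the half-line profile is zero, but only in the principal value sense; for the
  truncated operators the sign is all that can be expected, and all that is needed below.
\<close>

lemma halfline_profile:
  assumes e: "0 < \<epsilon>"
  defines "F \<equiv> \<lambda>r. indicator {r. \<epsilon> \<le> \<bar>r\<bar>} r * (Jp p (1 - (max 0 (1 - r)) powr s) * \<bar>r\<bar> powr (- 1 - p * s))"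
  shows "integrable lborel F" "(\<integral>r. F r \<partial>lborel) \<le> 0"
proof -
  define A where "A = (\<lambda>r. indicator {\<epsilon>..} r * (defect_below s p r * r powr (- 1 - p * s)))"
  define B where "B = (\<lambda>r. indicator {\<epsilon>..} r * (defect_above s p r * r powr (- 1 - p * s)))"
  have A: "integrable lborel A" and B: "integrable lborel B"
    unfolding A_def B_def using integrable_defect_below[OF e] integrable_defect_above[OF e] by auto
  have B': "integrable lborel (\<lambda>r. B (0 + (-1) * r))"
    using B by (intro lborel_integrable_real_affine) auto
  have "Jp p (1 - (max 0 (1 - r)) powr s) = defect_below s p r" if "0 \<le> r" for r
    unfolding defect_below_def using that s powr_mono2[of s "max 0 (1 - r)" 1]
    by (intro Jp_nonneg_eq) auto
  moreover have "Jp p (1 - (max 0 (1 - r)) powr s) = - defect_above s p (- r)" if "r \<le> 0" for r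
  proof -
    have "1 powr s \<le> (1 - r) powr s" using that s by (intro powr_mono2) auto
    then show ?thesis
      unfolding defect_above_def using that
      by (subst minus_diff_eq[symmetric], subst Jp_minus) (simp add: Jp_nonneg_eq max_def)
  qed
  ultimately have F: "F = (\<lambda>r. A r - B (0 + (-1) * r))"
    unfolding F_def A_def B_def using e by (force simp: indicator_def fun_eq_iff)
  show "integrable lborel F" unfolding F using A B' by simp
  have "(\<integral>r. B r \<partial>lborel) = (\<integral>r. B (0 + (-1) * r) \<partial>lborel)"
    using lborel_integral_real_affine[of "-1" B 0] by simp
  then have "(\<integral>r. F r \<partial>lborel) = (\<integral>r. A r - B r \<partial>lborel)"
    unfolding F using A B B' by simp
  also have "\<dots> \<le> 0"
    using truncated_halfline_nonpos[OF e] by (simp add: halfline_operator_def A_def B_def algebra_simps)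
  finally show "(\<integral>r. F r \<partial>lborel) \<le> 0" .
qed

lemma affine_profile:
  assumes e: "0 < \<epsilon>" and q: "0 < q" and m: "0 \<le> m"
  defines "F \<equiv> \<lambda>r. indicator {r. \<epsilon> \<le> \<bar>r\<bar>} r * (Jp p (q powr s - (max 0 (q - m * r)) powr s) * \<bar>r\<bar> powr (- 1 - p * s))"
  shows "integrable lborel F" "(\<integral>r. F r \<partial>lborel) \<le> 0"
proof -
  have "integrable lborel F \<and> (\<integral>r. F r \<partial>lborel) \<le> 0"
  proof (cases "m = 0")
    case True
    then have "F = (\<lambda>_. 0)" unfolding F_def using q by (simp add: max_def)
    then show ?thesis by simp
  next
    case False
    then have m: "0 < m" using assms by simp
    define t where "t = q / m"
    have t: "0 < t" unfolding t_def using q m by simp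
    define G where "G = (\<lambda>r. indicator {r. \<epsilon> / t \<le> \<bar>r\<bar>} r * (Jp p (1 - (max 0 (1 - r)) powr s) * \<bar>r\<bar> powr (- 1 - p * s)))"
    have G: "integrable lborel G" "(\<integral>r. G r \<partial>lborel) \<le> 0"
      unfolding G_def using halfline_profile[of "\<epsilon> / t"] e t by auto
    \<comment> \<open>The dilation by the zero \<open>t\<close> of the affine function reduces to the zero \<open>1\<close>.\<close>
    define c where "c = (q powr s) powr (p - 1) * t powr (- 1 - p * s)"
    have FG: "F r = c * G (0 + (1 / t) * r)" for r
    proof -
      have "max 0 (q - m * r) = q * max 0 (1 - r / t)"
        unfolding t_def using q m by (auto simp: max_def field_simps)
      then have "q powr s - (max 0 (q - m * r)) powr s = q powr s * (1 - (max 0 (1 - r / t)) powr s)"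
        using q by (simp add: powr_mult algebra_simps)
      then have "Jp p (q powr s - (max 0 (q - m * r)) powr s)
          = (q powr s) powr (p - 1) * Jp p (1 - (max 0 (1 - r / t)) powr s)"
        by (simp add: Jp_scale)
      moreover have "\<bar>r\<bar> powr (- 1 - p * s) = t powr (- 1 - p * s) * \<bar>r / t\<bar> powr (- 1 - p * s)"
        using t by (simp add: abs_divide powr_mult[symmetric])
      moreover have "\<epsilon> / t \<le> \<bar>r / t\<bar> \<longleftrightarrow> \<epsilon> \<le> \<bar>r\<bar>"
        using t by (simp add: abs_divide divide_le_cancel)
      ultimately show ?thesis
        unfolding F_def G_def c_def by (auto simp: indicator_def)
    qed
    have c: "0 \<le> c" unfolding c_def by simp
    have "integrable lborel (\<lambda>r. G (0 + (1 / t) * r))"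
      using G t by (intro lborel_integrable_real_affine) auto
    then have 1: "integrable lborel F" unfolding FG[abs_def] by simp
    have "(\<integral>r. G r \<partial>lborel) = (1 / t) * (\<integral>r. G (0 + (1 / t) * r) \<partial>lborel)"
      using lborel_integral_real_affine[of "1 / t" G 0] t by simp
    then have "(\<integral>r. F r \<partial>lborel) = c * (t * (\<integral>r. G r \<partial>lborel))"
      unfolding FG[abs_def] using t by simp
    also have "\<dots> \<le> 0" using c t G by (intro mult_nonneg_nonpos) auto
    finally show ?thesis using 1 by simp
  qed
  then show "integrable lborel F" "(\<integral>r. F r \<partial>lborel) \<le> 0" by auto
qed

section \<open>The interval profile\<close>

text \<open>
  Integrable majorants for the error made when a parabola is replaced by its tangent.  Near the point
  of evaluation the exponent \<open>- s\<close> comes from that point itself and \<open>s - 1\<close> from the zero of the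
  tangent; far away the decay is that of the half-line profile.
\<close>

definition near_weight :: "real \<Rightarrow> real" where
  "near_weight r = indicator {-1..1} r * (\<bar>r\<bar> powr (- s) + \<bar>r\<bar> powr (s - 1))"

definition far_weight :: "real \<Rightarrow> real" where
  "far_weight r = indicator {r. 1 / 2 \<le> \<bar>r\<bar>} r * \<bar>r\<bar> powr (- 1 - s)"

lemma weight_nonneg: "0 \<le> near_weight r" "0 \<le> far_weight r"
  by (auto simp: near_weight_def far_weight_def)

lemma integrable_weights: "integrable lborel near_weight" "integrable lborel far_weight"
proof -
  define Z where "Z = (\<lambda>r::real. indicator {0..1} r * r powr (- s) + indicator {0..1} r * r powr (s - 1))"
  have Z: "integrable lborel Z"
    unfolding Z_def
    using has_bochner_integral_powr_near_0[of "- s" 1] has_bochner_integral_powr_near_0[of "s - 1" 1] s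
    by (auto simp: has_bochner_integral_iff)
  have "near_weight = (\<lambda>r. Z r + Z (0 + (-1) * r))"
    by (auto simp: near_weight_def Z_def fun_eq_iff indicator_def)
  then show "integrable lborel near_weight"
    using Z lborel_integrable_real_affine[OF Z, of "-1" 0] by simp
  define Y where "Y = (\<lambda>r::real. indicator {1 / 2..} r * r powr (- 1 - s))"
  have Y: "integrable lborel Y"
    unfolding Y_def using has_bochner_integral_powr_tail[of "- 1 - s" "1 / 2"] s
    by (auto simp: has_bochner_integral_iff)
  have "far_weight = (\<lambda>r. Y r + Y (0 + (-1) * r))"
    by (auto simp: far_weight_def Y_def fun_eq_iff indicator_def)
  then show "integrable lborel far_weight"
    using Y lborel_integrable_real_affine[OF Y, of "-1" 0] by simp
qed

text \<open>
  \<open>X\<close> is the tangent at distance \<open>r\<close>.  For small \<open>\<tau>\<close> it is bounded below.  Otherwise its slope is at least \<open>1\<close> in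
  absolute value, and with \<open>y\<close> the signed distance to its zero, the product of the two powers is at most a single
  power of \<open>|r|\<close> or of \<open>y\<close>.
\<close>

lemma tangent_error_near:
  assumes r: "r \<noteq> 0" "\<bar>r\<bar> < 1 / 2" and t: "0 \<le> \<tau>" "\<tau> < 1"
    and X: "X = 1 - \<tau>\<^sup>2 - 2 * \<tau> * r" "0 < X"
  shows "\<bar>r\<bar> powr (1 - 2 * s) * X powr (s - 1)
    \<le> 4 * (near_weight r + near_weight (r - (1 - \<tau>\<^sup>2) / (2 * \<tau>)))"
proof -
  have nr: "near_weight r = \<bar>r\<bar> powr (- s) + \<bar>r\<bar> powr (s - 1)"
    using r by (auto simp: near_weight_def indicator_def)
  have e: "x powr (1 - 2 * s) * x powr (s - 1) = x powr (- s)" for x :: real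
    by (simp add: powr_add[symmetric])
  show ?thesis
  proof (cases "\<tau> < 1 / 2")
    case True
    have "\<tau>\<^sup>2 \<le> (1 / 2)\<^sup>2" using True t by (intro power_mono) auto
    moreover have "2 * \<tau> * r \<le> 1 * \<bar>r\<bar>"
      using True t by (intro order_trans[OF mult_left_mono[of r "\<bar>r\<bar>"] mult_right_mono]) auto
    ultimately have "1 / 4 \<le> X" using X r by (simp add: power2_eq_square)
    then have "X powr (s - 1) \<le> (1 / 4) powr (s - 1)" using s by (intro powr_mono2') auto
    also have "\<dots> = 4 powr (1 - s)" by (simp add: powr_divide powr_minus[symmetric] powr_minus_divide[symmetric])
    also have "\<dots> \<le> 4 powr 1" using s by (intro powr_mono) auto
    finally have "X powr (s - 1) \<le> 4" by simp
    moreover have "\<bar>r\<bar> powr (1 - 2 * s) \<le> \<bar>r\<bar> powr (- s)" using r s by (intro powr_mono') auto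
    ultimately have "\<bar>r\<bar> powr (1 - 2 * s) * X powr (s - 1) \<le> \<bar>r\<bar> powr (- s) * 4"
      by (intro mult_mono) auto
    also have "\<dots> \<le> 4 * near_weight r" using nr by simp
    finally show ?thesis
      using weight_nonneg(1)[of "r - (1 - \<tau>\<^sup>2) / (2 * \<tau>)"]
      by (simp add: distrib_left add_increasing2)
  next
    case False
    define y where "y = (1 - \<tau>\<^sup>2) / (2 * \<tau>) - r"
    have Xy: "X = 2 * \<tau> * y" unfolding y_def X using False by (simp add: field_simps)
    have y: "0 < y" using X(2) False unfolding Xy by (simp add: zero_less_mult_iff)
    have yX: "y \<le> X" unfolding Xy using y False mult_right_mono[of 1 "2 * \<tau>" y] by simp
    have sym: "near_weight (r - (1 - \<tau>\<^sup>2) / (2 * \<tau>)) = near_weight y"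
      unfolding y_def near_weight_def by (auto simp: indicator_def abs_minus_commute)
    have "\<bar>r\<bar> powr (1 - 2 * s) * X powr (s - 1) \<le> near_weight r + near_weight y"
    proof (cases "\<bar>r\<bar> \<le> X")
      case True
      then have "\<bar>r\<bar> powr (1 - 2 * s) * X powr (s - 1) \<le> \<bar>r\<bar> powr (1 - 2 * s) * \<bar>r\<bar> powr (s - 1)"
        using s r by (intro mult_left_mono powr_mono2') auto
      also have "\<dots> \<le> near_weight r" unfolding e using nr by simp
      finally show ?thesis using weight_nonneg(1)[of y] by linarith
    next
      case rX: False
      have yr: "y < \<bar>r\<bar>" using yX rX by simp
      then have ny: "near_weight y = y powr (- s) + y powr (s - 1)"
        using r y by (auto simp: near_weight_def indicator_def)
      have "\<bar>r\<bar> powr (1 - 2 * s) * X powr (s - 1) \<le> \<bar>r\<bar> powr (1 - 2 * s) * y powr (s - 1)"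
        using s y yX by (intro mult_left_mono powr_mono2') auto
      also have "\<dots> \<le> near_weight y"
      proof (cases "1 - 2 * s \<ge> 0")
        case True
        then have "\<bar>r\<bar> powr (1 - 2 * s) \<le> 1" using r by (intro powr_le1) auto
        then have "\<bar>r\<bar> powr (1 - 2 * s) * y powr (s - 1) \<le> 1 * y powr (s - 1)"
          by (intro mult_right_mono) auto
        then show ?thesis using ny by (smt (verit) powr_ge_zero)
      next
        case False
        then have "\<bar>r\<bar> powr (1 - 2 * s) * y powr (s - 1) \<le> y powr (1 - 2 * s) * y powr (s - 1)"
          using y yr by (intro mult_right_mono powr_mono2') auto
        then show ?thesis using ny e[of y] by (smt (verit) powr_ge_zero)
      qed
      finally show ?thesis using weight_nonneg(1)[of r] by linarith
    qed
    also have "\<dots> \<le> 4 * (near_weight r + near_weight y)"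
      using weight_nonneg(1)[of r] weight_nonneg(1)[of y] by simp
    finally show ?thesis unfolding sym .
  qed
qed

text \<open>
  The increments \<open>a\<close> and \<open>b\<close> belong to the tangent and to the parabola, which touch at \<open>\<tau>\<close> and differ by
  \<open>r\<^sup>2\<close>.  For small \<open>r\<close> both increments are of order \<open>|r|\<^sup>s\<close> and differ by at most
  \<open>X powr (s - 1) * r\<^sup>2\<close>.  The product of all powers of \<open>|r|\<close> is then \<open>|r| powr (1 - 2 * s)\<close>, whatever \<open>p\<close> is.
\<close>

lemma tangent_error:
  assumes r: "r \<noteq> 0" and t: "0 \<le> \<tau>" "\<tau> < 1"
  defines "q \<equiv> 1 - \<tau>\<^sup>2"
  defines "a \<equiv> q powr s - (max 0 (q - 2 * \<tau> * r)) powr s"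
    and "b \<equiv> q powr s - (max 0 (1 - (\<tau> + r)\<^sup>2)) powr s"
  shows "(Jp p b - Jp p a) * \<bar>r\<bar> powr (- 1 - p * s)
    \<le> (2 * 2 powr (s * (p - 1)) + 4 * (p - 1) * 3 powr (s * (p - 2)))
       * (near_weight r + near_weight (r - q / (2 * \<tau>)) + far_weight r)"
    (is "_ \<le> (?C1 + ?C2) * ?W")
proof -
  define X where "X = q - 2 * \<tau> * r"
  have q: "0 < q" "q \<le> 1" unfolding q_def using t by (auto simp: power2_eq_square mult_le_one mult_strict_mono' [of \<tau> 1 \<tau> 1, simplified])
  have XD: "1 - (\<tau> + r)\<^sup>2 = X - r\<^sup>2" unfolding X_def q_def by (simp add: power2_eq_square algebra_simps)
  have W: "near_weight r \<le> ?W" "far_weight r \<le> ?W"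
      "near_weight r + near_weight (r - q / (2 * \<tau>)) \<le> ?W" "0 \<le> ?W"
    using weight_nonneg(1)[of r] weight_nonneg(2)[of r] weight_nonneg(1)[of "r - q / (2 * \<tau>)"] by linarith+
  have C: "0 \<le> ?C1" "0 \<le> ?C2" using p by auto
  have tr: "\<bar>2 * \<tau> * r\<bar> \<le> 2 * \<bar>r\<bar>" using t by (simp add: abs_mult mult_left_le_one_le)
  have absa: "\<bar>a\<bar> \<le> (2 * \<bar>r\<bar>) powr s"
  proof -
    have "\<bar>a\<bar> \<le> \<bar>q - max 0 (q - 2 * \<tau> * r)\<bar> powr s"
      unfolding a_def using q s by (intro powr_diff_abs_le) auto
    also have "\<dots> \<le> (2 * \<bar>r\<bar>) powr s"
    proof (intro powr_mono2)
      have "\<bar>q - max 0 (q - z)\<bar> \<le> \<bar>z\<bar>" for z using q by (auto simp: max_def)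
      then show "\<bar>q - max 0 (q - 2 * \<tau> * r)\<bar> \<le> 2 * \<bar>r\<bar>" using tr by (rule order_trans)
    qed (use s in auto)
    finally show ?thesis .
  qed
  show ?thesis
  proof (cases "1 / 2 \<le> \<bar>r\<bar>")
    case True
    have "b \<le> 1" unfolding b_def using q s powr_le1[of s q] by (smt (verit) powr_ge_zero)
    then have "Jp p b \<le> Jp p 1" using p by (intro Jp_mono) auto
    also have "\<dots> \<le> (2 * \<bar>r\<bar>) powr (s * (p - 1))"
      using True s p by (simp add: Jp_nonneg_eq ge_one_powr_ge_zero)
    finally have "Jp p b \<le> (2 * \<bar>r\<bar>) powr (s * (p - 1))" .
    moreover have "\<bar>Jp p a\<bar> \<le> (2 * \<bar>r\<bar>) powr (s * (p - 1))"
      unfolding Jp_abs powr_powr[symmetric] using absa p by (intro powr_mono2) auto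
    ultimately have "Jp p b - Jp p a \<le> 2 * (2 * \<bar>r\<bar>) powr (s * (p - 1))" by linarith
    then have "(Jp p b - Jp p a) * \<bar>r\<bar> powr (- 1 - p * s)
       \<le> 2 * (2 * \<bar>r\<bar>) powr (s * (p - 1)) * \<bar>r\<bar> powr (- 1 - p * s)"
      by (intro mult_right_mono) auto
    also have "\<dots> = ?C1 * (\<bar>r\<bar> powr (s * (p - 1)) * \<bar>r\<bar> powr (- 1 - p * s))"
      by (simp add: powr_mult)
    also have "\<bar>r\<bar> powr (s * (p - 1)) * \<bar>r\<bar> powr (- 1 - p * s) = \<bar>r\<bar> powr (- 1 - s)"
      by (simp add: powr_add[symmetric] algebra_simps)
    also have "?C1 * \<bar>r\<bar> powr (- 1 - s) = ?C1 * far_weight r" using True by (simp add: far_weight_def)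
    also have "\<dots> \<le> (?C1 + ?C2) * ?W" using W C by (intro mult_mono) (auto simp: weight_nonneg)
    finally show ?thesis .
  next
    case False
    then have r2: "\<bar>r\<bar> < 1 / 2" by simp
    show ?thesis
    proof (cases "0 < X")
      case False
      then have "X - r\<^sup>2 \<le> 0" using zero_le_power2[of r] by linarith
      then have "a = b"
        unfolding a_def b_def XD X_def[symmetric] using False by (simp add: max_absorb1)
      then show ?thesis using W C by simp
    next
      case True
      have rr: "r\<^sup>2 \<le> \<bar>r\<bar>" using r2 mult_right_mono[of "\<bar>r\<bar>" 1 "\<bar>r\<bar>"] by (simp add: power2_eq_square)
      have absb: "\<bar>b\<bar> \<le> (3 * \<bar>r\<bar>) powr s"
      proof -
        have "\<bar>b\<bar> \<le> \<bar>q - max 0 (1 - (\<tau> + r)\<^sup>2)\<bar> powr s"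
          unfolding b_def using q s by (intro powr_diff_abs_le) auto
        also have "\<dots> \<le> (3 * \<bar>r\<bar>) powr s"
        proof (intro powr_mono2)
          have "\<bar>q - max 0 (q - z - r\<^sup>2)\<bar> \<le> \<bar>z\<bar> + r\<^sup>2" for z
            using q abs_triangle_ineq[of z "r\<^sup>2"] by (auto simp: max_def)
          from this[of "2 * \<tau> * r"] show "\<bar>q - max 0 (1 - (\<tau> + r)\<^sup>2)\<bar> \<le> 3 * \<bar>r\<bar>"
            unfolding XD X_def using tr rr by linarith
        qed (use s in auto)
        finally show ?thesis .
      qed
      have ba: "b - a \<le> X powr (s - 1) * r\<^sup>2" "a \<le> b"
        unfolding a_def b_def XD X_def[symmetric]
        using powr_diff_le_tangent[OF True, of "r\<^sup>2" s] True s
          powr_mono2[of s "max 0 (X - r\<^sup>2)" X] by (auto simp: max_def split: if_splits)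
      have "\<bar>a\<bar> \<le> (3 * \<bar>r\<bar>) powr s"
        using absa s by (intro order_trans[OF absa] powr_mono2) auto
      then have "Jp p b - Jp p a \<le> (p - 1) * ((3 * \<bar>r\<bar>) powr s) powr (p - 2) * (b - a)"
        using absb ba p by (intro Jp_diff_le) auto
      also have "\<dots> \<le> (p - 1) * ((3 * \<bar>r\<bar>) powr s) powr (p - 2) * (X powr (s - 1) * r\<^sup>2)"
        using ba p by (intro mult_left_mono) auto
      finally have "(Jp p b - Jp p a) * \<bar>r\<bar> powr (- 1 - p * s)
         \<le> (p - 1) * ((3 * \<bar>r\<bar>) powr s) powr (p - 2) * (X powr (s - 1) * r\<^sup>2) * \<bar>r\<bar> powr (- 1 - p * s)"
        by (intro mult_right_mono) auto
      also have "\<dots> = (p - 1) * 3 powr (s * (p - 2))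
          * (X powr (s - 1) * (\<bar>r\<bar> powr (s * (p - 2)) * \<bar>r\<bar> powr 2 * \<bar>r\<bar> powr (- 1 - p * s)))"
        by (simp add: powr_powr powr_mult)
      also have "\<bar>r\<bar> powr (s * (p - 2)) * \<bar>r\<bar> powr 2 * \<bar>r\<bar> powr (- 1 - p * s) = \<bar>r\<bar> powr (1 - 2 * s)"
      proof -
        have "s * (p - 2) + 2 + (- 1 - p * s) = 1 - 2 * s" by (simp add: algebra_simps)
        then show ?thesis by (simp only: powr_add[symmetric])
      qed
      also have "(p - 1) * 3 powr (s * (p - 2)) * (X powr (s - 1) * \<bar>r\<bar> powr (1 - 2 * s))
         \<le> (p - 1) * 3 powr (s * (p - 2)) * (4 * (near_weight r + near_weight (r - q / (2 * \<tau>))))"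
        using tangent_error_near[OF r r2 t, of X] True p unfolding X_def q_def
        by (intro mult_left_mono) (auto simp: mult.commute)
      also have "\<dots> = ?C2 * (near_weight r + near_weight (r - q / (2 * \<tau>)))"
        by (simp only: ac_simps)
      also have "\<dots> \<le> (?C1 + ?C2) * ?W"
        using W C weight_nonneg(1)[of r] weight_nonneg(1)[of "r - q / (2 * \<tau>)"] by (intro mult_mono) auto
      finally show ?thesis .
    qed
  qed
qed

text \<open>
  The integrand of the truncated operator at \<open>\<tau>\<close> for the profile of the interval with end points \<open>- l\<close> and \<open>l\<close>.
\<close>

definition interval_integrand :: "real \<Rightarrow> real \<Rightarrow> real \<Rightarrow> real \<Rightarrow> real" where
  "interval_integrand l \<tau> \<epsilon> r = indicator {r. \<epsilon> \<le> \<bar>r\<bar>} r *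
     (Jp p ((l\<^sup>2 - \<tau>\<^sup>2) powr s - (max 0 (l\<^sup>2 - (\<tau> + r)\<^sup>2)) powr s) * \<bar>r\<bar> powr (- 1 - p * s))"

text \<open>
  The weights are integrable and translation does not change their integrals, so that the bound does
  not depend on the zero \<open>q / (2 * \<tau>)\<close> of the tangent.
\<close>

lemma unit_interval_profile:
  obtains M where "0 \<le> M"
    and "\<And>\<tau> \<epsilon>. \<bar>\<tau>\<bar> < 1 \<Longrightarrow> 0 < \<epsilon> \<Longrightarrow>
      (\<integral>r. interval_integrand 1 \<tau> \<epsilon> r \<partial>lborel) \<le> M"
proof -
  define C where "C = 2 * 2 powr (s * (p - 1)) + 4 * (p - 1) * 3 powr (s * (p - 2))"
  have C: "0 \<le> C" unfolding C_def using p by simp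
  define K where "K = integral\<^sup>L lborel near_weight + integral\<^sup>L lborel near_weight + integral\<^sup>L lborel far_weight"
  define Q where "Q = (\<lambda>\<tau> \<epsilon> r. indicator {r. \<epsilon> \<le> \<bar>r\<bar>} r *
        (Jp p ((1 - \<tau>\<^sup>2) powr s - (max 0 (1 - (\<tau> + r)\<^sup>2)) powr s) * \<bar>r\<bar> powr (- 1 - p * s)))"
  have K: "0 \<le> K" unfolding K_def using weight_nonneg by (intro add_nonneg_nonneg integral_nonneg) auto
  have main: "(\<integral>r. Q \<tau> \<epsilon> r \<partial>lborel) \<le> C * K" if t: "0 \<le> \<tau>" "\<tau> < 1" and e: "0 < \<epsilon>" for \<tau> \<epsilon>
  proof -
    define q where "q = 1 - \<tau>\<^sup>2"
    define F where "F = (\<lambda>r. indicator {r. \<epsilon> \<le> \<bar>r\<bar>} r *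
      (Jp p (q powr s - (max 0 (q - 2 * \<tau> * r)) powr s) * \<bar>r\<bar> powr (- 1 - p * s)))"
    have "\<tau>\<^sup>2 < 1" using t by (simp add: power_less_one_iff abs_square_less_1)
    then have q: "0 < q" unfolding q_def by simp
    have F: "integrable lborel F" "(\<integral>r. F r \<partial>lborel) \<le> 0"
      unfolding F_def using affine_profile[OF e q, of "2 * \<tau>"] t by auto
    define W where "W = (\<lambda>r. near_weight r + near_weight (- (q / (2 * \<tau>)) + 1 * r) + far_weight r)"
    have shift: "integrable lborel (\<lambda>r. near_weight (- (q / (2 * \<tau>)) + 1 * r))"
      using lborel_integrable_real_affine[OF integrable_weights(1), of 1 "- (q / (2 * \<tau>))"] by simp
    have intW: "integrable lborel W" unfolding W_def using integrable_weights shift by auto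
    have "(\<integral>r. near_weight (- (q / (2 * \<tau>)) + 1 * r) \<partial>lborel) = integral\<^sup>L lborel near_weight"
      using lborel_integral_real_affine[of 1 near_weight "- (q / (2 * \<tau>))"] by simp
    then have WK: "(\<integral>r. W r \<partial>lborel) = K"
      unfolding W_def K_def using integrable_weights shift by simp
    have QF: "Q \<tau> \<epsilon> r \<le> F r + C * W r" for r
    proof (cases "\<epsilon> \<le> \<bar>r\<bar>")
      case True
      then show ?thesis
        using tangent_error[of r \<tau>] t e unfolding Q_def F_def W_def C_def q_def
        by (simp add: algebra_simps)
    next
      case False
      then show ?thesis
        unfolding Q_def F_def W_def using weight_nonneg C by (auto intro!: mult_nonneg_nonneg add_nonneg_nonneg)
    qed
    show ?thesis
    proof (cases "integrable lborel (Q \<tau> \<epsilon>)")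
      case True
      then have "(\<integral>r. Q \<tau> \<epsilon> r \<partial>lborel) \<le> (\<integral>r. F r + C * W r \<partial>lborel)"
        using F intW QF by (intro integral_mono) auto
      also have "\<dots> \<le> C * K" using F intW WK by simp
      finally show ?thesis .
    next
      case False
      then show ?thesis using C K by (simp add: not_integrable_integral_eq)
    qed
  qed
  have "(\<integral>r. Q \<tau> \<epsilon> r \<partial>lborel) \<le> C * K" if t: "\<bar>\<tau>\<bar> < 1" and e: "0 < \<epsilon>" for \<tau> \<epsilon>
  proof (cases "0 \<le> \<tau>")
    case False
    have "Q \<tau> \<epsilon> (0 + (-1) * r) = Q (- \<tau>) \<epsilon> r" for r
    proof -
      have "(\<tau> - r)\<^sup>2 = (- \<tau> + r)\<^sup>2" by (simp add: power2_eq_square algebra_simps)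
      then show ?thesis unfolding Q_def by (simp add: indicator_def)
    qed
    then have "(\<integral>r. Q \<tau> \<epsilon> r \<partial>lborel) = (\<integral>r. Q (- \<tau>) \<epsilon> r \<partial>lborel)"
      using lborel_integral_real_affine[of "-1" "Q \<tau> \<epsilon>" 0] by simp
    then show ?thesis using main[of "- \<tau>" \<epsilon>] that False by simp
  qed (use main that in auto)
  then show thesis using that[of "C * K"] C K unfolding Q_def interval_integrand_def by simp
qed

lemma interval_profile:
  obtains M where "0 \<le> M"
    and "\<And>l \<tau> \<epsilon>. \<bar>\<tau>\<bar> < l \<Longrightarrow> 0 < \<epsilon> \<Longrightarrow>
      (\<integral>r. interval_integrand l \<tau> \<epsilon> r \<partial>lborel)
      \<le> M * l powr (s * (p - 2))"
proof -
  obtain M where M: "0 \<le> M" "\<And>\<tau> \<epsilon>. \<bar>\<tau>\<bar> < 1 \<Longrightarrow> 0 < \<epsilon> \<Longrightarrow> (\<integral>r. interval_integrand 1 \<tau> \<epsilon> r \<partial>lborel) \<le> M"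
    using unit_interval_profile by blast
  have "(\<integral>r. interval_integrand l \<tau> \<epsilon> r \<partial>lborel) \<le> M * l powr (s * (p - 2))" if t: "\<bar>\<tau>\<bar> < l" and e: "0 < \<epsilon>" for l \<tau> \<epsilon>
  proof -
    have l: "0 < l" using t by simp
    define c where "c = ((l\<^sup>2) powr s) powr (p - 1) * l powr (- 1 - p * s)"
    have sc: "interval_integrand l \<tau> \<epsilon> (0 + l * r) = c * interval_integrand 1 (\<tau> / l) (\<epsilon> / l) r" for r
    proof -
      have "\<tau> + l * r = l * (\<tau> / l + r)" using l by (simp add: field_simps)
      then have "(\<tau> + l * r)\<^sup>2 = l\<^sup>2 * (\<tau> / l + r)\<^sup>2" by (simp add: power_mult_distrib)
      then have "max 0 (l\<^sup>2 - (\<tau> + l * r)\<^sup>2) = l\<^sup>2 * max 0 (1 - (\<tau> / l + r)\<^sup>2)"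
        using l by (simp add: max_mult_distrib_left[symmetric] algebra_simps max_def zero_le_mult_iff)
      moreover have "l\<^sup>2 - \<tau>\<^sup>2 = l\<^sup>2 * (1 - (\<tau> / l)\<^sup>2)" using l by (simp add: field_simps)
      ultimately have "(l\<^sup>2 - \<tau>\<^sup>2) powr s - (max 0 (l\<^sup>2 - (\<tau> + l * r)\<^sup>2)) powr s
        = (l\<^sup>2) powr s * ((1 - (\<tau> / l)\<^sup>2) powr s - (max 0 (1 - (\<tau> / l + r)\<^sup>2)) powr s)"
        by (simp only: powr_mult right_diff_distrib[of "(l\<^sup>2) powr s"])
      moreover have "\<bar>l * r\<bar> powr (- 1 - p * s) = l powr (- 1 - p * s) * \<bar>r\<bar> powr (- 1 - p * s)"
        using l by (simp add: abs_mult powr_mult)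
      moreover have "\<epsilon> \<le> \<bar>l * r\<bar> \<longleftrightarrow> \<epsilon> / l \<le> \<bar>r\<bar>" using l by (simp add: abs_mult field_simps)
      ultimately show ?thesis
        unfolding interval_integrand_def c_def by (simp add: Jp_scale indicator_def)
    qed
    have "(\<integral>r. interval_integrand l \<tau> \<epsilon> r \<partial>lborel) = l * (\<integral>r. interval_integrand l \<tau> \<epsilon> (0 + l * r) \<partial>lborel)"
      using lborel_integral_real_affine[of l "interval_integrand l \<tau> \<epsilon>" 0] l by simp
    also have "\<dots> = (l * c) * (\<integral>r. interval_integrand 1 (\<tau> / l) (\<epsilon> / l) r \<partial>lborel)" unfolding sc by simp
    also have "\<dots> \<le> (l * c) * M"
      using M(2)[of "\<tau> / l" "\<epsilon> / l"] l t e by (intro mult_left_mono) (auto simp: c_def)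
    also have "l * c = l powr (s * (p - 2))"
    proof -
      have "l * c = l powr 1 * (((l powr 2) powr s) powr (p - 1) * l powr (- 1 - p * s))"
        unfolding c_def using l by simp
      also have "\<dots> = l powr (1 + (2 * s * (p - 1) + (- 1 - p * s)))"
        by (simp only: powr_powr powr_add)
      also have "1 + (2 * s * (p - 1) + (- 1 - p * s)) = s * (p - 2)" by (simp add: algebra_simps)
      finally show ?thesis .
    qed
    finally show ?thesis by (simp add: mult.commute)
  qed
  then show thesis using that M(1) by blast
qed

end

section \<open>Integration along lines\<close>

text \<open>
  The annulus plays the role of the unit sphere in polar coordinates: every \<open>h \<noteq> 0\<close> is of the form
  \<open>l *\<^sub>R k\<close> with \<open>k\<close> in the annulus for a set of factors \<open>l\<close> whose measure with respect to \<open>dl / |l|\<close> is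
  \<open>2 * ln 2\<close>.  No measure on the sphere is then needed.
\<close>

definition annulus :: "'a::euclidean_space set" where
  "annulus = {k. 1 \<le> norm k \<and> norm k \<le> 2}"

lemma annulus_borel [measurable]: "annulus \<in> sets borel"
  unfolding annulus_def by measurable

lemma annulus_emeasure_finite: "emeasure lborel (annulus :: 'a::euclidean_space set) < \<infinity>"
proof -
  have "annulus \<subseteq> cball (0 :: 'a) 2" by (auto simp: annulus_def)
  then have "emeasure lborel (annulus :: 'a set) \<le> emeasure lborel (cball (0 :: 'a) 2)"
    by (intro emeasure_mono) auto
  then show ?thesis using emeasure_lborel_cball_finite[of "0 :: 'a" 2] by (simp add: order_le_less_trans)
qed

lemma nn_integral_lborel_scale:
  fixes f :: "'a::euclidean_space \<Rightarrow> ennreal"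
  assumes [measurable]: "f \<in> borel_measurable borel" and c: "c \<noteq> 0"
  shows "(\<integral>\<^sup>+h. f h \<partial>lborel) = ennreal (\<bar>c\<bar> ^ DIM('a)) * (\<integral>\<^sup>+k. f (c *\<^sub>R k) \<partial>lborel)"
proof -
  have "(\<integral>\<^sup>+h. f h \<partial>lborel)
     = (\<integral>\<^sup>+h. f h \<partial>(density (distr lborel borel (\<lambda>x. 0 + c *\<^sub>R x)) (\<lambda>_. ennreal (\<bar>c\<bar> ^ DIM('a)))))"
    using lborel_affine[OF c, of "0 :: 'a"] by simp
  also have "\<dots> = (\<integral>\<^sup>+k. ennreal (\<bar>c\<bar> ^ DIM('a)) * f (c *\<^sub>R k) \<partial>lborel)"
    by (simp add: nn_integral_density nn_integral_distr)
  also have "\<dots> = ennreal (\<bar>c\<bar> ^ DIM('a)) * (\<integral>\<^sup>+k. f (c *\<^sub>R k) \<partial>lborel)"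
    by (rule nn_integral_cmult) measurable
  finally show ?thesis .
qed

lemma nn_integral_inverse_dyadic:
  fixes a :: real
  assumes a: "0 < a"
  shows "(\<integral>\<^sup>+l. indicator {l. a / 2 \<le> \<bar>l\<bar> \<and> \<bar>l\<bar> \<le> a} l * ennreal (1 / \<bar>l\<bar>) \<partial>lborel) = ennreal (2 * ln 2)"
proof -
  let ?f = "\<lambda>l. ennreal (1 / l) * indicator {a / 2..a} l"
  have f: "(\<integral>\<^sup>+l. ?f l \<partial>lborel) = ennreal (ln 2)"
  proof -
    have "(\<integral>\<^sup>+l. ?f l \<partial>lborel) = ennreal (ln a - ln (a / 2))"
      using a by (intro nn_integral_FTC_Icc) (auto intro!: derivative_eq_intros)
    then show ?thesis using a by (simp add: ln_div)
  qed
  have "(\<integral>\<^sup>+l. ?f l \<partial>lborel) = (\<integral>\<^sup>+l. ?f (- l) \<partial>lborel)"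
    using nn_integral_lborel_scale[of ?f "-1"] by simp
  with f have f': "(\<integral>\<^sup>+l. ?f (- l) \<partial>lborel) = ennreal (ln 2)" by simp
  have "(\<integral>\<^sup>+l. indicator {l. a / 2 \<le> \<bar>l\<bar> \<and> \<bar>l\<bar> \<le> a} l * ennreal (1 / \<bar>l\<bar>) \<partial>lborel)
     = (\<integral>\<^sup>+l. ?f l + ?f (- l) \<partial>lborel)"
    using a by (intro nn_integral_cong) (auto simp: indicator_def abs_if)
  also have "\<dots> = ennreal (ln 2) + ennreal (ln 2)"
    by (subst nn_integral_add) (auto simp only: f f', measurable)
  finally show ?thesis by (simp add: ennreal_plus[symmetric] del: ennreal_plus)
qed

text \<open>
  Exchange the integrals, substitute \<open>h = l *\<^sub>R k\<close> for fixed \<open>l\<close>, and exchange them again.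
\<close>

lemma nn_integral_radial:
  fixes f :: "'a::euclidean_space \<Rightarrow> ennreal"
  assumes [measurable]: "f \<in> borel_measurable borel"
  shows "(\<integral>\<^sup>+k. (\<integral>\<^sup>+l. indicator annulus k * ennreal (\<bar>l\<bar> ^ (DIM('a) - 1)) * f (l *\<^sub>R k) \<partial>lborel) \<partial>lborel)
    = ennreal (2 * ln 2) * (\<integral>\<^sup>+h. f h \<partial>lborel)"
proof -
  have "(\<integral>\<^sup>+k. (\<integral>\<^sup>+l. indicator annulus k * ennreal (\<bar>l\<bar> ^ (DIM('a) - 1)) * f (l *\<^sub>R k) \<partial>lborel) \<partial>lborel)
    = (\<integral>\<^sup>+l. (\<integral>\<^sup>+k. indicator annulus k * ennreal (\<bar>l\<bar> ^ (DIM('a) - 1)) * f (l *\<^sub>R k) \<partial>lborel) \<partial>lborel)"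
    by (rule lborel_pair.Fubini') measurable
  also have "\<dots> = (\<integral>\<^sup>+l. (\<integral>\<^sup>+h. indicator annulus ((1 / l) *\<^sub>R h) * ennreal (1 / \<bar>l\<bar>) * f h \<partial>lborel) \<partial>lborel)"
  proof (intro nn_integral_cong_AE)
    show "AE l in lborel. (\<integral>\<^sup>+k. indicator annulus k * ennreal (\<bar>l\<bar> ^ (DIM('a) - 1)) * f (l *\<^sub>R k) \<partial>lborel)
       = (\<integral>\<^sup>+h. indicator annulus ((1 / l) *\<^sub>R h) * ennreal (1 / \<bar>l\<bar>) * f h \<partial>lborel)"
      using AE_lborel_singleton[of "0 :: real"]
    proof eventually_elim
      case (elim l)
      have "(\<integral>\<^sup>+h. indicator annulus ((1 / l) *\<^sub>R h) * ennreal (1 / \<bar>l\<bar>) * f h \<partial>lborel)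
        = ennreal (\<bar>l\<bar> ^ DIM('a)) * (\<integral>\<^sup>+k. indicator annulus ((1 / l) *\<^sub>R (l *\<^sub>R k)) * ennreal (1 / \<bar>l\<bar>) * f (l *\<^sub>R k) \<partial>lborel)"
        using elim by (intro nn_integral_lborel_scale) measurable
      also have "\<dots> = (\<integral>\<^sup>+k. ennreal (\<bar>l\<bar> ^ DIM('a)) * (indicator annulus k * ennreal (1 / \<bar>l\<bar>) * f (l *\<^sub>R k)) \<partial>lborel)"
        using elim by (subst nn_integral_cmult) auto
      also have "\<dots> = (\<integral>\<^sup>+k. indicator annulus k * ennreal (\<bar>l\<bar> ^ (DIM('a) - 1)) * f (l *\<^sub>R k) \<partial>lborel)"
      proof (intro nn_integral_cong)
        fix k
        have "\<bar>l\<bar> ^ DIM('a) * (1 / \<bar>l\<bar>) = \<bar>l\<bar> ^ (DIM('a) - 1)"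
          using elim by (simp add: power_diff)
        then have "ennreal (\<bar>l\<bar> ^ DIM('a)) * ennreal (1 / \<bar>l\<bar>) = ennreal (\<bar>l\<bar> ^ (DIM('a) - 1))"
          by (simp add: ennreal_mult[symmetric])
        then show "ennreal (\<bar>l\<bar> ^ DIM('a)) * (indicator annulus k * ennreal (1 / \<bar>l\<bar>) * f (l *\<^sub>R k))
          = indicator annulus k * ennreal (\<bar>l\<bar> ^ (DIM('a) - 1)) * f (l *\<^sub>R k)"
          by (metis (no_types, lifting) mult.assoc mult.commute)
      qed
      finally show ?case by simp
    qed
  qed
  also have "\<dots> = (\<integral>\<^sup>+h. (\<integral>\<^sup>+l. indicator annulus ((1 / l) *\<^sub>R h) * ennreal (1 / \<bar>l\<bar>) * f h \<partial>lborel) \<partial>lborel)"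
    by (rule lborel_pair.Fubini') measurable
  also have "\<dots> = (\<integral>\<^sup>+h. ennreal (2 * ln 2) * f h \<partial>lborel)"
  proof (intro nn_integral_cong_AE)
    show "AE h in lborel. (\<integral>\<^sup>+l. indicator annulus ((1 / l) *\<^sub>R h) * ennreal (1 / \<bar>l\<bar>) * f h \<partial>lborel)
        = ennreal (2 * ln 2) * f h"
      using AE_lborel_singleton[of "0 :: 'a"]
    proof eventually_elim
      case (elim h)
      have "(\<integral>\<^sup>+l. indicator annulus ((1 / l) *\<^sub>R h) * ennreal (1 / \<bar>l\<bar>) * f h \<partial>lborel)
        = (\<integral>\<^sup>+l. indicator annulus ((1 / l) *\<^sub>R h) * ennreal (1 / \<bar>l\<bar>) \<partial>lborel) * f h"
        by (rule nn_integral_multc) measurable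
      also have "(\<integral>\<^sup>+l. indicator annulus ((1 / l) *\<^sub>R h) * ennreal (1 / \<bar>l\<bar>) \<partial>lborel)
        = (\<integral>\<^sup>+l. indicator {l. norm h / 2 \<le> \<bar>l\<bar> \<and> \<bar>l\<bar> \<le> norm h} l * ennreal (1 / \<bar>l\<bar>) \<partial>lborel)"
      proof (intro nn_integral_cong)
        fix l :: real
        show "indicator annulus ((1 / l) *\<^sub>R h) * ennreal (1 / \<bar>l\<bar>)
          = indicator {l. norm h / 2 \<le> \<bar>l\<bar> \<and> \<bar>l\<bar> \<le> norm h} l * ennreal (1 / \<bar>l\<bar>)"
          using elim by (cases "l = 0")
            (auto simp: annulus_def indicator_def pos_le_divide_eq pos_divide_le_eq)
      qed
      also have "\<dots> = ennreal (2 * ln 2)"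
        using elim by (intro nn_integral_inverse_dyadic) simp
      finally show ?case .
    qed
  qed
  also have "\<dots> = ennreal (2 * ln 2) * (\<integral>\<^sup>+h. f h \<partial>lborel)"
    by (rule nn_integral_cmult) measurable
  finally show ?thesis .
qed

lemma nn_integral_finite_of_lines:
  fixes f :: "'a::euclidean_space \<Rightarrow> ennreal"
  assumes [measurable]: "f \<in> borel_measurable borel" and M: "M < \<infinity>"
    and lines: "\<And>k. k \<in> annulus \<Longrightarrow> (\<integral>\<^sup>+l. ennreal (\<bar>l\<bar> ^ (DIM('a) - 1)) * f (l *\<^sub>R k) \<partial>lborel) \<le> M"
  shows "(\<integral>\<^sup>+h. f h \<partial>lborel) < \<infinity>"
proof -
  have "ennreal (2 * ln 2) * (\<integral>\<^sup>+h. f h \<partial>lborel)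
    = (\<integral>\<^sup>+k. (\<integral>\<^sup>+l. indicator annulus k * ennreal (\<bar>l\<bar> ^ (DIM('a) - 1)) * f (l *\<^sub>R k) \<partial>lborel) \<partial>lborel)"
    by (rule nn_integral_radial[symmetric]) measurable
  also have "\<dots> \<le> (\<integral>\<^sup>+k. M * indicator annulus (k :: 'a) \<partial>lborel)"
    using lines by (intro nn_integral_mono) (auto simp: indicator_def)
  also have "\<dots> = M * emeasure lborel (annulus :: 'a set)"
    by (rule nn_integral_cmult_indicator) measurable
  also have "\<dots> < \<infinity>" using M annulus_emeasure_finite[where 'a='a] by (simp add: ennreal_mult_less_top)
  finally have "ennreal (2 * ln 2) * (\<integral>\<^sup>+h. f h \<partial>lborel) < \<infinity>" .
  moreover have "(2::real) * ln 2 > 0" by simp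
  ultimately show ?thesis by (auto simp: ennreal_mult_less_top ennreal_eq_0_iff)
qed

text \<open>
  The radial formula is an identity of measures, hence it also holds for signed integrands, and
  cancellation along the lines is not lost.
\<close>

lemma integral_le_of_lines:
  fixes G :: "'a::euclidean_space \<Rightarrow> real"
  assumes G: "integrable lborel G" and M: "0 \<le> M"
    and lines: "\<And>k. k \<in> annulus \<Longrightarrow> (\<integral>l. \<bar>l\<bar> ^ (DIM('a) - 1) * G (l *\<^sub>R k) \<partial>lborel) \<le> M"
  shows "(\<integral>h. G h \<partial>lborel) \<le> measure lborel (annulus :: 'a set) * M / (2 * ln 2)"
proof -
  have [measurable]: "G \<in> borel_measurable borel" using borel_measurable_integrable[OF G] by simp
  define w where "w = (\<lambda>(k :: 'a, l :: real). ennreal (indicator annulus k * \<bar>l\<bar> ^ (DIM('a) - 1)))"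
  define T where "T = (\<lambda>(k :: 'a, l :: real). l *\<^sub>R k)"
  have [measurable]: "w \<in> borel_measurable (lborel \<Otimes>\<^sub>M lborel)" unfolding w_def by measurable
  have [measurable]: "T \<in> measurable (lborel \<Otimes>\<^sub>M lborel) borel" unfolding T_def by measurable
  have eq: "distr (density (lborel \<Otimes>\<^sub>M lborel) w) borel T = density lborel (\<lambda>_. ennreal (2 * ln 2))"
  proof (rule measure_eqI)
    fix A assume "A \<in> sets (distr (density (lborel \<Otimes>\<^sub>M lborel) w) borel T)"
    then have [measurable]: "A \<in> sets borel" by simp
    have "emeasure (distr (density (lborel \<Otimes>\<^sub>M lborel) w) borel T) A
       = (\<integral>\<^sup>+x. indicator A x \<partial>(distr (density (lborel \<Otimes>\<^sub>M lborel) w) borel T))"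
      by simp
    also have "\<dots> = (\<integral>\<^sup>+z. indicator A (T z) \<partial>(density (lborel \<Otimes>\<^sub>M lborel) w))"
      by (rule nn_integral_distr) measurable
    also have "\<dots> = (\<integral>\<^sup>+z. w z * indicator A (T z) \<partial>(lborel \<Otimes>\<^sub>M lborel))"
      by (rule nn_integral_density) measurable
    also have "\<dots> = (\<integral>\<^sup>+k. (\<integral>\<^sup>+l. w (k, l) * indicator A (T (k, l)) \<partial>lborel) \<partial>lborel)"
      by (rule lborel.nn_integral_fst[symmetric]) measurable
    also have "\<dots> = (\<integral>\<^sup>+k. (\<integral>\<^sup>+l. indicator annulus k * ennreal (\<bar>l\<bar> ^ (DIM('a) - 1)) * indicator A (l *\<^sub>R k) \<partial>lborel) \<partial>lborel)"
      unfolding w_def T_def by (intro nn_integral_cong) (auto simp: indicator_def)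
    also have "\<dots> = ennreal (2 * ln 2) * (\<integral>\<^sup>+h. indicator A h \<partial>lborel)"
      by (rule nn_integral_radial) measurable
    finally show "emeasure (distr (density (lborel \<Otimes>\<^sub>M lborel) w) borel T) A
       = emeasure (density lborel (\<lambda>_. ennreal (2 * ln 2))) A"
      by (simp add: emeasure_density nn_integral_cmult)
  qed simp
  have D: "integrable (density lborel (\<lambda>_. ennreal (2 * ln 2))) G"
    using G by (simp add: integrable_real_density[of "\<lambda>_. 2 * ln 2"])
  have ID: "(\<integral>h. G h \<partial>(density lborel (\<lambda>_. ennreal (2 * ln 2)))) = 2 * ln 2 * (\<integral>h. G h \<partial>lborel)"
    by (subst integral_real_density) auto
  define w' where "w' = (\<lambda>(k :: 'a, l :: real). indicator annulus k * \<bar>l\<bar> ^ (DIM('a) - 1) :: real)"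
  have [measurable]: "w' \<in> borel_measurable (lborel \<Otimes>\<^sub>M lborel)" unfolding w'_def by measurable
  have ww: "w = (\<lambda>z. ennreal (w' z))" unfolding w_def w'_def by auto
  have w'0: "0 \<le> w' z" for z unfolding w'_def by (auto split: prod.split)
  have int: "integrable (lborel \<Otimes>\<^sub>M lborel) (\<lambda>z. w' z * G (T z))"
    using D unfolding eq[symmetric] ww
    by (simp add: integrable_distr_eq integrable_real_density w'0)
  have "2 * ln 2 * (\<integral>h. G h \<partial>lborel) = (\<integral>z. w' z * G (T z) \<partial>(lborel \<Otimes>\<^sub>M lborel))"
    unfolding ID[symmetric] eq[symmetric] ww
    by (simp add: integral_distr integral_real_density w'0)
  also have "\<dots> = (\<integral>k. (\<integral>l. w' (k, l) * G (T (k, l)) \<partial>lborel) \<partial>lborel)"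
    by (rule lborel_pair.integral_fst'[symmetric, OF int])
  also have "\<dots> \<le> (\<integral>k. indicator annulus (k :: 'a) * M \<partial>lborel)"
  proof (rule integral_mono)
    show "integrable lborel (\<lambda>k. \<integral>l. w' (k, l) * G (T (k, l)) \<partial>lborel)"
      by (rule lborel_pair.integrable_fst'[OF int])
    show "integrable lborel (\<lambda>k :: 'a. indicator annulus k * M)"
      using annulus_emeasure_finite by (intro integrable_mult_left integrable_real_indicator) auto
    show "(\<integral>l. w' (k, l) * G (T (k, l)) \<partial>lborel) \<le> indicator annulus k * M" for k
      using lines[of k] unfolding w'_def T_def by (cases "k \<in> annulus") auto
  qed
  also have "\<dots> = measure lborel (annulus :: 'a set) * M" by simp
  finally have "2 * ln 2 * (\<integral>h. G h \<partial>lborel) \<le> measure lborel (annulus :: 'a set) * M" .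
  then show ?thesis by (simp add: pos_le_divide_eq mult.commute)
qed

context frac_exponents begin

section \<open>The ball profile\<close>

lemma radial_weight_on_line:
  fixes k :: "'a::euclidean_space"
  assumes "l \<noteq> 0"
  shows "\<bar>l\<bar> ^ (DIM('a) - 1) / norm (l *\<^sub>R k) powr (real DIM('a) + p * s)
    = \<bar>l\<bar> powr (- 1 - p * s) * norm k powr (- (real DIM('a) + p * s))"
proof -
  have "\<bar>l\<bar> ^ (DIM('a) - 1) = \<bar>l\<bar> powr (real DIM('a) - 1)"
    using assms powr_realpow[of "\<bar>l\<bar>" "DIM('a) - 1"] by (simp add: of_nat_diff)
  moreover have "\<bar>l\<bar> powr (real DIM('a) - 1) / \<bar>l\<bar> powr (real DIM('a) + p * s) = \<bar>l\<bar> powr (- 1 - p * s)"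
    by (simp add: powr_diff[symmetric])
  moreover have "\<bar>l\<bar> ^ (DIM('a) - 1) / norm (l *\<^sub>R k) powr (real DIM('a) + p * s)
    = \<bar>l\<bar> ^ (DIM('a) - 1) / \<bar>l\<bar> powr (real DIM('a) + p * s) * (1 / norm k powr (real DIM('a) + p * s))"
    by (simp add: powr_mult)
  ultimately show ?thesis
    by (simp only: powr_minus_divide)
qed

lemma integrable_min_kernel:
  "integrable lborel (\<lambda>h :: 'a::euclidean_space. min 1 (norm h powr p) / norm h powr (real DIM('a) + p * s))"
proof (rule integrableI_bounded)
  define g where "g = (\<lambda>l::real. 2 powr p * (indicator {0..1} l * l powr (- 1 - p * s + p) + indicator {1..} l * l powr (- 1 - p * s)))"
  have ps: "0 < p * s" "0 < p * (1 - s)" using s p by auto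
  have g: "integrable lborel g"
  proof -
    have "-1 < - 1 - p * s + p" using ps by (simp add: algebra_simps)
    then show ?thesis
      unfolding g_def
      using has_bochner_integral_powr_near_0[of "- 1 - p * s + p" 1] has_bochner_integral_powr_tail[of "- 1 - p * s" 1] ps
      by (intro integrable_mult_right Bochner_Integration.integrable_add) (auto simp: has_bochner_integral_iff)
  qed
  have g2: "integrable lborel (\<lambda>l. g l + g (0 + (-1) * l))"
    using g lborel_integrable_real_affine[OF g, of "-1" 0] by simp
  have g0: "0 \<le> g l" for l by (simp add: g_def)
  have "(\<integral>\<^sup>+ h. ennreal (norm (min 1 (norm (h :: 'a) powr p) / norm h powr (real DIM('a) + p * s))) \<partial>lborel) < \<infinity>"
  proof (rule nn_integral_finite_of_lines)
    show "(\<integral>\<^sup>+ l. ennreal (norm (g l + g (0 + (-1) * l))) \<partial>lborel) < \<infinity>"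
      using g2 by (simp add: integrable_iff_bounded)
    fix k :: 'a assume "k \<in> annulus"
    then have k: "1 \<le> norm k" "norm k \<le> 2" by (auto simp: annulus_def)
    show "(\<integral>\<^sup>+ l. ennreal (\<bar>l\<bar> ^ (DIM('a) - 1)) * ennreal (norm (min 1 (norm (l *\<^sub>R k) powr p)
        / norm (l *\<^sub>R k) powr (real DIM('a) + p * s))) \<partial>lborel)
      \<le> (\<integral>\<^sup>+ l. ennreal (norm (g l + g (0 + (-1) * l))) \<partial>lborel)"
    proof (intro nn_integral_mono)
      fix l :: real
      show "ennreal (\<bar>l\<bar> ^ (DIM('a) - 1)) * ennreal (norm (min 1 (norm (l *\<^sub>R k) powr p)
          / norm (l *\<^sub>R k) powr (real DIM('a) + p * s)))
        \<le> ennreal (norm (g l + g (0 + (-1) * l)))"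
      proof (cases "l = 0")
        case False
        have sym: "g \<bar>l\<bar> \<le> g l + g (0 + (-1) * l)"
          using g0[of l] g0[of "- l"] by (auto simp: abs_if)
        have "\<bar>l\<bar> ^ (DIM('a) - 1) * norm (min 1 (norm (l *\<^sub>R k) powr p) / norm (l *\<^sub>R k) powr (real DIM('a) + p * s))
          = min 1 (norm (l *\<^sub>R k) powr p) * (\<bar>l\<bar> powr (- 1 - p * s) * norm k powr (- (real DIM('a) + p * s)))"
          unfolding radial_weight_on_line[OF False, symmetric] by (simp add: min_def)
        also have "\<dots> \<le> min 1 (norm (l *\<^sub>R k) powr p) * (\<bar>l\<bar> powr (- 1 - p * s) * 1)"
        proof -
          have "norm k powr (- (real DIM('a) + p * s)) \<le> 1 powr (- (real DIM('a) + p * s))"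
            using k ps by (intro powr_mono2') auto
          then show ?thesis by (intro mult_left_mono) auto
        qed
        also have "\<dots> \<le> g \<bar>l\<bar>"
        proof (cases "\<bar>l\<bar> \<le> 1")
          case True
          have "norm (l *\<^sub>R k) powr p \<le> (\<bar>l\<bar> * 2) powr p"
            using k p by (intro powr_mono2) (auto intro!: mult_left_mono)
          also have "\<dots> = 2 powr p * \<bar>l\<bar> powr p" by (simp add: powr_mult)
          finally have "min 1 (norm (l *\<^sub>R k) powr p) * (\<bar>l\<bar> powr (- 1 - p * s) * 1)
              \<le> 2 powr p * \<bar>l\<bar> powr p * \<bar>l\<bar> powr (- 1 - p * s)"
            by (simp add: mult_right_mono)
          also have "\<dots> = 2 powr p * \<bar>l\<bar> powr (- 1 - p * s + p)"
            by (simp add: powr_add[symmetric] add.commute)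
          also have "\<dots> \<le> g \<bar>l\<bar>" using True unfolding g_def by (simp add: indicator_def)
          finally show ?thesis .
        next
          case False
          have "1 \<le> (2::real) powr p" using p by (intro ge_one_powr_ge_zero) auto
          then have "min 1 (norm (l *\<^sub>R k) powr p) * (\<bar>l\<bar> powr (- 1 - p * s) * 1) \<le> 2 powr p * \<bar>l\<bar> powr (- 1 - p * s)"
            by (intro mult_mono) auto
          then show ?thesis using False unfolding g_def by (simp add: indicator_def)
        qed
        finally have "\<bar>l\<bar> ^ (DIM('a) - 1) * norm (min 1 (norm (l *\<^sub>R k) powr p) / norm (l *\<^sub>R k) powr (real DIM('a) + p * s))
          \<le> norm (g l + g (0 + (-1) * l))"
          using sym by (metis order_trans abs_ge_self real_norm_def)
        then show ?thesis
          by (simp only: ennreal_mult[symmetric] norm_ge_zero zero_le_power abs_ge_zero ennreal_leI)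
      next
        case True
        then show ?thesis by simp
      qed
    qed
  qed measurable
  then show "(\<integral>\<^sup>+ h. ennreal (norm (min 1 (norm (h :: 'a) powr p) / norm h powr (real DIM('a) + p * s))) \<partial>lborel) < \<infinity>" .
qed measurable

lemma integrable_far_kernel:
  assumes e: "0 < \<epsilon>"
  shows "integrable lborel (\<lambda>h :: 'a::euclidean_space. indicator {h. \<epsilon> \<le> norm h} h / norm h powr (real DIM('a) + p * s))"
proof (rule Bochner_Integration.integrable_bound)
  let ?c = "min 1 (\<epsilon> powr p)"
  show "integrable lborel (\<lambda>h :: 'a. (1 / ?c) * (min 1 (norm h powr p) / norm h powr (real DIM('a) + p * s)))"
    using integrable_min_kernel by (rule integrable_mult_right)
  show "AE h in lborel. norm (indicator {h. \<epsilon> \<le> norm h} h / norm (h :: 'a) powr (real DIM('a) + p * s))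
     \<le> norm ((1 / ?c) * (min 1 (norm h powr p) / norm h powr (real DIM('a) + p * s)))" (is "AE h in _. ?l h \<le> ?r h")
  proof (intro AE_I2)
    fix h :: 'a
    show "?l h \<le> ?r h"
    proof (cases "\<epsilon> \<le> norm h")
      case True
      have c: "0 < ?c" using e by simp
      have "\<epsilon> powr p \<le> norm h powr p" using True e p by (intro powr_mono2) auto
      then have "?c \<le> min 1 (norm h powr p)" by auto
      then have "1 \<le> (1 / ?c) * min 1 (norm h powr p)" using c by (simp add: pos_le_divide_eq)
      then have "1 / norm h powr (real DIM('a) + p * s) \<le> (1 / ?c) * min 1 (norm h powr p) / norm h powr (real DIM('a) + p * s)"
        by (rule divide_right_mono) simp
      then show ?thesis using True c by simp
    qed simp
  qed
qed measurable

definition ball_profile :: "'a::euclidean_space \<Rightarrow> real \<Rightarrow> 'a \<Rightarrow> real" where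
  "ball_profile z R y = (max 0 (R\<^sup>2 - (norm (y - z))\<^sup>2)) powr s"

definition truncated_operator :: "real \<Rightarrow> ('a::euclidean_space \<Rightarrow> real) \<Rightarrow> 'a \<Rightarrow> real" where
  "truncated_operator \<epsilon> v x = (\<integral>h. indicator {h. \<epsilon> \<le> norm h} h *
     (Jp p (v x - v (x + h)) / norm h powr (real DIM('a) + p * s)) \<partial>lborel)"

lemma ball_profile_borel [measurable]: "ball_profile z R \<in> borel_measurable borel"
  unfolding ball_profile_def[abs_def] by measurable

lemma ball_profile_bounds:
  shows "0 \<le> ball_profile z R y" "ball_profile z R y \<le> (R\<^sup>2) powr s"
  unfolding ball_profile_def using s by (auto intro!: powr_mono2)

text \<open>
  A quadratic polynomial with leading coefficient \<open>- (norm k)\<^sup>2\<close> that is positive at \<open>0\<close> is, after a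
  shift, the parabola of a chord.  By the Cauchy-Schwarz inequality the half-length of the chord,
  measured in units of \<open>k\<close>, is at most \<open>R / norm k\<close>.
\<close>

lemma ball_profile_on_line:
  fixes x z k :: "'a::euclidean_space"
  assumes k: "k \<noteq> 0" and x: "norm (x - z) < R"
  obtains \<tau> l where "\<bar>\<tau>\<bar> < l" "l \<le> R / norm k"
    "\<And>r. ball_profile z R (x + r *\<^sub>R k) = ((norm k)\<^sup>2) powr s * (max 0 (l\<^sup>2 - (\<tau> + r)\<^sup>2)) powr s"
proof -
  define \<tau> where "\<tau> = ((x - z) \<bullet> k) / (norm k)\<^sup>2"
  define l where "l = sqrt ((R\<^sup>2 - (norm (x - z))\<^sup>2) / (norm k)\<^sup>2 + \<tau>\<^sup>2)"
  have nk: "0 < (norm k)\<^sup>2" using k by simp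
  have R: "0 < R" using x norm_ge_zero[of "x - z"] by linarith
  have xz: "(norm (x - z))\<^sup>2 < R\<^sup>2" using x by (intro power_strict_mono) auto
  have pos: "0 < (R\<^sup>2 - (norm (x - z))\<^sup>2) / (norm k)\<^sup>2" using xz nk by simp
  then have l2: "l\<^sup>2 = (R\<^sup>2 - (norm (x - z))\<^sup>2) / (norm k)\<^sup>2 + \<tau>\<^sup>2"
    unfolding l_def by (simp add: add_nonneg_nonneg)
  have l0: "0 \<le> l" unfolding l_def using pos by simp
  have 1: "\<bar>\<tau>\<bar> < l"
  proof (rule power_less_imp_less_base)
    show "\<bar>\<tau>\<bar>\<^sup>2 < l\<^sup>2" using pos l2 by simp
  qed (use l0 in auto)
  have 2: "l \<le> R / norm k"
  proof (rule power2_le_imp_le)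
    have "((x - z) \<bullet> k)\<^sup>2 \<le> (norm (x - z))\<^sup>2 * (norm k)\<^sup>2"
      using Cauchy_Schwarz_ineq[of "x - z" k] by (simp add: power2_norm_eq_inner)
    then have "\<tau>\<^sup>2 \<le> (norm (x - z))\<^sup>2 / (norm k)\<^sup>2"
      unfolding \<tau>_def using nk by (simp add: power_divide field_simps power2_eq_square)
    then show "l\<^sup>2 \<le> (R / norm k)\<^sup>2"
      unfolding l2 by (simp add: power_divide diff_divide_distrib)
  qed (use R in auto)
  have 3: "ball_profile z R (x + r *\<^sub>R k) = ((norm k)\<^sup>2) powr s * (max 0 (l\<^sup>2 - (\<tau> + r)\<^sup>2)) powr s" for r
  proof -
    have "(norm (x + r *\<^sub>R k - z))\<^sup>2 = (norm (x - z))\<^sup>2 + 2 * r * ((x - z) \<bullet> k) + r\<^sup>2 * (norm k)\<^sup>2"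
    proof -
      have "x + r *\<^sub>R k - z = (x - z) + r *\<^sub>R k" by simp
      then show ?thesis
        unfolding power2_norm_eq_inner
        by (simp only:) (simp add: inner_add_left inner_add_right inner_commute power2_eq_square[of r] distrib_left)
    qed
    moreover have "(x - z) \<bullet> k = (norm k)\<^sup>2 * \<tau>" unfolding \<tau>_def using nk by simp
    moreover have "R\<^sup>2 - (norm (x - z))\<^sup>2 = (norm k)\<^sup>2 * (l\<^sup>2 - \<tau>\<^sup>2)" unfolding l2 using nk by simp
    ultimately have "R\<^sup>2 - (norm (x + r *\<^sub>R k - z))\<^sup>2 = (norm k)\<^sup>2 * (l\<^sup>2 - (\<tau> + r)\<^sup>2)"
      by (simp add: power2_eq_square algebra_simps)
    then have "max 0 (R\<^sup>2 - (norm (x + r *\<^sub>R k - z))\<^sup>2) = (norm k)\<^sup>2 * max 0 (l\<^sup>2 - (\<tau> + r)\<^sup>2)"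
      using nk by (auto simp: max_def zero_le_mult_iff)
    then show ?thesis unfolding ball_profile_def by (simp add: powr_mult)
  qed
  show thesis using that 1 2 3 by blast
qed

lemma truncated_ball_profile_integrable:
  fixes x z :: "'a::euclidean_space"
  assumes e: "0 < \<epsilon>"
  shows "integrable lborel (\<lambda>h. indicator {h. \<epsilon> \<le> norm h} h *
    (Jp p (ball_profile z R x - ball_profile z R (x + h)) / norm h powr (real DIM('a) + p * s)))"
proof (rule Bochner_Integration.integrable_bound)
  let ?B = "((R\<^sup>2) powr s) powr (p - 1)"
  show "integrable lborel (\<lambda>h :: 'a. ?B * (indicator {h. \<epsilon> \<le> norm h} h / norm h powr (real DIM('a) + p * s)))"
    using integrable_far_kernel[OF e] by (rule integrable_mult_right)
  show "AE h in lborel. norm (indicator {h. \<epsilon> \<le> norm h} h *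
      (Jp p (ball_profile z R x - ball_profile z R (x + h)) / norm h powr (real DIM('a) + p * s)))
    \<le> norm (?B * (indicator {h. \<epsilon> \<le> norm h} h / norm h powr (real DIM('a) + p * s)))" (is "AE h in _. ?l h \<le> ?r h")
  proof (intro AE_I2)
    fix h :: 'a
    have "\<bar>ball_profile z R x - ball_profile z R (x + h)\<bar> \<le> (R\<^sup>2) powr s"
      using ball_profile_bounds[of z R x] ball_profile_bounds[of z R "x + h"] by linarith
    then have "\<bar>Jp p (ball_profile z R x - ball_profile z R (x + h))\<bar> \<le> ?B"
      unfolding Jp_abs using p by (intro powr_mono2) auto
    then show "?l h \<le> ?r h"
      by (auto simp: indicator_def intro!: divide_right_mono)
  qed
qed measurable

text \<open>
  On the line with direction \<open>k\<close> the integrand is that of an interval profile, times powers of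
  \<open>norm k\<close> that are bounded on the annulus.  As \<open>s * (p - 2) \<ge> 0\<close>, the bound for an interval does not
  deteriorate when the chord is short.
\<close>

lemma truncated_ball_profile_le:
  assumes R1: "0 < R1"
  obtains M where "0 \<le> M"
    and "\<And>(z :: 'a::euclidean_space) x R \<epsilon>. norm (x - z) < R \<Longrightarrow> R \<le> R1 \<Longrightarrow> 0 < \<epsilon> \<Longrightarrow>
      truncated_operator \<epsilon> (ball_profile z R) x \<le> M"
proof -
  obtain M where M: "0 \<le> M"
    and line: "\<And>l \<tau> \<epsilon>. \<bar>\<tau>\<bar> < l \<Longrightarrow> 0 < \<epsilon> \<Longrightarrow>
      (\<integral>r. interval_integrand l \<tau> \<epsilon> r \<partial>lborel)
      \<le> M * l powr (s * (p - 2))"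
    using interval_profile by blast
  define M1 where "M1 = ((2\<^sup>2) powr s) powr (p - 1) * (M * R1 powr (s * (p - 2)))"
  have M1: "0 \<le> M1" unfolding M1_def using M by simp
  have "truncated_operator \<epsilon> (ball_profile z R) x
      \<le> measure lborel (annulus :: 'a set) * M1 / (2 * ln 2)"
    if x: "norm (x - z) < R" and RR: "R \<le> R1" and e: "0 < \<epsilon>" for z x :: 'a and R \<epsilon>
    unfolding truncated_operator_def
  proof (rule integral_le_of_lines[OF truncated_ball_profile_integrable[OF e] M1])
    fix k :: 'a assume "k \<in> annulus"
    then have k: "1 \<le> norm k" "norm k \<le> 2" "k \<noteq> 0" by (auto simp: annulus_def)
    have R: "0 < R" using x norm_ge_zero[of "x - z"] by linarith
    obtain \<tau> l where l: "\<bar>\<tau>\<bar> < l" "l \<le> R / norm k"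
      and prof: "\<And>r. ball_profile z R (x + r *\<^sub>R k) = ((norm k)\<^sup>2) powr s * (max 0 (l\<^sup>2 - (\<tau> + r)\<^sup>2)) powr s"
      using ball_profile_on_line[OF k(3) x] by blast
    let ?G = "\<lambda>r. \<bar>r\<bar> ^ (DIM('a) - 1) * (indicator {h. \<epsilon> \<le> norm h} (r *\<^sub>R k) *
        (Jp p (ball_profile z R x - ball_profile z R (x + r *\<^sub>R k)) / norm (r *\<^sub>R k) powr (real DIM('a) + p * s)))"
    have lt: "0 \<le> l\<^sup>2 - \<tau>\<^sup>2" using l(1) by (simp add: abs_le_square_iff[symmetric])
    define c where "c = (((norm k)\<^sup>2) powr s) powr (p - 1) * norm k powr (- (real DIM('a) + p * s))"
    have "(\<integral>r. ?G r \<partial>lborel)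
      = (\<integral>r. c * interval_integrand l \<tau> (\<epsilon> / norm k) r \<partial>lborel)"
    proof (rule Bochner_Integration.integral_cong[OF refl])
      fix r :: real
      have ind: "\<epsilon> \<le> norm (r *\<^sub>R k) \<longleftrightarrow> \<epsilon> / norm k \<le> \<bar>r\<bar>"
        using k by (simp add: pos_divide_le_eq)
      show "?G r
        = c * interval_integrand l \<tau> (\<epsilon> / norm k) r"
      proof (cases "\<epsilon> / norm k \<le> \<bar>r\<bar>")
        case True
        have r: "r \<noteq> 0" using True ind e by auto
        have "ball_profile z R x = ((norm k)\<^sup>2) powr s * (l\<^sup>2 - \<tau>\<^sup>2) powr s"
          using prof[of 0] lt by simp
        then have J: "Jp p (ball_profile z R x - ball_profile z R (x + r *\<^sub>R k))
          = (((norm k)\<^sup>2) powr s) powr (p - 1) * Jp p ((l\<^sup>2 - \<tau>\<^sup>2) powr s - (max 0 (l\<^sup>2 - (\<tau> + r)\<^sup>2)) powr s)"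
          unfolding prof by (simp only: right_diff_distrib[symmetric]) (simp add: Jp_scale)
        have "\<bar>r\<bar> ^ (DIM('a) - 1) * (Jp p (ball_profile z R x - ball_profile z R (x + r *\<^sub>R k)) / norm (r *\<^sub>R k) powr (real DIM('a) + p * s))
          = Jp p (ball_profile z R x - ball_profile z R (x + r *\<^sub>R k)) * (\<bar>r\<bar> ^ (DIM('a) - 1) / norm (r *\<^sub>R k) powr (real DIM('a) + p * s))"
          by simp
        then show ?thesis
          unfolding radial_weight_on_line[OF r] J c_def interval_integrand_def using True ind by simp
      next
        case False
        then show ?thesis using ind by (simp add: interval_integrand_def)
      qed
    qed
    also have "\<dots> = c * (\<integral>r. interval_integrand l \<tau> (\<epsilon> / norm k) r \<partial>lborel)"
      by simp
    also have "\<dots> \<le> c * (M * l powr (s * (p - 2)))"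
      using line[OF l(1), of "\<epsilon> / norm k"] e k by (intro mult_left_mono) (auto simp: c_def)
    also have "\<dots> \<le> ((2\<^sup>2) powr s) powr (p - 1) * (M * R1 powr (s * (p - 2)))"
    proof (intro mult_mono)
      have "0 \<le> p * s" using s p by simp
      then have "norm k powr (- (real DIM('a) + p * s)) \<le> 1 powr (- (real DIM('a) + p * s))"
        using k \<open>0 \<le> p * s\<close> by (intro powr_mono2') auto
      moreover have "(((norm k)\<^sup>2) powr s) powr (p - 1) \<le> ((2\<^sup>2) powr s) powr (p - 1)"
        using k s p by (intro powr_mono2 power_mono) auto
      ultimately have "c \<le> ((2\<^sup>2) powr s) powr (p - 1) * 1"
        unfolding c_def by (intro mult_mono) auto
      then show "c \<le> ((2\<^sup>2) powr s) powr (p - 1)" by simp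
      have "R / norm k \<le> R" using R k by (simp add: pos_divide_le_eq)
      then have "l \<le> R1" using l RR by linarith
      then show "l powr (s * (p - 2)) \<le> R1 powr (s * (p - 2))"
        using l(1) s p by (intro powr_mono2) auto
    qed (use M in \<open>auto simp: c_def\<close>)
    finally show "(\<integral>r. ?G r \<partial>lborel)
      \<le> M1" unfolding M1_def .
  qed
  then show thesis
    using that[of "measure lborel (annulus :: 'a set) * M1 / (2 * ln 2)"] M1 by simp
qed

end

section \<open>Gagliardo energies and the weak form\<close>

interpretation lebesgue: sigma_finite_measure lebesgue
proof
  show "\<exists>A::'a set set. countable A \<and> A \<subseteq> sets lebesgue \<and> \<Union>A = space lebesgue \<and> (\<forall>a\<in>A. emeasure lebesgue a \<noteq> \<infinity>)"
    by (intro exI[of _ "range (\<lambda>n::nat. box (- real n *\<^sub>R One) (real n *\<^sub>R One))"])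
      (auto simp: UN_box_eq_UNIV)
qed

interpretation lebesgue_pair: pair_sigma_finite lebesgue lebesgue ..

lemma lebesgue_measurable_of_borel: "f \<in> borel_measurable borel \<Longrightarrow> f \<in> borel_measurable lebesgue"
  by (simp add: measurable_completion)

lemma pair_lebesgue_diff_measurable [measurable]:
  "(\<lambda>z :: 'a::euclidean_space \<times> 'a. fst z - snd z) \<in> borel_measurable (lebesgue \<Otimes>\<^sub>M lebesgue)"
proof -
  have id: "(\<lambda>x :: 'a. x) \<in> borel_measurable lebesgue"
    by (rule measurable_completion) simp
  have "(fst :: 'a \<times> 'a \<Rightarrow> 'a) \<in> borel_measurable (lebesgue \<Otimes>\<^sub>M lebesgue)"
    by (rule measurable_compose[OF measurable_fst id])
  moreover have "(snd :: 'a \<times> 'a \<Rightarrow> 'a) \<in> borel_measurable (lebesgue \<Otimes>\<^sub>M lebesgue)"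
    by (rule measurable_compose[OF measurable_snd id])
  ultimately show ?thesis by (rule borel_measurable_diff)
qed

lemma kernel_measurable_pair:
  fixes \<kappa> :: "'a::euclidean_space \<Rightarrow> real"
  assumes "\<kappa> \<in> borel_measurable borel"
  shows "(\<lambda>z. \<kappa> (fst z - snd z)) \<in> borel_measurable (lebesgue \<Otimes>\<^sub>M lebesgue)"
  using measurable_compose[OF pair_lebesgue_diff_measurable assms] .

lemma lebesgue_integral_translate:
  fixes f :: "'a::euclidean_space \<Rightarrow> real"
  assumes "integrable lborel (\<lambda>h. f (x + h))" and [measurable]: "f \<in> borel_measurable borel"
  shows "integrable lebesgue f" "(\<integral>y. f y \<partial>lebesgue) = (\<integral>h. f (x + h) \<partial>lborel)"
proof -
  have "integrable (distr lborel borel ((+) x)) f"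
    using assms(1) by (subst integrable_distr_eq) auto
  then show "integrable lebesgue f" by (simp add: lborel_distr_plus integrable_completion)
  have "(\<integral>y. f y \<partial>(distr lborel borel ((+) x))) = (\<integral>h. f (x + h) \<partial>lborel)"
    by (subst integral_distr) auto
  then show "(\<integral>y. f y \<partial>lebesgue) = (\<integral>h. f (x + h) \<partial>lborel)"
    by (simp add: lborel_distr_plus integral_completion)
qed

lemma integrable_reflect:
  fixes f :: "'a::euclidean_space \<Rightarrow> real"
  assumes "integrable lborel f"
  shows "integrable lborel (\<lambda>h. f (- h))" "(\<integral>h. f (- h) \<partial>lborel) = (\<integral>h. f h \<partial>lborel)"
proof -
  have [measurable]: "f \<in> borel_measurable borel" using borel_measurable_integrable[OF assms] by simp
  have d: "distr lborel borel uminus = (lborel :: 'a measure)"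
    using lborel_affine[of "-1" "0 :: 'a"] by (simp add: density_1)
  have "integrable (distr lborel borel uminus) f" using assms d by simp
  then show "integrable lborel (\<lambda>h. f (- h))" by (subst (asm) integrable_distr_eq) auto
  have "(\<integral>h. f h \<partial>(distr lborel borel uminus)) = (\<integral>h. f (- h) \<partial>lborel)"
    by (subst integral_distr) auto
  then show "(\<integral>h. f (- h) \<partial>lborel) = (\<integral>h. f h \<partial>lborel)" using d by simp
qed

text \<open>
  Translation and reflection invariance make the inner integral independent of the first variable.
  All truncated double integrals below are majorized by functions of this kind.
\<close>

lemma integrable_convolution_kernel:
  fixes \<kappa> f :: "'a::euclidean_space \<Rightarrow> real"
  assumes f: "integrable lebesgue f" and k: "integrable lborel \<kappa>"
  shows "integrable (lebesgue \<Otimes>\<^sub>M lebesgue) (\<lambda>z. f (fst z) * \<kappa> (fst z - snd z))"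
proof (rule lebesgue_pair.Fubini_integrable)
  have kb [measurable]: "\<kappa> \<in> borel_measurable borel" using borel_measurable_integrable[OF k] by simp
  have fb [measurable]: "f \<in> borel_measurable lebesgue" using borel_measurable_integrable[OF f] .
  note [measurable] = kernel_measurable_pair[OF kb]
  show "(\<lambda>z. f (fst z) * \<kappa> (fst z - snd z)) \<in> borel_measurable (lebesgue \<Otimes>\<^sub>M lebesgue)"
    by measurable
  have inner: "integrable lebesgue (\<lambda>y. \<kappa> (x - y))"
      "(\<integral>y. norm (\<kappa> (x - y)) \<partial>lebesgue) = (\<integral>h. \<bar>\<kappa> h\<bar> \<partial>lborel)" for x
  proof -
    have "integrable lborel (\<lambda>h. \<kappa> (- h))" using integrable_reflect[OF k] by simp
    then show "integrable lebesgue (\<lambda>y. \<kappa> (x - y))"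
      using lebesgue_integral_translate(1)[of "\<lambda>y. \<kappa> (x - y)" x] by simp
    have "integrable lborel (\<lambda>h. \<bar>\<kappa> h\<bar>)" using k by simp
    from integrable_reflect[OF this] show "(\<integral>y. norm (\<kappa> (x - y)) \<partial>lebesgue) = (\<integral>h. \<bar>\<kappa> h\<bar> \<partial>lborel)"
      using lebesgue_integral_translate(2)[of "\<lambda>y. \<bar>\<kappa> (x - y)\<bar>" x] by simp
  qed
  have "(\<integral>y. norm (f x * \<kappa> (x - y)) \<partial>lebesgue) = \<bar>f x\<bar> * (\<integral>h. \<bar>\<kappa> h\<bar> \<partial>lborel)" for x
    using inner(2)[of x] by (simp add: abs_mult)
  then show "integrable lebesgue (\<lambda>x. \<integral>y. norm (f (fst (x, y)) * \<kappa> (fst (x, y) - snd (x, y))) \<partial>lebesgue)"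
    using f by simp
  show "AE x in lebesgue. integrable lebesgue (\<lambda>y. f (fst (x, y)) * \<kappa> (fst (x, y) - snd (x, y)))"
    using inner(1) by simp
qed

lemma integrable_pair_swap:
  fixes F :: "'a::euclidean_space \<times> 'a \<Rightarrow> real"
  assumes "integrable (lebesgue \<Otimes>\<^sub>M lebesgue) F"
  shows "integrable (lebesgue \<Otimes>\<^sub>M lebesgue) (\<lambda>z. F (snd z, fst z))"
    "(\<integral>z. F (snd z, fst z) \<partial>(lebesgue \<Otimes>\<^sub>M lebesgue)) = (\<integral>z. F z \<partial>(lebesgue \<Otimes>\<^sub>M lebesgue))"
  using lebesgue_pair.integrable_product_swap[OF assms]
    lebesgue_pair.integral_product_swap[OF borel_measurable_integrable[OF assms]]
  by (simp_all add: case_prod_beta')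

definition gagliardo_integrand :: "real \<Rightarrow> real \<Rightarrow> ('a::euclidean_space \<Rightarrow> real) \<Rightarrow> 'a \<times> 'a \<Rightarrow> real" where
  "gagliardo_integrand s p u z =
     \<bar>u (fst z) - u (snd z)\<bar> powr p / norm (fst z - snd z) powr (real DIM('a) + p * s)"

definition frac_integrand ::
  "real \<Rightarrow> real \<Rightarrow> ('a::euclidean_space \<Rightarrow> real) \<Rightarrow> ('a \<Rightarrow> real) \<Rightarrow> 'a \<times> 'a \<Rightarrow> real" where
  "frac_integrand s p u \<phi> z = Jp p (u (fst z) - u (snd z)) * (\<phi> (fst z) - \<phi> (snd z))
     / norm (fst z - snd z) powr (real DIM('a) + p * s)"

lemma frac_p_laplacian_eq:
  "frac_p_laplacian s p u \<phi> = (\<integral>z. frac_integrand s p u \<phi> z \<partial>(lebesgue \<Otimes>\<^sub>M lebesgue))"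
  unfolding frac_p_laplacian_def frac_integrand_def Jp_def by (simp add: case_prod_beta')

lemma gagliardo_integrand_measurable [measurable]:
  fixes u :: "'a::euclidean_space \<Rightarrow> real"
  assumes [measurable]: "u \<in> borel_measurable lebesgue"
  shows "gagliardo_integrand s p u \<in> borel_measurable (lebesgue \<Otimes>\<^sub>M lebesgue)"
proof -
  have [measurable]: "(\<lambda>z :: 'a \<times> 'a. norm (fst z - snd z) powr (real DIM('a) + p * s)) \<in> borel_measurable (lebesgue \<Otimes>\<^sub>M lebesgue)"
    by (intro kernel_measurable_pair) measurable
  show ?thesis unfolding gagliardo_integrand_def[abs_def] by measurable
qed

lemma frac_integrand_measurable [measurable]:
  fixes u \<phi> :: "'a::euclidean_space \<Rightarrow> real"
  assumes [measurable]: "u \<in> borel_measurable lebesgue" "\<phi> \<in> borel_measurable lebesgue"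
  shows "frac_integrand s p u \<phi> \<in> borel_measurable (lebesgue \<Otimes>\<^sub>M lebesgue)"
proof -
  have [measurable]: "(\<lambda>z :: 'a \<times> 'a. norm (fst z - snd z) powr (real DIM('a) + p * s)) \<in> borel_measurable (lebesgue \<Otimes>\<^sub>M lebesgue)"
    by (intro kernel_measurable_pair) measurable
  show ?thesis unfolding frac_integrand_def[abs_def] by measurable
qed

lemma Wsp_iff:
  fixes u :: "'a::euclidean_space \<Rightarrow> real"
  shows "u \<in> Wsp s p \<longleftrightarrow> u \<in> borel_measurable lebesgue \<and> integrable lebesgue (\<lambda>x. \<bar>u x\<bar> powr p)
    \<and> integrable (lebesgue \<Otimes>\<^sub>M lebesgue) (gagliardo_integrand s p u)"
proof -
  have g: "gagliardo_pow s p u = (\<integral>\<^sup>+z. ennreal (norm (gagliardo_integrand s p u z)) \<partial>(lebesgue \<Otimes>\<^sub>M lebesgue))"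
    unfolding gagliardo_pow_def by (intro nn_integral_cong) (auto simp: gagliardo_integrand_def)
  show ?thesis
    by (auto simp: Wsp_def g integrable_iff_bounded gagliardo_integrand_measurable)
qed

lemma powr_mult_le_sum_powr:
  fixes a b p :: real
  assumes "0 \<le> a" "0 \<le> b" "1 \<le> p"
  shows "a powr (p - 1) * b \<le> a powr p + b powr p"
proof (cases "b \<le> a")
  case True
  then have "a powr (p - 1) * b \<le> a powr (p - 1) * a" by (intro mult_left_mono) auto
  also have "\<dots> = a powr p" using assms powr_add[of a "p - 1" 1] by (cases "a = 0") auto
  finally show ?thesis by (smt (verit) powr_ge_zero)
next
  case False
  then have "a powr (p - 1) * b \<le> b powr (p - 1) * b"
    using assms by (intro mult_right_mono powr_mono2) auto
  also have "\<dots> = b powr p" using False assms powr_add[of b "p - 1" 1] by (cases "b = 0") auto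
  finally show ?thesis by (smt (verit) powr_ge_zero)
qed

lemma powr_add_le_two_powr:
  fixes a b p :: real
  assumes "0 \<le> a" "0 \<le> b" "0 \<le> p"
  shows "(a + b) powr p \<le> 2 powr p * (a powr p + b powr p)"
proof -
  have "(a + b) powr p \<le> (2 * max a b) powr p" using assms by (intro powr_mono2) auto
  also have "\<dots> = 2 powr p * (max a b) powr p" using assms by (simp add: powr_mult)
  also have "\<dots> \<le> 2 powr p * (a powr p + b powr p)" by (intro mult_left_mono) (auto simp: max_def)
  finally show ?thesis .
qed

text \<open>
  By Young's inequality the energies of \<open>u\<close> and \<open>\<phi>\<close> together majorize the integrand of the form.
\<close>

lemma integrable_frac_integrand:
  fixes u \<phi> :: "'a::euclidean_space \<Rightarrow> real"
  assumes "u \<in> Wsp s p" "\<phi> \<in> Wsp s p" "1 \<le> p"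
  shows "integrable (lebesgue \<Otimes>\<^sub>M lebesgue) (frac_integrand s p u \<phi>)"
proof (rule Bochner_Integration.integrable_bound)
  show "integrable (lebesgue \<Otimes>\<^sub>M lebesgue) (\<lambda>z. gagliardo_integrand s p u z + gagliardo_integrand s p \<phi> z)"
    using assms by (auto simp: Wsp_iff)
  show "frac_integrand s p u \<phi> \<in> borel_measurable (lebesgue \<Otimes>\<^sub>M lebesgue)"
    using assms by (intro frac_integrand_measurable) (auto simp: Wsp_iff)
  show "AE z in lebesgue \<Otimes>\<^sub>M lebesgue. norm (frac_integrand s p u \<phi> z)
     \<le> norm (gagliardo_integrand s p u z + gagliardo_integrand s p \<phi> z)" (is "AE z in _. ?l z \<le> ?r z")
  proof (intro AE_I2)
    fix z :: "'a \<times> 'a"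
    show "?l z \<le> ?r z"
      using divide_right_mono[OF powr_mult_le_sum_powr[of "\<bar>u (fst z) - u (snd z)\<bar>" "\<bar>\<phi> (fst z) - \<phi> (snd z)\<bar>" p],
          of "norm (fst z - snd z) powr (real DIM('a) + p * s)"] assms
      by (simp add: frac_integrand_def gagliardo_integrand_def abs_mult Jp_abs add_divide_distrib)
  qed
qed

context frac_exponents begin

text \<open>
  A point with \<open>v \<noteq> 0\<close> lies in \<open>S\<close>, so the integrand of the energy is at most a multiple of
  \<open>min 1 (norm (x - y) powr p)\<close> times the kernel, restricted to pairs with one point in \<open>S\<close>.
\<close>

lemma Lipschitz_bounded_support_in_Wsp:
  fixes v :: "'a::euclidean_space \<Rightarrow> real"
  assumes [measurable]: "v \<in> borel_measurable borel"
    and lip: "\<And>x y. \<bar>v x - v y\<bar> \<le> L * norm (x - y)"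
    and bnd: "\<And>x. \<bar>v x\<bar> \<le> B"
    and supp: "\<And>x. x \<notin> S \<Longrightarrow> v x = 0" and S: "bounded S" "S \<in> sets borel"
  shows "v \<in> Wsp s p"
proof -
  have S_fin: "emeasure lborel S < \<infinity>" using emeasure_bounded_finite[OF S(1)] by simp
  have indS: "integrable lebesgue (indicator S :: 'a \<Rightarrow> real)"
    using S S_fin by (intro integrable_real_indicator) auto
  have B: "0 \<le> B" using bnd[of 0] by linarith
  have vm: "v \<in> borel_measurable lebesgue" by (simp add: lebesgue_measurable_of_borel)
  have 1: "integrable lebesgue (\<lambda>x. \<bar>v x\<bar> powr p)"
  proof (rule Bochner_Integration.integrable_bound)
    show "integrable lebesgue (\<lambda>x. B powr p * indicator S x)" using indS by simp
    show "AE x in lebesgue. norm (\<bar>v x\<bar> powr p) \<le> norm (B powr p * indicator S x)"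
      using bnd supp p by (auto simp: indicator_def intro!: powr_mono2)
  qed (use vm in measurable)
  define C where "C = max (\<bar>L\<bar> powr p) ((2 * B) powr p)"
  define \<kappa> where "\<kappa> = (\<lambda>h :: 'a. min 1 (norm h powr p) / norm h powr (real DIM('a) + p * s))"
  have \<kappa>: "integrable lborel \<kappa>" unfolding \<kappa>_def by (rule integrable_min_kernel)
  define H where "H = (\<lambda>z :: 'a \<times> 'a. indicator S (fst z) * \<kappa> (fst z - snd z))"
  have H: "integrable (lebesgue \<Otimes>\<^sub>M lebesgue) H"
    unfolding H_def by (rule integrable_convolution_kernel[OF indS \<kappa>])
  have 2: "integrable (lebesgue \<Otimes>\<^sub>M lebesgue) (gagliardo_integrand s p v)"
  proof (rule Bochner_Integration.integrable_bound)
    show "integrable (lebesgue \<Otimes>\<^sub>M lebesgue) (\<lambda>z. C * (H z + H (snd z, fst z)))"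
      using H integrable_pair_swap[OF H] by simp
    show "AE z in lebesgue \<Otimes>\<^sub>M lebesgue. norm (gagliardo_integrand s p v z) \<le> norm (C * (H z + H (snd z, fst z)))" (is "AE z in _. ?l z \<le> ?r z")
    proof (intro AE_I2)
      fix z :: "'a \<times> 'a"
      obtain x y where z: "z = (x, y)" by (cases z)
      have C0: "0 \<le> C" unfolding C_def by (simp add: le_max_iff_disj)
      have num: "\<bar>v x - v y\<bar> powr p \<le> C * min 1 (norm (x - y) powr p)"
      proof (cases "norm (x - y) powr p \<le> 1")
        case True
        have "\<bar>v x - v y\<bar> powr p \<le> (\<bar>L\<bar> * norm (x - y)) powr p"
          using p by (intro powr_mono2 order_trans[OF lip] mult_right_mono) auto
        also have "\<dots> \<le> C * norm (x - y) powr p"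
          unfolding C_def by (simp add: powr_mult mult_right_mono)
        finally show ?thesis using True by (simp add: min_def)
      next
        case False
        have "\<bar>v x - v y\<bar> powr p \<le> (2 * B) powr p"
          using p bnd[of x] bnd[of y] by (intro powr_mono2) auto
        then show ?thesis using False unfolding C_def by (simp add: min_def max_def split: if_splits)
      qed
      have "norm (gagliardo_integrand s p v z) \<le> C * (H z + H (snd z, fst z))"
      proof (cases "x \<in> S \<or> y \<in> S")
        case True
        have k0: "0 \<le> \<kappa> h" for h unfolding \<kappa>_def by simp
        have "norm (gagliardo_integrand s p v z) \<le> C * \<kappa> (x - y)"
          using divide_right_mono[OF num, of "norm (x - y) powr (real DIM('a) + p * s)"]
          unfolding gagliardo_integrand_def \<kappa>_def z by simp
        also have "\<dots> \<le> C * (H z + H (snd z, fst z))"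
        proof (intro mult_left_mono C0)
          have "\<kappa> (y - x) = \<kappa> (x - y)" unfolding \<kappa>_def by (simp add: norm_minus_commute)
          then show "\<kappa> (x - y) \<le> H z + H (snd z, fst z)"
            unfolding H_def z using True k0 by (auto simp: indicator_def)
        qed
        finally show ?thesis .
      next
        case False
        then show ?thesis using supp unfolding gagliardo_integrand_def H_def z by simp
      qed
      then show "?l z \<le> ?r z" by simp
    qed
  qed (use vm in measurable)
  show ?thesis using 1 2 vm by (simp add: Wsp_iff)
qed

section \<open>Barriers on balls\<close>

text \<open>
  This is the profile of the larger ball of radius \<open>sqrt (R\<^sup>2 + d)\<close>, raised to its value \<open>d powr s\<close> on the
  sphere of radius \<open>R\<close> wherever it is smaller, and then lowered by this value.  Unlike the profile of
  the ball of radius \<open>R\<close> it is Lipschitz.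
\<close>

definition barrier :: "'a::euclidean_space \<Rightarrow> real \<Rightarrow> real \<Rightarrow> 'a \<Rightarrow> real" where
  "barrier z R d y = (max 0 (R\<^sup>2 - (norm (y - z))\<^sup>2) + d) powr s - d powr s"

lemma barrier_borel [measurable]: "barrier z R d \<in> borel_measurable borel"
  unfolding barrier_def[abs_def] by measurable

lemma barrier_nonneg: "0 \<le> d \<Longrightarrow> 0 \<le> barrier z R d y"
  unfolding barrier_def using s by (simp add: powr_mono2)

lemma barrier_le: "0 \<le> d \<Longrightarrow> barrier z R d y \<le> (R\<^sup>2 + d) powr s"
proof -
  assume d: "0 \<le> d"
  have "(max 0 (R\<^sup>2 - (norm (y - z))\<^sup>2) + d) powr s \<le> (R\<^sup>2 + d) powr s"
    using s d by (intro powr_mono2) auto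
  then show ?thesis unfolding barrier_def by (smt (verit) powr_ge_zero)
qed

lemma barrier_outside: "0 \<le> R \<Longrightarrow> y \<notin> ball z R \<Longrightarrow> barrier z R d y = 0"
proof -
  assume "0 \<le> R" "y \<notin> ball z R"
  then have "R\<^sup>2 \<le> (norm (y - z))\<^sup>2"
    by (intro power_mono) (auto simp: dist_norm norm_minus_commute)
  then show ?thesis unfolding barrier_def by (simp add: max_def)
qed

lemma barrier_Lipschitz:
  assumes d: "0 < d" and R: "0 \<le> R"
  shows "\<bar>barrier z R d x - barrier z R d y\<bar> \<le> d powr (s - 1) * (2 * R) * norm (x - y)"
proof -
  let ?m = "\<lambda>y. max 0 (R\<^sup>2 - (norm (y - z))\<^sup>2)"
  have m: "?m y = R\<^sup>2 - (min (norm (y - z)) R)\<^sup>2" for y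
    using R power_mono[of "norm (y - z)" R 2] power_mono[of R "norm (y - z)" 2] by (auto simp: min_def max_def)
  have half: "barrier z R d x - barrier z R d y \<le> d powr (s - 1) * (2 * R) * norm (x - y)"
    if le: "?m y \<le> ?m x" for x y
  proof -
    have "barrier z R d x - barrier z R d y = (?m x + d) powr s - (max 0 ((?m x + d) - (?m x - ?m y))) powr s"
    proof -
      have "(?m x + d) - (?m x - ?m y) = ?m y + d" by simp
      moreover have "max 0 (?m y + d) = ?m y + d" using d by (intro max_absorb2) (simp add: add_nonneg_nonneg)
      ultimately show ?thesis unfolding barrier_def by (simp only:)
    qed
    also have "\<dots> \<le> (?m x + d) powr (s - 1) * (?m x - ?m y)"
      using d le s by (intro powr_diff_le_tangent) auto
    also have "\<dots> \<le> d powr (s - 1) * (?m x - ?m y)"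
      using d le s by (intro mult_right_mono powr_mono2') auto
    also have "\<dots> \<le> d powr (s - 1) * ((2 * R) * norm (x - y))"
    proof (intro mult_left_mono)
      define a b where "a = min (norm (x - z)) R" and "b = min (norm (y - z)) R"
      have ab: "0 \<le> a" "a \<le> R" "0 \<le> b" "b \<le> R" unfolding a_def b_def using R by auto
      have "\<bar>norm (y - z) - norm (x - z)\<bar> \<le> norm (x - y)"
        using norm_triangle_ineq3[of "y - z" "x - z"] by (simp add: norm_minus_commute)
      then have "b - a \<le> norm (x - y)" unfolding a_def b_def by (auto simp: min_def)
      have "?m x - ?m y = (b + a) * (b - a)" unfolding m a_def b_def by (simp add: power2_eq_square algebra_simps)
      also have "\<dots> \<le> (b + a) * norm (x - y)"
        using ab \<open>b - a \<le> norm (x - y)\<close> by (intro mult_left_mono) auto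
      also have "\<dots> \<le> (2 * R) * norm (x - y)" using ab by (intro mult_right_mono) auto
      finally show "?m x - ?m y \<le> (2 * R) * norm (x - y)" .
    qed auto
    finally show ?thesis by (simp add: mult.assoc)
  qed
  have mono: "barrier z R d y \<le> barrier z R d x" if "?m y \<le> ?m x" for x y
    unfolding barrier_def using that d s by (intro diff_right_mono powr_mono2) auto
  show ?thesis
  proof (cases "?m y \<le> ?m x")
    case True
    then show ?thesis using half mono by (simp add: abs_of_nonneg)
  next
    case False
    then have "?m x \<le> ?m y" by linarith
    then show ?thesis using half[of x y] mono[of x y] by (simp only: norm_minus_commute[of x y] abs_minus_commute[of "barrier z R d x"] abs_of_nonneg diff_ge_0_iff_ge)
  qed
qed

lemma barrier_in_Wsp:
  assumes d: "0 < d" and R: "0 \<le> R"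
  shows "barrier (z :: 'a::euclidean_space) R d \<in> Wsp s p"
proof (rule Lipschitz_bounded_support_in_Wsp)
  show "\<bar>barrier z R d x - barrier z R d y\<bar> \<le> (d powr (s - 1) * (2 * R)) * norm (x - y)" for x y
    using barrier_Lipschitz[OF d R] .
  show "\<bar>barrier z R d x\<bar> \<le> (R\<^sup>2 + d) powr s" for x
    using barrier_le[of d z R x] barrier_nonneg[of d z R x] d by simp
  show "x \<notin> ball z R \<Longrightarrow> barrier z R d x = 0" for x using barrier_outside[OF R] .
qed auto

text \<open>
  Up to the constant \<open>d powr s\<close> the barrier agrees with the larger ball profile at \<open>x\<close> and is nowhere
  below it.
\<close>

lemma barrier_diff_le_ball_profile:
  assumes d: "0 < d" and x: "norm (x - z) < R"
  shows "barrier z R d x - barrier z R d y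
    \<le> ball_profile z (sqrt (R\<^sup>2 + d)) x - ball_profile z (sqrt (R\<^sup>2 + d)) y"
proof -
  have sq: "(sqrt (R\<^sup>2 + d))\<^sup>2 = R\<^sup>2 + d" using d by (simp add: add_nonneg_nonneg)
  have "(norm (x - z))\<^sup>2 \<le> R\<^sup>2" using x by (intro power_mono) auto
  then have "barrier z R d x = ball_profile z (sqrt (R\<^sup>2 + d)) x - d powr s"
    unfolding barrier_def ball_profile_def sq using d by (simp add: max_absorb2 algebra_simps)
  moreover have "ball_profile z (sqrt (R\<^sup>2 + d)) y - d powr s \<le> barrier z R d y"
    unfolding barrier_def ball_profile_def sq using d s
    by (auto intro!: powr_mono2)
  ultimately show ?thesis by linarith
qed

text \<open>
  The kernel may be too singular for the operator of the barrier to converge absolutely at a point, but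
  the double integral with \<open>\<phi>\<close> converges.  It is the limit of its truncations \<open>norm (x - y) \<ge> \<epsilon>\<close>.  These
  split by antisymmetry into two equal integrals of \<open>\<phi>\<close> against truncated operators, which are
  bounded by those of the ball profile.
\<close>

lemma barrier_weak_subsolution:
  fixes z :: "'a::euclidean_space" and \<phi> :: "'a \<Rightarrow> real"
  assumes M: "\<And>x \<epsilon>. norm (x - z) < sqrt (R\<^sup>2 + d) \<Longrightarrow> 0 < \<epsilon> \<Longrightarrow>
      truncated_operator \<epsilon> (ball_profile z (sqrt (R\<^sup>2 + d))) x \<le> M"
    and d: "0 < d" and R: "0 < R"
    and \<phi>: "\<phi> \<in> Wsp s p" "\<And>x. 0 \<le> \<phi> x" "\<And>x. x \<notin> ball z R \<Longrightarrow> \<phi> x = 0" "integrable lebesgue \<phi>"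
  shows "frac_p_laplacian s p (barrier z R d) \<phi> \<le> 2 * M * (\<integral>x. \<phi> x \<partial>lebesgue)"
proof -
  define v where "v = barrier z R d"
  define R' where "R' = sqrt (R\<^sup>2 + d)"
  define P where "P = (lebesgue :: 'a measure) \<Otimes>\<^sub>M (lebesgue :: 'a measure)"
  have [measurable]: "v \<in> borel_measurable borel" unfolding v_def by measurable
  have vl [measurable]: "v \<in> borel_measurable lebesgue" by (simp add: lebesgue_measurable_of_borel)
  have \<phi>m [measurable]: "\<phi> \<in> borel_measurable lebesgue" using \<phi>(1) by (simp add: Wsp_iff)
  have vW: "v \<in> Wsp s p" unfolding v_def by (rule barrier_in_Wsp[OF d less_imp_le[OF R]])
  have RR': "R < R'" unfolding R'_def using d R by (intro real_less_rsqrt) simp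
  define Bv where "Bv = (R\<^sup>2 + d) powr s"
  have v_bound: "\<bar>v x - v y\<bar> \<le> Bv" for x y
    using barrier_le[of d z R x] barrier_nonneg[of d z R x] barrier_le[of d z R y] barrier_nonneg[of d z R y] d
    unfolding v_def Bv_def by linarith
  define \<kappa> where "\<kappa> = (\<lambda>\<epsilon> (h :: 'a). indicator {h. \<epsilon> \<le> norm h} h / norm h powr (real DIM('a) + p * s))"
  have \<kappa>: "integrable lborel (\<kappa> \<epsilon>)" if "0 < \<epsilon>" for \<epsilon>
    unfolding \<kappa>_def using integrable_far_kernel[OF that] .
  have \<kappa>m: "\<kappa> \<epsilon> \<in> borel_measurable borel" for \<epsilon> unfolding \<kappa>_def by measurable
  note [measurable] = kernel_measurable_pair[OF \<kappa>m]
  define a where "a = (\<lambda>\<epsilon> (w :: 'a \<times> 'a). \<phi> (fst w) * (Jp p (v (fst w) - v (snd w)) * \<kappa> \<epsilon> (fst w - snd w)))"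
  have am: "a \<epsilon> \<in> borel_measurable P" for \<epsilon> unfolding a_def P_def by measurable
  have a: "integrable P (a \<epsilon>)" if e: "0 < \<epsilon>" for \<epsilon>
  proof (rule Bochner_Integration.integrable_bound)
    show "integrable P (\<lambda>w. Bv powr (p - 1) * (\<phi> (fst w) * \<kappa> \<epsilon> (fst w - snd w)))"
      unfolding P_def using integrable_convolution_kernel[OF \<phi>(4) \<kappa>[OF e]] by (rule integrable_mult_right)
    show "AE w in P. norm (a \<epsilon> w) \<le> norm (Bv powr (p - 1) * (\<phi> (fst w) * \<kappa> \<epsilon> (fst w - snd w)))" (is "AE w in _. ?l w \<le> ?r w")
    proof (intro AE_I2)
      fix w :: "'a \<times> 'a"
      have "\<bar>Jp p (v (fst w) - v (snd w))\<bar> \<le> Bv powr (p - 1)"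
        unfolding Jp_abs using v_bound p by (intro powr_mono2) auto
      then have "\<bar>Jp p (v (fst w) - v (snd w))\<bar> * (\<bar>\<phi> (fst w)\<bar> * \<bar>\<kappa> \<epsilon> (fst w - snd w)\<bar>)
         \<le> Bv powr (p - 1) * (\<bar>\<phi> (fst w)\<bar> * \<bar>\<kappa> \<epsilon> (fst w - snd w)\<bar>)"
        by (intro mult_right_mono) auto
      then show "?l w \<le> ?r w"
        unfolding a_def by (simp add: abs_mult mult.left_commute)
    qed
  qed (rule am)
  have a_le: "(\<integral>w. a \<epsilon> w \<partial>P) \<le> M * (\<integral>x. \<phi> x \<partial>lebesgue)" if e: "0 < \<epsilon>" for \<epsilon>
  proof -
    have "(\<integral>w. a \<epsilon> w \<partial>P) = (\<integral>x. (\<integral>y. a \<epsilon> (x, y) \<partial>lebesgue) \<partial>lebesgue)"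
      unfolding P_def by (rule lebesgue_pair.integral_fst'[symmetric]) (use a[OF e] in \<open>simp add: P_def\<close>)
    also have "\<dots> \<le> (\<integral>x. M * \<phi> x \<partial>lebesgue)"
    proof (rule integral_mono)
      show "integrable lebesgue (\<lambda>x. \<integral>y. a \<epsilon> (x, y) \<partial>lebesgue)"
        by (rule lebesgue_pair.integrable_fst') (use a[OF e] in \<open>simp add: P_def\<close>)
      show "integrable lebesgue (\<lambda>x. M * \<phi> x)" using \<phi>(4) by simp
      fix x
      show "(\<integral>y. a \<epsilon> (x, y) \<partial>lebesgue) \<le> M * \<phi> x"
      proof (cases "x \<in> ball z R")
        case False
        then show ?thesis using \<phi>(3) unfolding a_def by simp
      next
        case True
        then have xz: "norm (x - z) < R" by (simp add: dist_norm norm_minus_commute)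
        define F where "F = (\<lambda>h. indicator {h. \<epsilon> \<le> norm h} h *
          (Jp p (ball_profile z R' x - ball_profile z R' (x + h)) / norm h powr (real DIM('a) + p * s)))"
        define E where "E = (\<lambda>y. Jp p (v x - v y) * \<kappa> \<epsilon> (x - y))"
        have [measurable]: "E \<in> borel_measurable borel"
        proof -
          have [measurable]: "(\<lambda>y. \<kappa> \<epsilon> (x - y)) \<in> borel_measurable borel"
            by (rule measurable_compose[OF _ \<kappa>m]) measurable
          show ?thesis unfolding E_def by measurable
        qed
        have F: "integrable lborel F" unfolding F_def using truncated_ball_profile_integrable[OF e] .
        have Eint: "integrable lborel (\<lambda>h. E (x + h))"
        proof (rule Bochner_Integration.integrable_bound)
          show "integrable lborel (\<lambda>h. Bv powr (p - 1) * \<kappa> \<epsilon> h)" using \<kappa>[OF e] by simp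
          show "AE h in lborel. norm (E (x + h)) \<le> norm (Bv powr (p - 1) * \<kappa> \<epsilon> h)" (is "AE h in _. ?l h \<le> ?r h")
          proof (intro AE_I2)
            fix h
            have "\<bar>Jp p (v x - v (x + h))\<bar> \<le> Bv powr (p - 1)"
              unfolding Jp_abs using v_bound p by (intro powr_mono2) auto
            then show "?l h \<le> ?r h"
              unfolding E_def \<kappa>_def by (auto simp: abs_mult indicator_def intro!: divide_right_mono)
          qed
        qed measurable
        have EF: "E (x + h) \<le> F h" for h
        proof -
          have "Jp p (v x - v (x + h)) \<le> Jp p (ball_profile z R' x - ball_profile z R' (x + h))"
            unfolding v_def R'_def using p d xz by (intro Jp_mono barrier_diff_le_ball_profile) auto
          then show ?thesis
            unfolding E_def F_def \<kappa>_def by (auto simp: indicator_def intro!: divide_right_mono)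
        qed
        have "(\<integral>y. E y \<partial>lebesgue) = (\<integral>h. E (x + h) \<partial>lborel)"
          using lebesgue_integral_translate(2)[OF Eint] by simp
        also have "\<dots> \<le> (\<integral>h. F h \<partial>lborel)" using Eint F EF by (intro integral_mono) auto
        also have "\<dots> \<le> M"
          using M[of x \<epsilon>] xz RR' e by (simp add: F_def R'_def truncated_operator_def)
        finally have "(\<integral>y. E y \<partial>lebesgue) \<le> M" .
        then have "\<phi> x * (\<integral>y. E y \<partial>lebesgue) \<le> \<phi> x * M" using \<phi>(2) by (intro mult_left_mono) auto
        then show ?thesis unfolding a_def E_def by (simp add: mult.commute)
      qed
    qed
    also have "\<dots> = M * (\<integral>x. \<phi> x \<partial>lebesgue)" by simp
    finally show ?thesis .
  qed
  define I where "I = (\<lambda>\<epsilon> w. a \<epsilon> w + a \<epsilon> (snd w, fst w))"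
  have I_eq: "I \<epsilon> w = indicator {h. \<epsilon> \<le> norm h} (fst w - snd w) * frac_integrand s p v \<phi> w" for \<epsilon> w
  proof -
    have "Jp p (v (snd w) - v (fst w)) = - Jp p (v (fst w) - v (snd w))"
      using Jp_minus[of p "v (fst w) - v (snd w)"] by simp
    moreover have "\<kappa> \<epsilon> (snd w - fst w) = \<kappa> \<epsilon> (fst w - snd w)"
      unfolding \<kappa>_def by (simp add: norm_minus_commute indicator_def)
    ultimately show ?thesis
      unfolding I_def a_def frac_integrand_def by (simp add: \<kappa>_def indicator_def diff_divide_distrib algebra_simps)
  qed
  have I_le: "(\<integral>w. I \<epsilon> w \<partial>P) \<le> 2 * M * (\<integral>x. \<phi> x \<partial>lebesgue)" if e: "0 < \<epsilon>" for \<epsilon>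
    using integrable_pair_swap[of "a \<epsilon>"] a[OF e] a_le[OF e] unfolding I_def P_def by simp
  have lim: "(\<lambda>n. \<integral>w. I (1 / real (Suc n)) w \<partial>P) \<longlonglongrightarrow> (\<integral>w. frac_integrand s p v \<phi> w \<partial>P)"
  proof (rule integral_dominated_convergence)
    have fi: "integrable P (frac_integrand s p v \<phi>)"
      unfolding P_def using integrable_frac_integrand[OF vW \<phi>(1)] p by simp
    then show "integrable P (\<lambda>w. norm (frac_integrand s p v \<phi> w))" by (rule integrable_norm)
    show "frac_integrand s p v \<phi> \<in> borel_measurable P" using fi by (rule borel_measurable_integrable)
    show "(\<lambda>w. I (1 / real (Suc n)) w) \<in> borel_measurable P" for n
      using a[of "1 / real (Suc n)"] integrable_pair_swap(1)[of "a (1 / real (Suc n))"]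
      unfolding I_def P_def by (auto intro!: borel_measurable_add borel_measurable_integrable)
    show "AE w in P. norm (I (1 / real (Suc n)) w) \<le> norm (frac_integrand s p v \<phi> w)" for n
      unfolding I_eq by (auto simp: indicator_def)
    show "AE w in P. (\<lambda>n. I (1 / real (Suc n)) w) \<longlonglongrightarrow> frac_integrand s p v \<phi> w" (is "AE w in _. ?L w")
    proof (intro AE_I2)
      fix w :: "'a \<times> 'a"
      show "?L w"
      proof (cases "fst w = snd w")
        case True
        then have "frac_integrand s p v \<phi> w = 0" unfolding frac_integrand_def by simp
        then show ?thesis unfolding I_eq by simp
      next
        case False
        then have "\<forall>\<^sub>F n in sequentially. 1 / real (Suc n) < norm (fst w - snd w)"
          using order_tendstoD(2)[OF LIMSEQ_inverse_real_of_nat, of "norm (fst w - snd w)"]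
          by (simp add: inverse_eq_divide)
        then have "\<forall>\<^sub>F n in sequentially. I (1 / real (Suc n)) w = frac_integrand s p v \<phi> w"
          unfolding I_eq by eventually_elim simp
        then show ?thesis by (rule tendsto_eventually)
      qed
    qed
  qed
  have "(\<integral>w. frac_integrand s p v \<phi> w \<partial>P) \<le> 2 * M * (\<integral>x. \<phi> x \<partial>lebesgue)"
    by (rule LIMSEQ_le_const2[OF lim]) (auto intro!: I_le)
  then show ?thesis unfolding frac_p_laplacian_eq v_def P_def .
qed

end

section \<open>Comparison on balls\<close>

lemma Jp_pos_part_mono:
  assumes "1 \<le> p"
  shows "Jp p (u1 - u2) * (max 0 (v1 - u1) - max 0 (v2 - u2))
    \<le> Jp p (v1 - v2) * (max 0 (v1 - u1) - max 0 (v2 - u2))"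
proof -
  consider "max 0 (v1 - u1) = max 0 (v2 - u2)" | "max 0 (v2 - u2) < max 0 (v1 - u1)"
    | "max 0 (v1 - u1) < max 0 (v2 - u2)" by linarith
  then show ?thesis
  proof cases
    case 2
    then have "u1 - u2 \<le> v1 - v2" by (auto simp: max_def split: if_splits)
    then show ?thesis using 2 assms by (intro mult_right_mono Jp_mono) auto
  next
    case 3
    then have "v1 - v2 \<le> u1 - u2" by (auto simp: max_def split: if_splits)
    then show ?thesis using 3 assms by (intro mult_right_mono_neg Jp_mono) auto
  qed simp
qed

lemma AE_eq_0_imp_continuous_le:
  fixes f g :: "'a::euclidean_space \<Rightarrow> real"
  assumes "open U" "continuous_on U f" "continuous_on U g"
    and ae: "AE x in lebesgue. max 0 (f x - g x) = 0" and x: "x \<in> U"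
  shows "f x \<le> g x"
proof (rule ccontr)
  assume "\<not> f x \<le> g x"
  define V where "V = {x \<in> U. 0 < f x - g x}"
  have "open V"
  proof -
    have "continuous_on U (\<lambda>x. f x - g x)" using assms by (intro continuous_intros)
    then have "open (U \<inter> (\<lambda>x. f x - g x) -` {0<..})"
      using assms(1) by (intro continuous_open_preimage open_greaterThan)
    moreover have "U \<inter> (\<lambda>x. f x - g x) -` {0<..} = {x \<in> U. 0 < f x - g x}" by auto
    ultimately show ?thesis unfolding V_def by (simp only:)
  qed
  moreover have "x \<in> V" using x \<open>\<not> f x \<le> g x\<close> unfolding V_def by simp
  moreover have "negligible V"
  proof -
    from ae obtain N where N: "N \<in> null_sets lebesgue" "{x. max 0 (f x - g x) \<noteq> 0} \<subseteq> N"
      by (auto simp: eventually_ae_filter)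
    have "V \<subseteq> N" using N(2) unfolding V_def by auto
    then show ?thesis using N(1) negligible_iff_null_sets negligible_subset by blast
  qed
  ultimately show False using open_not_negligible by auto
qed

context frac_exponents begin

lemma barrier_continuous:
  assumes d: "0 < d" shows "continuous_on A (barrier z R d)"
  unfolding barrier_def
  using d by (intro continuous_intros) (auto simp: add_nonneg_eq_0_iff max_def)

text \<open>
  The test function is the positive part of \<open>\<eta> * barrier - u\<close>.  Compared with the form of the barrier,
  the form of \<open>u\<close> gains \<open>\<kappa>0 * \<phi> x\<close> at every pair of \<open>x\<close> and a point of \<open>ball b \<rho>\<close>: there the barrier
  vanishes while \<open>u \<ge> e\<close>, and \<open>u x < e / 2\<close> where \<open>\<phi> x > 0\<close>, so that the difference of the values of \<open>u\<close>
  is at most \<open>- e / 2\<close>.  The factor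
  \<open>\<eta>\<close> depends on \<open>R1\<close> but not on the ball, since neither the gain nor the bound for the operator of the barrier does.
\<close>

lemma barrier_comparison:
  fixes \<Omega> :: "'a::euclidean_space set" and u :: "'a \<Rightarrow> real"
  assumes \<Omega>: "open \<Omega>" and D: "0 < D" "\<And>x y. x \<in> \<Omega> \<Longrightarrow> y \<in> \<Omega> \<Longrightarrow> norm (x - y) \<le> D"
    and u: "u \<in> Wsp s p" "\<And>x. x \<notin> \<Omega> \<Longrightarrow> u x = 0" "\<And>x. 0 \<le> u x" "continuous_on \<Omega> u"
    and super: "weak_supersolution s p \<Omega> g u" and g: "continuous_on UNIV g"
    and B: "0 < \<rho>" "ball b \<rho> \<subseteq> \<Omega>" "0 < e" "\<And>y. y \<in> ball b \<rho> \<Longrightarrow> e \<le> u y"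
    and R1: "0 < R1"
  obtains \<eta> where "0 < \<eta>"
    and "\<And>z R x. 0 < R \<Longrightarrow> R\<^sup>2 + 1 \<le> R1\<^sup>2 \<Longrightarrow> ball z R \<subseteq> \<Omega> \<Longrightarrow> ball z R \<inter> ball b \<rho> = {} \<Longrightarrow>
      x \<in> ball z R \<Longrightarrow> \<eta> * (R\<^sup>2 - (norm (x - z))\<^sup>2) powr s \<le> u x"
proof -
  obtain M where M: "0 \<le> M"
    and trunc: "\<And>(z :: 'a) x R \<epsilon>. norm (x - z) < R \<Longrightarrow> R \<le> R1 \<Longrightarrow> 0 < \<epsilon> \<Longrightarrow>
      truncated_operator \<epsilon> (ball_profile z R) x \<le> M"
    using truncated_ball_profile_le[OF R1] by blast
  define \<beta> where "\<beta> = measure lebesgue (ball b \<rho>)"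
  have \<beta>: "0 < \<beta>" unfolding \<beta>_def using B(1) by (simp add: content_ball_pos)
  \<comment> \<open>The pairs counted in the gain lie in \<open>\<Omega>\<close>, so their distance is at most \<open>D\<close>.\<close>
  define \<kappa>0 where "\<kappa>0 = (e / 2) powr (p - 1) / D powr (real DIM('a) + p * s)"
  have \<kappa>0: "0 < \<kappa>0" unfolding \<kappa>0_def using B(3) D(1) by simp
  define V where "V = (R1\<^sup>2) powr s"
  have V: "0 < V" unfolding V_def using R1 by simp
  have "isCont g 0" using g continuous_on_eq_continuous_at[of UNIV g] by simp
  then obtain \<delta>g where \<delta>g: "0 < \<delta>g" "\<And>t. \<bar>t\<bar> < \<delta>g \<Longrightarrow> \<bar>g t - g 0\<bar> < \<kappa>0 * \<beta> / 2"
    unfolding continuous_at_eps_delta using \<kappa>0 \<beta> by (auto simp: dist_real_def dest: spec[of _ "\<kappa>0 * \<beta> / 2"])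
  have "((\<lambda>\<eta>. 2 * M * \<eta> powr (p - 1)) \<longlongrightarrow> 2 * M * 0 powr (p - 1)) (at_right 0)"
  proof (intro tendsto_mult tendsto_const tendsto_powr')
    show "((\<lambda>x. x) \<longlongrightarrow> (0::real)) (at_right 0)" by (rule tendsto_ident_at)
    show "(0::real) \<noteq> 0 \<or> (p - 1 > 0 \<and> eventually (\<lambda>b::real. 0 \<le> b) (at_right 0))"
      using p eventually_at_right_real[of 0 1] by (auto elim!: eventually_mono)
  qed
  then have "((\<lambda>\<eta>. 2 * M * \<eta> powr (p - 1)) \<longlongrightarrow> 0) (at_right 0)" using p by simp
  then have "\<forall>\<^sub>F \<eta> in at_right 0. 2 * M * \<eta> powr (p - 1) < \<kappa>0 * \<beta>"
    using \<kappa>0 \<beta> by (intro order_tendstoD) auto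
  moreover have "\<forall>\<^sub>F \<eta> in at_right 0. \<eta> \<in> {0<..<min (e / 2 / V) (\<delta>g / V)}"
    using B(3) V \<delta>g by (intro eventually_at_right_real) auto
  ultimately have "\<forall>\<^sub>F \<eta> in at_right 0. 2 * M * \<eta> powr (p - 1) < \<kappa>0 * \<beta> \<and> \<eta> \<in> {0<..<min (e / 2 / V) (\<delta>g / V)}"
    by (rule eventually_conj)
  \<comment> \<open>The bound \<open>\<eta> * V < e / 2\<close> keeps the barrier below half of \<open>u\<close> on the small ball, and
      \<open>\<eta> * V < \<delta>g\<close> makes \<open>g(u) - g(0)\<close> smaller than \<open>\<kappa>0 * \<beta> / 2\<close> wherever \<open>u\<close> is below the
      barrier.  Of the gain \<open>2 * \<kappa>0 * \<beta>\<close> one half is used up by the operator of the barrier.\<close>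
  then obtain \<eta> where \<eta>1: "2 * M * \<eta> powr (p - 1) < \<kappa>0 * \<beta>" and "\<eta> \<in> {0<..<min (e / 2 / V) (\<delta>g / V)}"
    using eventually_happens'[of "at_right (0::real)"] by (auto simp: trivial_limit_at_right_real)
  then have \<eta>: "0 < \<eta>" "\<eta> * V < e / 2" "\<eta> * V < \<delta>g" using V by (auto simp: field_simps)

  have um [measurable]: "u \<in> borel_measurable lebesgue" using u(1) by (simp add: Wsp_iff)
  have main: "\<eta> * barrier z R d x \<le> u x"
    if R: "0 < R" "R\<^sup>2 + 1 \<le> R1\<^sup>2" and U: "ball z R \<subseteq> \<Omega>" "ball z R \<inter> ball b \<rho> = {}" and x: "x \<in> ball z R"
      and d: "0 < d" "d \<le> 1" for z R x d
  proof -
    define v where "v = barrier z R d"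
    define w where "w = (\<lambda>y. \<eta> * v y)"
    define \<phi> where "\<phi> = (\<lambda>y. max 0 (w y - u y))"
    define P where "P = (lebesgue :: 'a measure) \<Otimes>\<^sub>M (lebesgue :: 'a measure)"
    have sq: "sqrt (R\<^sup>2 + d) \<le> R1" using R d R1 by (intro real_le_lsqrt) auto
    have vm: "v \<in> borel_measurable lebesgue" unfolding v_def by (simp add: lebesgue_measurable_of_borel)
    then have [measurable]: "w \<in> borel_measurable lebesgue" unfolding w_def by simp
    have vW: "v \<in> Wsp s p" unfolding v_def by (rule barrier_in_Wsp[OF d(1) less_imp_le[OF R(1)]])
    have v_le: "v y \<le> V" for y
    proof -
      have "v y \<le> (R\<^sup>2 + d) powr s" unfolding v_def using d by (intro barrier_le) simp
      also have "\<dots> \<le> V" unfolding V_def using R d s by (intro powr_mono2) auto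
      finally show ?thesis .
    qed
    have w_bounds: "0 \<le> w y" "w y \<le> \<eta> * V" for y
      unfolding w_def using \<eta> v_le barrier_nonneg[of d z R y] d by (auto simp: v_def)
    have w_out: "w y = 0" if "y \<notin> ball z R" for y
      unfolding w_def v_def using barrier_outside[of R y z d] that R by simp
    have \<phi>0: "0 \<le> \<phi> y" for y unfolding \<phi>_def by simp
    have \<phi>_le: "\<phi> y \<le> \<eta> * V" for y
      unfolding \<phi>_def using w_bounds[of y] u(3)[of y] by simp
    have \<phi>_out: "\<phi> y = 0" if "y \<notin> ball z R" for y
      unfolding \<phi>_def using w_out[OF that] u(3)[of y] by simp
    have \<phi>m [measurable]: "\<phi> \<in> borel_measurable lebesgue" unfolding \<phi>_def by measurable
    have indU: "integrable lebesgue (indicator (ball z R) :: 'a \<Rightarrow> real)"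
      using emeasure_lborel_ball_finite[of z R] by (intro integrable_real_indicator) auto
    have \<phi>_int: "integrable lebesgue \<phi>"
    proof (rule Bochner_Integration.integrable_bound)
      show "integrable lebesgue (\<lambda>y. \<eta> * V * indicator (ball z R) y)" using indU by simp
      show "AE y in lebesgue. norm (\<phi> y) \<le> norm (\<eta> * V * indicator (ball z R) y)"
        using \<phi>0 order_trans[OF \<phi>_le abs_ge_self] \<phi>_out by (intro AE_I2) (auto simp: indicator_def)
    qed measurable
    have \<phi>W: "\<phi> \<in> Wsp s p"
    proof -
      have "integrable lebesgue (\<lambda>y. \<bar>\<phi> y\<bar> powr p)"
      proof (rule Bochner_Integration.integrable_bound)
        show "integrable lebesgue (\<lambda>y. (\<eta> * V) powr p * indicator (ball z R) y)" using indU by simp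
        show "AE y in lebesgue. norm (\<bar>\<phi> y\<bar> powr p) \<le> norm ((\<eta> * V) powr p * indicator (ball z R) y)" (is "AE y in _. ?l y \<le> ?r y")
        proof (intro AE_I2)
          fix y
          show "?l y \<le> ?r y"
            using \<phi>0[of y] \<phi>_le[of y] \<phi>_out[of y] p by (auto simp: indicator_def intro!: powr_mono2)
        qed
      qed measurable
      moreover have "integrable P (gagliardo_integrand s p \<phi>)"
      proof (rule Bochner_Integration.integrable_bound)
        show "integrable P (\<lambda>q. 2 powr p * (\<eta> powr p * gagliardo_integrand s p v q + gagliardo_integrand s p u q))"
          using vW u(1) unfolding P_def Wsp_iff by simp
        show "AE q in P. norm (gagliardo_integrand s p \<phi> q)
          \<le> norm (2 powr p * (\<eta> powr p * gagliardo_integrand s p v q + gagliardo_integrand s p u q))" (is "AE q in _. ?l q \<le> ?r q")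
        proof (intro AE_I2)
          fix q :: "'a \<times> 'a"
          have "\<bar>\<phi> (fst q) - \<phi> (snd q)\<bar> \<le> \<bar>w (fst q) - w (snd q)\<bar> + \<bar>u (fst q) - u (snd q)\<bar>"
            unfolding \<phi>_def by (auto simp: max_def)
          then have "\<bar>\<phi> (fst q) - \<phi> (snd q)\<bar> powr p \<le> (\<bar>w (fst q) - w (snd q)\<bar> + \<bar>u (fst q) - u (snd q)\<bar>) powr p"
            using p by (intro powr_mono2) auto
          also have "\<dots> \<le> 2 powr p * (\<bar>w (fst q) - w (snd q)\<bar> powr p + \<bar>u (fst q) - u (snd q)\<bar> powr p)"
            using p by (intro powr_add_le_two_powr) auto
          also have "\<bar>w (fst q) - w (snd q)\<bar> powr p = \<eta> powr p * \<bar>v (fst q) - v (snd q)\<bar> powr p"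
            unfolding w_def using \<eta> by (simp add: right_diff_distrib[symmetric] abs_mult powr_mult)
          finally show "?l q \<le> ?r q"
            unfolding gagliardo_integrand_def
            by (simp add: add_divide_distrib[symmetric] divide_right_mono)
        qed
      qed (use \<phi>m in \<open>simp add: P_def gagliardo_integrand_measurable\<close>)
      ultimately show ?thesis using \<phi>m unfolding P_def Wsp_iff by simp
    qed
    have \<phi>_test: "\<phi> \<in> Wsp0_pos s p \<Omega>"
    proof -
      have "\<phi> y = 0" if "y \<notin> \<Omega>" for y using that U(1) by (intro \<phi>_out) blast
      then show ?thesis unfolding Wsp0_pos_def Wsp0_def using \<phi>W \<phi>0 by (auto intro!: AE_I2)
    qed

    define C where "C = (\<lambda>q :: 'a \<times> 'a. \<phi> (fst q) * indicator (ball b \<rho>) (snd q) :: real)"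
    have C: "integrable P C" "(\<integral>q. C q \<partial>P) = \<beta> * (\<integral>y. \<phi> y \<partial>lebesgue)"
    proof -
      have indB: "integrable lebesgue (indicator (ball b \<rho>) :: 'a \<Rightarrow> real)"
        using emeasure_lborel_ball_finite[of b \<rho>] by (intro integrable_real_indicator) auto
      have in1: "(\<integral>y. C (x, y) \<partial>lebesgue) = \<phi> x * \<beta>" "(\<integral>y. norm (C (x, y)) \<partial>lebesgue) = \<phi> x * \<beta>" for x
        unfolding C_def \<beta>_def using \<phi>0 by simp_all
      show 1: "integrable P C"
        unfolding P_def
      proof (rule lebesgue_pair.Fubini_integrable)
        have [measurable]: "ball b \<rho> \<in> sets lebesgue" by simp
        show "C \<in> borel_measurable (lebesgue \<Otimes>\<^sub>M lebesgue)"
          unfolding C_def by measurable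
        show "integrable lebesgue (\<lambda>x. \<integral>y. norm (C (x, y)) \<partial>lebesgue)"
          unfolding in1 using \<phi>_int by simp
        show "AE x in lebesgue. integrable lebesgue (\<lambda>y. C (x, y))"
          unfolding C_def using indB by simp
      qed
      have "(\<integral>q. C q \<partial>P) = (\<integral>x. (\<integral>y. C (x, y) \<partial>lebesgue) \<partial>lebesgue)"
        using 1 unfolding P_def by (rule lebesgue_pair.integral_fst'[symmetric])
      then show "(\<integral>q. C q \<partial>P) = \<beta> * (\<integral>y. \<phi> y \<partial>lebesgue)" unfolding in1 by (simp add: mult.commute)
    qed

    have point: "frac_integrand s p u \<phi> q
      \<le> \<eta> powr (p - 1) * frac_integrand s p v \<phi> q - \<kappa>0 * (C q + C (snd q, fst q))" for q
    proof -
      obtain x y where q: "q = (x, y)" by (cases q)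
      define K where "K = 1 / norm (x - y) powr (real DIM('a) + p * s)"
      have K0: "0 \<le> K" unfolding K_def by simp
      have Jw: "Jp p (w x - w y) = \<eta> powr (p - 1) * Jp p (v x - v y)"
        unfolding w_def using \<eta> by (simp add: right_diff_distrib[symmetric] Jp_scale)
      have fu: "frac_integrand s p u \<phi> q = Jp p (u x - u y) * (\<phi> x - \<phi> y) * K"
        and fv: "\<eta> powr (p - 1) * frac_integrand s p v \<phi> q = Jp p (w x - w y) * (\<phi> x - \<phi> y) * K"
        unfolding frac_integrand_def K_def Jw q by simp_all
      have K_ge: "1 / D powr (real DIM('a) + p * s) \<le> K" if "x \<in> \<Omega>" "y \<in> \<Omega>" "x \<noteq> y"
      proof -
        have "norm (x - y) powr (real DIM('a) + p * s) \<le> D powr (real DIM('a) + p * s)"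
          using D(2)[OF that(1,2)] s p by (intro powr_mono2) auto
        then show ?thesis unfolding K_def using that(3) D(1) by (intro divide_left_mono) auto
      qed
      have gain: "Jp p (u x - u y) * \<phi> x * K \<le> Jp p (w x - w y) * \<phi> x * K - \<kappa>0 * \<phi> x"
        if y: "y \<in> ball b \<rho>" and x: "0 < \<phi> x" and K_ge: "1 / D powr (real DIM('a) + p * s) \<le> K" for x y
      proof -
        have wy: "w y = 0" using w_out y U(2) by blast
        have "u x < w x" using x unfolding \<phi>_def by (simp add: max_def split: if_splits)
        then have "u x - u y \<le> - (e / 2)" using w_bounds[of x] \<eta> B(4)[OF y] by linarith
        then have "Jp p (u x - u y) \<le> Jp p (- (e / 2))" using p by (intro Jp_mono) auto
        also have "\<dots> = - ((e / 2) powr (p - 1))" using B(3) by (simp only: Jp_minus) (simp add: Jp_nonneg_eq)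
        finally have "Jp p (u x - u y) * (\<phi> x * K) \<le> - ((e / 2) powr (p - 1)) * (\<phi> x * K)"
          using \<phi>0 K_ge D(1) by (intro mult_right_mono mult_nonneg_nonneg) (auto intro: order_trans[rotated])
        also have "\<dots> \<le> - ((e / 2) powr (p - 1)) * (\<phi> x * (1 / D powr (real DIM('a) + p * s)))"
          using K_ge \<phi>0 by (intro mult_left_mono_neg mult_left_mono) auto
        also have "\<dots> = - (\<kappa>0 * \<phi> x)" unfolding \<kappa>0_def by simp
        also have "\<dots> \<le> Jp p (w x - w y) * (\<phi> x * K) - \<kappa>0 * \<phi> x"
        proof -
          have "0 \<le> K" using K_ge by (rule order_trans[rotated]) simp
          then have "0 \<le> Jp p (w x - w y) * (\<phi> x * K)"
            using wy w_bounds(1)[of x] \<phi>0[of x] by (intro mult_nonneg_nonneg Jp_nonneg) auto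
          then show ?thesis by linarith
        qed
        finally show ?thesis by (simp add: mult.assoc)
      qed
      have zeroB: "\<phi> y = 0" if "y \<in> ball b \<rho>" for y using that U(2) \<phi>_out by blast
      have inU: "y \<in> ball z R" if "0 < \<phi> y" for y using that \<phi>_out[of y] by force
      consider "y \<in> ball b \<rho>" "0 < \<phi> x" | "x \<in> ball b \<rho>" "0 < \<phi> y"
        | "C q + C (snd q, fst q) = 0"
        using \<phi>0[of x] \<phi>0[of y] unfolding C_def q by (fastforce simp: indicator_def)
      then show ?thesis
      proof cases
        case 1
        have xU: "x \<in> ball z R" using inU 1 by simp
        have "x \<in> \<Omega>" "y \<in> \<Omega>" "x \<noteq> y" using xU 1 U B(2) by blast+
        then have "1 / D powr (real DIM('a) + p * s) \<le> K" by (rule K_ge)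
        moreover have "x \<notin> ball b \<rho>" using xU U(2) by blast
        ultimately show ?thesis
          unfolding fu fv using gain[OF 1] zeroB[OF 1(1)] 1 by (simp add: C_def q)
      next
        case 2
        have yU: "y \<in> ball z R" using inU 2 by simp
        have "x \<in> \<Omega>" "y \<in> \<Omega>" "x \<noteq> y" using yU 2 U B(2) by blast+
        then have "1 / D powr (real DIM('a) + p * s) \<le> K" by (rule K_ge)
        moreover have "y \<notin> ball b \<rho>" using yU U(2) by blast
        moreover have "Jp p (u x - u y) = - Jp p (u y - u x)" "Jp p (w x - w y) = - Jp p (w y - w x)"
          using Jp_minus[of p "u y - u x"] Jp_minus[of p "w y - w x"] by simp_all
        ultimately show ?thesis
          unfolding fu fv using gain[OF 2] zeroB[OF 2(1)] 2 by (simp add: C_def q)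
      next
        case 3
        then show ?thesis
          unfolding fu fv using Jp_pos_part_mono[of p "u x" "u y" "w x" "w y"] p K0
          by (simp add: \<phi>_def mult_right_mono)
      qed
    qed
    have Iu: "integrable P (frac_integrand s p u \<phi>)" and Iv: "integrable P (frac_integrand s p v \<phi>)"
      unfolding P_def using u(1) vW \<phi>W p by (auto intro!: integrable_frac_integrand)
    have C': "integrable P (\<lambda>q. C (snd q, fst q))" "(\<integral>q. C (snd q, fst q) \<partial>P) = \<beta> * (\<integral>y. \<phi> y \<partial>lebesgue)"
      using integrable_pair_swap[of C] C unfolding P_def by simp_all
    have "frac_p_laplacian s p u \<phi>
      \<le> (\<integral>q. \<eta> powr (p - 1) * frac_integrand s p v \<phi> q - \<kappa>0 * (C q + C (snd q, fst q)) \<partial>P)"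
      unfolding frac_p_laplacian_eq P_def[symmetric] using Iu Iv C C' point by (intro integral_mono) auto
    also have "\<dots> = \<eta> powr (p - 1) * frac_p_laplacian s p v \<phi> - \<kappa>0 * (2 * (\<beta> * (\<integral>y. \<phi> y \<partial>lebesgue)))"
      unfolding frac_p_laplacian_eq P_def[symmetric] using Iv C C' by simp
    also have "\<dots> \<le> \<eta> powr (p - 1) * (2 * M * (\<integral>y. \<phi> y \<partial>lebesgue)) - \<kappa>0 * (2 * (\<beta> * (\<integral>y. \<phi> y \<partial>lebesgue)))"
    proof -
      have "frac_p_laplacian s p v \<phi> \<le> 2 * M * (\<integral>y. \<phi> y \<partial>lebesgue)"
        unfolding v_def using trunc sq d(1) R(1) \<phi>W \<phi>0 \<phi>_out \<phi>_int
        by (intro barrier_weak_subsolution) auto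
      then show ?thesis by (intro diff_right_mono mult_left_mono) auto
    qed
    also have "\<dots> \<le> - (\<kappa>0 * \<beta>) * (\<integral>y. \<phi> y \<partial>lebesgue)"
    proof -
      have "(2 * M * \<eta> powr (p - 1)) * (\<integral>y. \<phi> y \<partial>lebesgue) \<le> (\<kappa>0 * \<beta>) * (\<integral>y. \<phi> y \<partial>lebesgue)"
        using \<eta>1 \<phi>0 by (intro mult_right_mono integral_nonneg) auto
      then show ?thesis by (simp add: algebra_simps)
    qed
    finally have frac_le: "frac_p_laplacian s p u \<phi> \<le> - (\<kappa>0 * \<beta>) * (\<integral>y. \<phi> y \<partial>lebesgue)" .

    have gu: "\<bar>(g (u y) - g 0) * \<phi> y\<bar> \<le> \<kappa>0 * \<beta> / 2 * \<phi> y" for y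
    proof (cases "0 < \<phi> y")
      case True
      then have "u y < w y" unfolding \<phi>_def by (simp add: max_def split: if_splits)
      then have "\<bar>u y\<bar> < \<delta>g" using u(3)[of y] w_bounds[of y] \<eta> by linarith
      then show ?thesis using \<delta>g(2)[of "u y"] True by (simp add: abs_mult)
    next
      case False
      then show ?thesis using \<phi>0[of y] by simp
    qed
    have [measurable]: "g \<in> borel_measurable borel" using g by (rule borel_measurable_continuous_onI)
    have gm: "(\<lambda>y. (g (u y) - g 0) * \<phi> y) \<in> borel_measurable lebesgue" by measurable
    have g_int: "integrable lebesgue (\<lambda>y. (g (u y) - g 0) * \<phi> y)"
      by (rule Bochner_Integration.integrable_bound[of _ "\<lambda>y. \<kappa>0 * \<beta> / 2 * \<phi> y"])
        (use \<phi>_int gm gu \<phi>0 \<kappa>0 \<beta> in auto)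
    have \<phi>\<Omega>: "\<phi> y = 0 \<or> y \<in> \<Omega>" for y using \<phi>_out[of y] U(1) by blast
    have e0: "(LINT y:\<Omega>|lebesgue. g 0 * \<phi> y) = (\<integral>y. g 0 * \<phi> y \<partial>lebesgue)"
      unfolding set_lebesgue_integral_def using \<phi>\<Omega> by (intro Bochner_Integration.integral_cong) (auto simp: indicator_def)
    have e1: "(LINT y:\<Omega>|lebesgue. g (u y) * \<phi> y) = (\<integral>y. (g (u y) - g 0) * \<phi> y + g 0 * \<phi> y \<partial>lebesgue)"
      unfolding set_lebesgue_integral_def using \<phi>\<Omega>
      by (intro Bochner_Integration.integral_cong) (auto simp: indicator_def algebra_simps)
    have "(LINT y:\<Omega>|lebesgue. g 0 * \<phi> y) \<le> frac_p_laplacian s p u \<phi> + (LINT y:\<Omega>|lebesgue. g (u y) * \<phi> y)"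
      using super \<phi>_test unfolding weak_supersolution_def by blast
    then have "0 \<le> frac_p_laplacian s p u \<phi> + (\<integral>y. (g (u y) - g 0) * \<phi> y \<partial>lebesgue)"
      unfolding e0 e1 using g_int \<phi>_int by simp
    also have "(\<integral>y. (g (u y) - g 0) * \<phi> y \<partial>lebesgue) \<le> (\<integral>y. \<kappa>0 * \<beta> / 2 * \<phi> y \<partial>lebesgue)"
      using g_int \<phi>_int order_trans[OF abs_ge_self gu] by (intro integral_mono) auto
    also have "frac_p_laplacian s p u \<phi> + (\<integral>y. \<kappa>0 * \<beta> / 2 * \<phi> y \<partial>lebesgue)
       \<le> - (\<kappa>0 * \<beta>) * (\<integral>y. \<phi> y \<partial>lebesgue) + \<kappa>0 * \<beta> / 2 * (\<integral>y. \<phi> y \<partial>lebesgue)"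
      using frac_le by (simp add: algebra_simps)
    finally have "\<kappa>0 * \<beta> * (\<integral>y. \<phi> y \<partial>lebesgue) \<le> 0" by (simp add: algebra_simps)
    then have "(\<integral>y. \<phi> y \<partial>lebesgue) \<le> 0" using \<kappa>0 \<beta> by (simp add: mult_le_0_iff)
    then have "(\<integral>y. \<phi> y \<partial>lebesgue) = 0" using \<phi>0 by (intro antisym integral_nonneg) auto
    then have "AE y in lebesgue. \<phi> y = 0"
      using integral_nonneg_eq_0_iff_AE[OF \<phi>_int] \<phi>0 by simp
    then have "AE y in lebesgue. max 0 (w y - u y) = 0" unfolding \<phi>_def .
    then have "w x \<le> u x"
    proof (rule AE_eq_0_imp_continuous_le[rotated 3])
      show "continuous_on (ball z R) w"
        unfolding w_def v_def using barrier_continuous[OF d(1)] by (intro continuous_intros) auto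
      show "continuous_on (ball z R) u" using u(4) U(1) continuous_on_subset by blast
    qed (use x in auto)
    then show ?thesis unfolding w_def v_def .
  qed
  have "\<eta> * (R\<^sup>2 - (norm (x - z))\<^sup>2) powr s \<le> u x"
    if R: "0 < R" "R\<^sup>2 + 1 \<le> R1\<^sup>2" and U: "ball z R \<subseteq> \<Omega>" "ball z R \<inter> ball b \<rho> = {}" and x: "x \<in> ball z R" for z R x
  proof -
    have xz: "(norm (x - z))\<^sup>2 < R\<^sup>2"
      using x R by (intro power_strict_mono) (auto simp: dist_norm norm_minus_commute)
    have "((\<lambda>d. \<eta> * barrier z R d x) \<longlongrightarrow> \<eta> * ((max 0 (R\<^sup>2 - (norm (x - z))\<^sup>2) + 0) powr s - 0 powr s)) (at_right 0)"
      unfolding barrier_def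
    proof (intro tendsto_mult tendsto_const tendsto_diff tendsto_powr' tendsto_add tendsto_ident_at)
      show "(0::real) \<noteq> 0 \<or> (s > 0 \<and> eventually (\<lambda>b::real. 0 \<le> b) (at_right 0))"
        using s eventually_at_right_real[of 0 1] by (auto elim!: eventually_mono)
    qed (use xz in \<open>auto simp: max_def\<close>)
    moreover have "\<forall>\<^sub>F d in at_right 0. \<eta> * barrier z R d x \<le> u x"
      using eventually_at_right_real[of 0 1] main[OF R U x] by (auto elim!: eventually_mono)
    ultimately have "\<eta> * ((max 0 (R\<^sup>2 - (norm (x - z))\<^sup>2) + 0) powr s - 0 powr s) \<le> u x"
      by (intro tendsto_upperbound) auto
    then show ?thesis using xz s by (simp add: max_def)
  qed
  then show thesis using that \<eta>(1) by blast
qed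

end

section \<open>Interior balls\<close>

lemma Lipschitz_gradient_upper_bound:
  fixes \<gamma> :: "'a::euclidean_space \<Rightarrow> real"
  assumes D: "\<And>z. GDERIV \<gamma> z :> D z" and L: "L-lipschitz_on UNIV D"
  shows "\<gamma> (q + h) \<le> \<gamma> q + h \<bullet> D q + L * (norm h)\<^sup>2"
proof -
  have der: "((\<lambda>t. \<gamma> (q + t *\<^sub>R h)) has_real_derivative h \<bullet> D (q + t *\<^sub>R h)) (at t)" for t
  proof -
    have "((\<lambda>t. q + t *\<^sub>R h) has_derivative (\<lambda>t. t *\<^sub>R h)) (at t)"
      by (auto intro!: derivative_eq_intros)
    moreover have "(\<gamma> has_derivative (\<lambda>k. k \<bullet> D (q + t *\<^sub>R h))) (at (q + t *\<^sub>R h))"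
      using D[of "q + t *\<^sub>R h"] by (simp add: gderiv_def)
    ultimately have "((\<lambda>t. \<gamma> (q + t *\<^sub>R h)) has_derivative (\<lambda>t'. (t' *\<^sub>R h) \<bullet> D (q + t *\<^sub>R h))) (at t)"
      by (rule has_derivative_compose)
    then show ?thesis
      by (simp add: has_field_derivative_def mult_commute_abs)
  qed
  obtain \<xi> where \<xi>: "0 < \<xi>" "\<xi> < 1" "\<gamma> (q + 1 *\<^sub>R h) - \<gamma> (q + 0 *\<^sub>R h) = (1 - 0) * (h \<bullet> D (q + \<xi> *\<^sub>R h))"
    using MVT2[of 0 1 "\<lambda>t. \<gamma> (q + t *\<^sub>R h)" "\<lambda>t. h \<bullet> D (q + t *\<^sub>R h)"] der by auto
  have L0: "0 \<le> L" using L by (rule lipschitz_on_nonneg)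
  have "h \<bullet> D (q + \<xi> *\<^sub>R h) - h \<bullet> D q = h \<bullet> (D (q + \<xi> *\<^sub>R h) - D q)" by (simp add: inner_diff_right)
  also have "\<dots> \<le> norm h * norm (D (q + \<xi> *\<^sub>R h) - D q)" by (rule norm_cauchy_schwarz)
  also have "\<dots> \<le> norm h * (L * norm h)"
  proof (intro mult_left_mono)
    have "norm (D (q + \<xi> *\<^sub>R h) - D q) \<le> L * norm (\<xi> *\<^sub>R h)"
      using lipschitz_onD[OF L, of "q + \<xi> *\<^sub>R h" q] by (simp add: dist_norm)
    also have "\<dots> \<le> L * norm h" using \<xi> L0 by (intro mult_left_mono) (auto simp: mult_left_le_one_le)
    finally show "norm (D (q + \<xi> *\<^sub>R h) - D q) \<le> L * norm h" .
  qed auto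
  finally show ?thesis using \<xi>(3) by (simp add: power2_eq_square algebra_simps)
qed

text \<open>
  Let \<open>b\<close> be the boundary point vertically below \<open>x\<close> in the local graph and \<open>n\<close> the unit inner normal
  at \<open>b\<close>.  The ball of radius \<open>R\<close> that touches the boundary at \<open>b\<close> has centre \<open>b + R *\<^sub>R n\<close>; it lies above
  the graph as soon as its curvature exceeds that allowed by the Lipschitz constant of the gradient.
  The height \<open>t\<close> of \<open>x\<close> over \<open>b\<close> bounds the distance to the complement from above and
  \<open>R\<^sup>2 - (norm (x - z))\<^sup>2\<close>, up to a factor, from below, because the angle between \<open>n\<close> and the vertical
  direction stays away from a right angle.
\<close>

lemma interior_balls_near_boundary_point:
  fixes \<Omega> :: "'a::euclidean_space set"
  assumes \<Omega>: "open \<Omega>" "C11_boundary \<Omega>" and x0: "x0 \<in> frontier \<Omega>" and r0: "0 < r0"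
  obtains R c \<delta> where "0 < R" "R \<le> r0" "0 < c" "0 < \<delta>"
    "\<And>x. x \<in> \<Omega> \<Longrightarrow> dist x0 x < \<delta> \<Longrightarrow> \<exists>z. ball z R \<subseteq> \<Omega> \<inter> ball x0 r0 \<and> x \<in> ball z R
       \<and> c * bdist \<Omega> x \<le> R\<^sup>2 - (norm (x - z))\<^sup>2"
proof -
  obtain r' e \<gamma> D L where r': "0 < r'" and e: "norm e = 1" and D': "\<forall>z. GDERIV \<gamma> z :> D z"
    and L: "L-lipschitz_on UNIV D"
    and epi: "\<Omega> \<inter> ball x0 r' = {y \<in> ball x0 r'. \<gamma> (y - (y \<bullet> e) *\<^sub>R e) < y \<bullet> e}"
    using bspec[OF \<Omega>(2)[unfolded C11_boundary_def] x0] by (elim bexE exE conjE) rule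
  from D' have D: "GDERIV \<gamma> z :> D z" for z by simp
  define r where "r = min r' r0"
  have r: "0 < r" "r \<le> r'" "r \<le> r0" unfolding r_def using r' r0 by auto
  define P where "P = (\<lambda>y::'a. y - (y \<bullet> e) *\<^sub>R e)"
  have epi: "y \<in> \<Omega> \<longleftrightarrow> \<gamma> (P y) < y \<bullet> e" if "dist x0 y < r" for y
  proof -
    have y: "y \<in> ball x0 r'" using that r by simp
    have "(y \<in> \<Omega> \<inter> ball x0 r') = (y \<in> {y \<in> ball x0 r'. \<gamma> (P y) < y \<bullet> e})"
      unfolding P_def by (simp only: epi)
    then show ?thesis using y by blast
  qed
  have ee: "e \<bullet> e = 1" using e by (simp add: norm_eq_1)
  have P_add: "P (x + y) = P x + P y" for x y
    unfolding P_def by (simp add: inner_add_left algebra_simps)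
  have P_e: "P (t *\<^sub>R e) = 0" for t unfolding P_def using ee by simp
  have P_diff: "P (x - t *\<^sub>R e) = P x" for x t
    using P_add[of "x - t *\<^sub>R e" "t *\<^sub>R e"] P_e[of t] by simp
  have Pe: "P y \<bullet> e = 0" for y unfolding P_def by (simp add: inner_diff_left ee)
  have P_sym: "P x \<bullet> y = x \<bullet> P y" for x y
    unfolding P_def by (simp add: inner_diff_left inner_diff_right inner_commute)
  have P_norm: "norm (P y) \<le> norm y" for y
  proof -
    have "(norm (P y))\<^sup>2 = (norm y)\<^sup>2 - (y \<bullet> e)\<^sup>2"
      unfolding P_def power2_norm_eq_inner
      by (simp add: inner_diff_left inner_diff_right ee inner_commute power2_eq_square)
    then have "(norm (P y))\<^sup>2 \<le> (norm y)\<^sup>2" by simp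
    then show ?thesis by (rule power2_le_imp_le) simp
  qed
  have L0: "0 \<le> L" using L by (rule lipschitz_on_nonneg)
  \<comment> \<open>\<open>A\<close> bounds the length of the unnormalized normals \<open>\<nu>\<close> with vertical component \<open>1\<close>; the angle of the
      normal with the vertical direction thus has cosine at least \<open>1 / A\<close>.\<close>
  define A where "A = 1 + norm (D (P x0)) + L * r"
  have A: "1 \<le> A" unfolding A_def using L0 r by simp
  \<comment> \<open>The first bound keeps the balls in the neighbourhood where the boundary is a graph, the second one
      is the condition on the curvature.\<close>
  define R where "R = min (r / 8) (1 / (2 * (L + 1)))"
  have R: "0 < R" "R \<le> r / 8" "R \<le> 1 / (2 * (L + 1))" unfolding R_def using r L0 by auto
  have RL: "L * (2 * R) \<le> 1"
  proof -
    have "(2 * (L + 1)) * R \<le> 1" using R(3) L0 by (simp add: pos_le_divide_eq mult.commute)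
    then show ?thesis using R(1) by (simp add: algebra_simps)
  qed
  define t where "t = (\<lambda>x. x \<bullet> e - \<gamma> (P x))"
  have "x0 \<notin> \<Omega>" using x0 \<Omega>(1) by (simp add: frontier_def interior_open)
  then have t0: "t x0 \<le> 0" using epi[of x0] r unfolding t_def by simp
  have t_cont: "isCont t x0"
  proof -
    have \<gamma>c: "isCont \<gamma> z" for z using D[of z] unfolding gderiv_def by (rule has_derivative_continuous)
    have Pc: "isCont P x0" unfolding P_def by (intro continuous_intros)
    have "isCont (\<lambda>x. \<gamma> (P x)) x0" by (rule isCont_o2[OF Pc \<gamma>c])
    then show ?thesis unfolding t_def by (intro continuous_intros)
  qed
  obtain \<delta>1 where \<delta>1: "0 < \<delta>1" "\<And>x. dist x x0 < \<delta>1 \<Longrightarrow> dist (t x) (t x0) < R / A"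
  proof -
    have "0 < R / A" using R A by simp
    with t_cont have "\<exists>d>0. \<forall>x. dist x x0 < d \<longrightarrow> dist (t x) (t x0) < R / A"
      unfolding continuous_at_eps_delta by (elim allE[of _ "R / A"]) simp
    then show ?thesis using that by blast
  qed
  define \<delta> where "\<delta> = min \<delta>1 (r / 4)"
  have \<delta>: "0 < \<delta>" "\<delta> \<le> \<delta>1" "\<delta> \<le> r / 4" unfolding \<delta>_def using \<delta>1 r by auto
  have "\<exists>z. ball z R \<subseteq> \<Omega> \<inter> ball x0 r0 \<and> x \<in> ball z R \<and> R / A * bdist \<Omega> x \<le> R\<^sup>2 - (norm (x - z))\<^sup>2"
    if x: "x \<in> \<Omega>" "dist x0 x < \<delta>" for x
  proof -
    have tx: "0 < t x" using epi[of x] x \<delta> r unfolding t_def by simp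
    have txR: "t x < R / A" using \<delta>1(2)[of x] x(2) \<delta>(2) t0 by (simp add: dist_commute dist_real_def)
    have "R / A \<le> R" using A R by (simp add: pos_divide_le_eq)
    then have txr: "t x < R" using txR by simp
    define b where "b = x - t x *\<^sub>R e"
    have Pb: "P b = P x" unfolding b_def by (rule P_diff)
    have be: "b \<bullet> e = \<gamma> (P b)" unfolding Pb unfolding b_def by (simp add: inner_diff_left ee t_def)
    have bx: "dist b x = t x" unfolding b_def using tx e by (simp add: dist_norm)
    have bx0: "dist x0 b < r" using dist_triangle[of x0 b x] bx x \<delta> txr R by (simp add: dist_commute)
    have "b \<notin> \<Omega>" using epi[OF bx0] be by simp
    then have bd: "bdist \<Omega> x \<le> t x" using infdist_le[of b "- \<Omega>" x] bx by (simp add: dist_commute)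
    define \<nu> where "\<nu> = e - P (D (P b))"
    have \<nu>e: "\<nu> \<bullet> e = 1" unfolding \<nu>_def by (simp add: inner_diff_left ee Pe)
    have \<nu>1: "1 \<le> norm \<nu>" using norm_cauchy_schwarz[of \<nu> e] \<nu>e e by simp
    have \<nu>A: "norm \<nu> \<le> A"
    proof -
      have "norm (D (P b) - D (P x0)) \<le> L * norm (P b - P x0)"
        using lipschitz_onD[OF L, of "P b" "P x0"] by (simp add: dist_norm)
      also have "P b - P x0 = P (b - x0)" using P_add[of "b - x0" x0] by simp
      also have "L * norm (P (b - x0)) \<le> L * r"
        using P_norm[of "b - x0"] bx0 L0 by (intro mult_left_mono) (auto simp: dist_norm norm_minus_commute)
      finally have "norm (D (P b)) \<le> norm (D (P x0)) + L * r"
        using norm_triangle_ineq2[of "D (P b)" "D (P x0)"] by simp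
      then show ?thesis
        unfolding \<nu>_def A_def using norm_triangle_ineq4[of e "P (D (P b))"] P_norm[of "D (P b)"] e by simp
    qed
    define n where "n = \<nu> /\<^sub>R norm \<nu>"
    have "norm \<nu> \<noteq> 0" using \<nu>1 by linarith
    then have n1: "norm n = 1" unfolding n_def by simp
    have en: "e \<bullet> n = 1 / norm \<nu>" unfolding n_def using \<nu>e by (simp add: inner_commute inverse_eq_divide)
    define z where "z = b + R *\<^sub>R n"
    have xz: "R\<^sup>2 - (norm (x - z))\<^sup>2 = t x * (2 * R / norm \<nu> - t x)"
    proof -
      have "x - z = t x *\<^sub>R e - R *\<^sub>R n" unfolding z_def b_def by simp
      then have "(norm (x - z))\<^sup>2 = (t x)\<^sup>2 * (e \<bullet> e) - 2 * t x * R * (e \<bullet> n) + R\<^sup>2 * (n \<bullet> n)"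
        unfolding power2_norm_eq_inner
        by (simp only:) (simp add: inner_diff_left inner_diff_right inner_commute power2_eq_square algebra_simps)
      moreover have "n \<bullet> n = 1" using n1 by (simp add: norm_eq_1)
      ultimately show ?thesis unfolding en ee by (simp add: power2_eq_square algebra_simps)
    qed
    have "R / A \<le> R / norm \<nu>" using \<nu>1 \<nu>A R by (intro divide_left_mono mult_pos_pos) linarith+
    then have "R / A \<le> 2 * R / norm \<nu> - t x" using txR by simp
    then have "t x * (R / A) \<le> R\<^sup>2 - (norm (x - z))\<^sup>2"
      unfolding xz using tx by (intro mult_left_mono) auto
    moreover have "R / A * bdist \<Omega> x \<le> t x * (R / A)"
      unfolding mult.commute[of "t x"] using bd R A by (intro mult_left_mono) auto
    moreover have pos: "0 < t x * (R / A)" using tx R A by simp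
    ultimately have 1: "R / A * bdist \<Omega> x \<le> R\<^sup>2 - (norm (x - z))\<^sup>2" and "0 < R\<^sup>2 - (norm (x - z))\<^sup>2" by linarith+
    then have "(norm (x - z))\<^sup>2 < R\<^sup>2" by linarith
    then have "norm (x - z) < R" by (rule power2_less_imp_less) (use R(1) in simp)
    then have 2: "x \<in> ball z R" by (simp add: dist_norm norm_minus_commute)
    have 3: "ball z R \<subseteq> \<Omega> \<inter> ball x0 r0"
    proof
      fix y assume y: "y \<in> ball z R"
      have bz: "dist b z = R" unfolding z_def using n1 R by (simp add: dist_norm)
      have "dist x0 y \<le> dist x0 b + dist b z + dist z y"
        using dist_triangle[of x0 y b] dist_triangle[of b y z] by simp
      also have "\<dots> < r"
        using dist_triangle[of x0 b x] bx x \<delta> txr R bz y by (simp add: dist_commute)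
      finally have yr: "dist x0 y < r" .
      define w where "w = y - b"
      have "norm (w - R *\<^sub>R n) < R" using y unfolding w_def z_def
        by (simp add: dist_norm norm_minus_commute algebra_simps)
      then have "(norm (w - R *\<^sub>R n))\<^sup>2 < R\<^sup>2" by (intro power_strict_mono) auto
      moreover have "(norm (w - R *\<^sub>R n))\<^sup>2 = (norm w)\<^sup>2 - 2 * R * (w \<bullet> n) + R\<^sup>2 * (n \<bullet> n)"
        unfolding power2_norm_eq_inner
        by (simp add: inner_diff_left inner_diff_right inner_commute power2_eq_square algebra_simps)
      moreover have "n \<bullet> n = 1" using n1 by (simp add: norm_eq_1)
      ultimately have "(norm w)\<^sup>2 < 2 * R * (w \<bullet> n)" by simp
      also have "w \<bullet> n = (w \<bullet> \<nu>) / norm \<nu>" unfolding n_def by (simp add: divide_inverse mult.commute)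
      finally have wn: "(norm w)\<^sup>2 < 2 * R * ((w \<bullet> \<nu>) / norm \<nu>)" .
      then have "0 < 2 * R * ((w \<bullet> \<nu>) / norm \<nu>)" using zero_le_power2[of "norm w"] by linarith
      then have w\<nu>: "0 < w \<bullet> \<nu>" using R \<nu>1 by (simp add: zero_less_mult_iff zero_less_divide_iff)
      have "(w \<bullet> \<nu>) / norm \<nu> \<le> (w \<bullet> \<nu>) / 1"
        using \<nu>1 w\<nu> by (intro divide_left_mono) auto
      then have "(w \<bullet> \<nu>) / norm \<nu> \<le> w \<bullet> \<nu>" by simp
      then have "2 * R * ((w \<bullet> \<nu>) / norm \<nu>) \<le> 2 * R * (w \<bullet> \<nu>)" using R by (intro mult_left_mono) auto
      then have wR: "(norm w)\<^sup>2 < 2 * R * (w \<bullet> \<nu>)" using wn by linarith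
      have strict: "L * (norm w)\<^sup>2 < w \<bullet> \<nu>"
      proof (cases "L = 0")
        case False
        then have "L * (norm w)\<^sup>2 < L * (2 * R * (w \<bullet> \<nu>))" using wR L0 by (intro mult_strict_left_mono) auto
        also have "\<dots> = L * (2 * R) * (w \<bullet> \<nu>)" by simp
        also have "\<dots> \<le> 1 * (w \<bullet> \<nu>)" using RL w\<nu> by (intro mult_right_mono) auto
        finally show ?thesis by simp
      qed (use w\<nu> in simp)
      have yb: "y = b + w" unfolding w_def by simp
      have "\<gamma> (P y) \<le> \<gamma> (P b) + P w \<bullet> D (P b) + L * (norm (P w))\<^sup>2"
        unfolding yb P_add using Lipschitz_gradient_upper_bound[OF D L] .
      also have "\<dots> \<le> \<gamma> (P b) + w \<bullet> P (D (P b)) + L * (norm w)\<^sup>2"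
        using P_norm[of w] L0 by (simp add: P_sym mult_left_mono power_mono)
      also have "\<dots> < b \<bullet> e + w \<bullet> P (D (P b)) + w \<bullet> \<nu>" using strict be by simp
      also have "\<dots> = y \<bullet> e" unfolding yb \<nu>_def by (simp add: inner_diff_right inner_add_left)
      finally show "y \<in> \<Omega> \<inter> ball x0 r0" using epi[OF yr] yr r by simp
    qed
    show ?thesis using 1 2 3 by blast
  qed
  moreover have "R \<le> r0" using R r by simp
  moreover have "0 < R / A" using R A by simp
  ultimately show thesis using that[of R "R / A" \<delta>] R(1) \<delta>(1) by blast
qed

section \<open>The lower bound by the distance to the boundary\<close>

lemma AE_pair_of_AE:
  fixes u u' :: "'a::euclidean_space \<Rightarrow> real"
  assumes [measurable]: "u \<in> borel_measurable lebesgue" "u' \<in> borel_measurable lebesgue"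
    and ae: "AE x in lebesgue. u x = u' x"
  shows "AE q in lebesgue \<Otimes>\<^sub>M lebesgue. u (fst q) = u' (fst q) \<and> u (snd q) = u' (snd q)"
proof -
  have "AE x in lebesgue. AE y in lebesgue. u (fst (x, y)) = u' (fst (x, y)) \<and> u (snd (x, y)) = u' (snd (x, y))"
    using ae by eventually_elim (use ae in simp)
  then show ?thesis by (intro lebesgue_pair.AE_pair_measure) measurable
qed

lemma Wsp_cong_AE:
  fixes u u' :: "'a::euclidean_space \<Rightarrow> real"
  assumes u: "u \<in> Wsp s p" and m: "u' \<in> borel_measurable lebesgue" and ae: "AE x in lebesgue. u x = u' x"
  shows "u' \<in> Wsp s p"
proof -
  have um: "u \<in> borel_measurable lebesgue" using u by (simp add: Wsp_iff)
  have "integrable lebesgue (\<lambda>x. \<bar>u x\<bar> powr p)" using u by (simp add: Wsp_iff)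
  moreover have "integrable lebesgue (\<lambda>x. \<bar>u x\<bar> powr p) \<longleftrightarrow> integrable lebesgue (\<lambda>x. \<bar>u' x\<bar> powr p)"
    using um m ae by (intro integrable_cong_AE) (auto elim: eventually_mono)
  moreover have "integrable (lebesgue \<Otimes>\<^sub>M lebesgue) (gagliardo_integrand s p u)" using u by (simp add: Wsp_iff)
  moreover have "integrable (lebesgue \<Otimes>\<^sub>M lebesgue) (gagliardo_integrand s p u)
     \<longleftrightarrow> integrable (lebesgue \<Otimes>\<^sub>M lebesgue) (gagliardo_integrand s p u')"
    using AE_pair_of_AE[OF um m ae] um m
    by (intro integrable_cong_AE gagliardo_integrand_measurable)
      (auto simp: gagliardo_integrand_def elim: eventually_mono)
  ultimately show ?thesis using m by (simp add: Wsp_iff)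
qed

lemma frac_p_laplacian_cong_AE:
  fixes u u' \<phi> :: "'a::euclidean_space \<Rightarrow> real"
  assumes "u \<in> borel_measurable lebesgue" "u' \<in> borel_measurable lebesgue" "\<phi> \<in> borel_measurable lebesgue"
    and "AE x in lebesgue. u x = u' x"
  shows "frac_p_laplacian s p u \<phi> = frac_p_laplacian s p u' \<phi>"
  unfolding frac_p_laplacian_eq
  using AE_pair_of_AE[OF assms(1,2,4)] assms
  by (intro integral_cong_AE frac_integrand_measurable) (auto simp: frac_integrand_def elim: eventually_mono)

text \<open>
  Elements of \<^const>\<open>Wsp0\<close> vanish outside \<open>\<Omega>\<close> only almost everywhere.  This allows a representative
  that vanishes there everywhere, for which pointwise comparison is possible.
\<close>

lemma weak_supersolution_cong:
  fixes u u' :: "'a::euclidean_space \<Rightarrow> real"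
  assumes "u \<in> borel_measurable lebesgue" "u' \<in> borel_measurable lebesgue"
    and "AE x in lebesgue. u x = u' x" and eq: "\<And>x. x \<in> \<Omega> \<Longrightarrow> u x = u' x"
    and "weak_supersolution s p \<Omega> g u"
  shows "weak_supersolution s p \<Omega> g u'"
  unfolding weak_supersolution_def
proof
  fix \<phi> assume \<phi>: "\<phi> \<in> Wsp0_pos s p \<Omega>"
  then have "\<phi> \<in> borel_measurable lebesgue" by (simp add: Wsp0_pos_def Wsp0_def Wsp_iff)
  then have "frac_p_laplacian s p u \<phi> = frac_p_laplacian s p u' \<phi>"
    using assms by (intro frac_p_laplacian_cong_AE)
  moreover have "(LINT x:\<Omega>|lebesgue. g (u x) * \<phi> x) = (LINT x:\<Omega>|lebesgue. g (u' x) * \<phi> x)"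
    unfolding set_lebesgue_integral_def
    by (intro Bochner_Integration.integral_cong) (auto simp: indicator_def eq)
  ultimately show "(LINT x:\<Omega>|lebesgue. g 0 * \<phi> x)
      \<le> frac_p_laplacian s p u' \<phi> + (LINT x:\<Omega>|lebesgue. g (u' x) * \<phi> x)"
    using assms(5) \<phi> unfolding weak_supersolution_def by auto
qed

lemma bdist_powr_bound_of_lower_bound:
  fixes u :: "'a::euclidean_space \<Rightarrow> real"
  assumes s: "0 < s" and e: "0 < e" "0 < \<delta>" and u: "\<And>x. x \<in> \<Omega> \<Longrightarrow> dist x0 x < \<delta> \<Longrightarrow> e \<le> u x"
  shows "\<exists>c>0. \<forall>x\<in>\<Omega>. dist x0 x < \<delta> \<longrightarrow> c * bdist \<Omega> x powr s \<le> u x"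
proof -
  define m where "m = (bdist \<Omega> x0 + \<delta>) powr s"
  have m: "0 < m" unfolding m_def using e infdist_nonneg[of x0 "- \<Omega>"] by simp
  have "e / m * bdist \<Omega> x powr s \<le> u x" if "x \<in> \<Omega>" "dist x0 x < \<delta>" for x
  proof -
    have "bdist \<Omega> x \<le> bdist \<Omega> x0 + \<delta>"
      using infdist_triangle[of x "- \<Omega>" x0] that by (simp add: dist_commute)
    then have "bdist \<Omega> x powr s \<le> m" unfolding m_def using s infdist_nonneg[of x "- \<Omega>"] by (intro powr_mono2) auto
    then have "e / m * bdist \<Omega> x powr s \<le> e / m * m" using e m by (intro mult_left_mono) auto
    then show ?thesis using u[OF that] m by simp
  qed
  then show ?thesis using e m by (intro exI[of _ "e / m"]) auto
qed

lemma uniform_bound_of_local_bounds: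
  fixes u d :: "'a::euclidean_space \<Rightarrow> real"
  assumes "bounded \<Omega>" and d: "\<And>x. x \<in> \<Omega> \<Longrightarrow> 0 \<le> d x"
    and loc: "\<And>x0. x0 \<in> closure \<Omega> \<Longrightarrow> \<exists>\<delta>>0. \<exists>c>0. \<forall>x\<in>\<Omega>. dist x0 x < \<delta> \<longrightarrow> c * d x \<le> u x"
  shows "\<exists>c>0. \<forall>x\<in>\<Omega>. c * d x \<le> u x"
proof -
  obtain \<delta> where \<delta>: "\<And>x0. x0 \<in> closure \<Omega> \<Longrightarrow> 0 < \<delta> x0"
    "\<And>x0. x0 \<in> closure \<Omega> \<Longrightarrow> \<exists>c>0. \<forall>x\<in>\<Omega>. dist x0 x < \<delta> x0 \<longrightarrow> c * d x \<le> u x"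
    using loc by metis
  obtain c where c: "\<And>x0. x0 \<in> closure \<Omega> \<Longrightarrow> 0 < c x0"
    "\<And>x0 x. x0 \<in> closure \<Omega> \<Longrightarrow> x \<in> \<Omega> \<Longrightarrow> dist x0 x < \<delta> x0 \<Longrightarrow> c x0 * d x \<le> u x"
    using \<delta>(2) by metis
  have "compact (closure \<Omega>)" using assms(1) by simp
  then obtain F where F: "F \<subseteq> closure \<Omega>" "finite F" "closure \<Omega> \<subseteq> (\<Union>x0\<in>F. ball x0 (\<delta> x0))"
  proof (rule compactE_image)
    show "closure \<Omega> \<subseteq> (\<Union>x0\<in>closure \<Omega>. ball x0 (\<delta> x0))" using \<delta>(1) by force
  qed auto
  define m where "m = Min (insert 1 (c ` F))"
  have m: "0 < m" unfolding m_def using F c(1) by auto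
  have "m * d x \<le> u x" if x: "x \<in> \<Omega>" for x
  proof -
    obtain x0 where x0: "x0 \<in> F" "dist x0 x < \<delta> x0" using F(3) x closure_subset[of \<Omega>] by auto
    have "m \<le> c x0" unfolding m_def using F(2) x0(1) by simp
    then have "m * d x \<le> c x0 * d x" using d[OF x] by (rule mult_right_mono)
    also have "\<dots> \<le> u x" using c(2) F(1) x0 x by blast
    finally show ?thesis .
  qed
  then show ?thesis using m by blast
qed

text \<open>
  Each point of the closure of \<open>\<Omega>\<close> falls under one of three cases: near a point where \<open>u\<close> is positive
  there is nothing to compare; around any other point of \<open>\<Omega>\<close> a small concentric ball gives a positive
  lower bound; near a boundary point the balls touching the boundary give the power of the distance.
\<close>

lemma (in frac_exponents) Hopf_lower_bound:
  fixes \<Omega> :: "'a::euclidean_space set" and u :: "'a \<Rightarrow> real"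
  assumes \<Omega>: "bounded_C11_domain \<Omega>" and g: "continuous_on UNIV g"
    and u: "u \<in> Wsp s p" "\<And>x. x \<notin> \<Omega> \<Longrightarrow> u x = 0" "\<And>x. 0 \<le> u x" "continuous_on \<Omega> u"
    and super: "weak_supersolution s p \<Omega> g u"
    and x1: "x1 \<in> \<Omega>" "u x1 \<noteq> 0"
  shows "\<exists>c>0. \<forall>x\<in>\<Omega>. c * bdist \<Omega> x powr s \<le> u x"
proof -
  have op: "open \<Omega>" and bd: "bounded \<Omega>" and C11: "C11_boundary \<Omega>"
    using \<Omega> by (auto simp: bounded_C11_domain_def)
  define e where "e = u x1 / 2"
  have e: "0 < e" using x1 u(3)[of x1] unfolding e_def by simp
  have "isCont u x1" using u(4) op x1(1) continuous_on_eq_continuous_at by blast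
  then have "\<forall>\<^sub>F y in at x1. e < u y"
    unfolding isCont_def using e by (intro order_tendstoD) (auto simp: e_def)
  then obtain \<rho>1 where \<rho>1: "0 < \<rho>1" "\<And>y. y \<noteq> x1 \<Longrightarrow> dist y x1 < \<rho>1 \<Longrightarrow> e < u y"
    unfolding eventually_at by auto
  obtain \<rho>2 where \<rho>2: "0 < \<rho>2" "ball x1 \<rho>2 \<subseteq> \<Omega>" using op x1(1) openE by blast
  define \<rho> where "\<rho> = min \<rho>1 \<rho>2 / 2"
  have \<rho>: "0 < \<rho>" "ball x1 (2 * \<rho>) \<subseteq> \<Omega>" unfolding \<rho>_def using \<rho>1 \<rho>2 by auto
  have ue: "e \<le> u y" if "dist x1 y < 2 * \<rho>" for y
  proof (cases "y = x1")
    case True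
    then show ?thesis using e unfolding e_def by simp
  next
    case False
    then show ?thesis using \<rho>1(2)[of y] that unfolding \<rho>_def by (simp add: dist_commute)
  qed
  have sub: "ball x1 \<rho> \<subseteq> \<Omega>" using \<rho> by (intro order_trans[OF _ \<rho>(2)]) auto
  obtain D where D: "0 < D" "\<And>x y. x \<in> \<Omega> \<Longrightarrow> y \<in> \<Omega> \<Longrightarrow> norm (x - y) \<le> D"
  proof
    show "0 < diameter \<Omega> + 1" using diameter_ge_0[OF bd] by simp
    show "norm (x - y) \<le> diameter \<Omega> + 1" if "x \<in> \<Omega>" "y \<in> \<Omega>" for x y
      using diameter_bounded_bound[OF bd that] by (simp add: dist_norm)
  qed
  have ue_ball: "e \<le> u y" if "y \<in> ball x1 \<rho>" for y using that \<rho>(1) by (intro ue) simp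
  have \<rho>1_pos: "0 < \<rho> + 1" using \<rho>(1) by simp
  \<comment> \<open>All radii used below are at most \<open>\<rho>\<close>, and \<open>R\<^sup>2 + 1 \<le> (\<rho> + 1)\<^sup>2\<close> for these.\<close>
  obtain \<eta> where \<eta>: "0 < \<eta>"
    and comp: "\<And>z R x. 0 < R \<Longrightarrow> R\<^sup>2 + 1 \<le> (\<rho> + 1)\<^sup>2 \<Longrightarrow> ball z R \<subseteq> \<Omega> \<Longrightarrow> ball z R \<inter> ball x1 \<rho> = {} \<Longrightarrow>
      x \<in> ball z R \<Longrightarrow> \<eta> * (R\<^sup>2 - (norm (x - z))\<^sup>2) powr s \<le> u x"
    by (rule barrier_comparison[OF op D u super g \<rho>(1) sub e _ \<rho>1_pos]) (auto intro: ue_ball)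
  have RR: "R\<^sup>2 + 1 \<le> (\<rho> + 1)\<^sup>2" if "0 < R" "R \<le> \<rho>" for R
  proof -
    have "R\<^sup>2 \<le> \<rho>\<^sup>2" using that by (intro power_mono) auto
    then show ?thesis using \<rho> by (simp add: power2_eq_square algebra_simps)
  qed
  show ?thesis
  proof (rule uniform_bound_of_local_bounds[OF bd])
    fix x0 assume x0: "x0 \<in> closure \<Omega>"
    show "\<exists>\<delta>>0. \<exists>c>0. \<forall>x\<in>\<Omega>. dist x0 x < \<delta> \<longrightarrow> c * bdist \<Omega> x powr s \<le> u x"
    proof (cases "dist x1 x0 < 2 * \<rho>")
      case True
      define \<delta> where "\<delta> = 2 * \<rho> - dist x1 x0"
      have "0 < \<delta>" unfolding \<delta>_def using True by simp
      moreover have "\<exists>c>0. \<forall>x\<in>\<Omega>. dist x0 x < \<delta> \<longrightarrow> c * bdist \<Omega> x powr s \<le> u x"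
      proof (rule bdist_powr_bound_of_lower_bound)
        show "e \<le> u x" if "dist x0 x < \<delta>" for x
          using dist_triangle[of x1 x x0] that unfolding \<delta>_def by (intro ue) simp
      qed (use s e \<open>0 < \<delta>\<close> in auto)
      ultimately show ?thesis by blast
    next
      case far: False
      show ?thesis
      proof (cases "x0 \<in> \<Omega>")
        case True
        obtain R0 where R0: "0 < R0" "ball x0 R0 \<subseteq> \<Omega>" using op True openE by blast
        define R where "R = min R0 \<rho>"
        have R: "0 < R" "R \<le> \<rho>" "ball x0 R \<subseteq> \<Omega>" unfolding R_def using R0 \<rho> by auto
        have disj: "ball x0 R \<inter> ball x1 \<rho> = {}"
        proof (rule ccontr)
          assume "ball x0 R \<inter> ball x1 \<rho> \<noteq> {}"
          then obtain y where "dist x0 y < R" "dist x1 y < \<rho>" by auto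
          then show False using dist_triangle[of x1 x0 y] far R(2) by (simp add: dist_commute)
        qed
        \<comment> \<open>The value of the profile at distance \<open>R / 2\<close> from the centre.\<close>
        define c0 where "c0 = \<eta> * (R\<^sup>2 - (R / 2)\<^sup>2) powr s"
        have "0 < R\<^sup>2 - (R / 2)\<^sup>2" using R by (simp add: power_divide)
        then have c0: "0 < c0" unfolding c0_def using \<eta> by simp
        have "\<exists>c>0. \<forall>x\<in>\<Omega>. dist x0 x < R / 2 \<longrightarrow> c * bdist \<Omega> x powr s \<le> u x"
        proof (rule bdist_powr_bound_of_lower_bound[OF s(1) c0])
          show "c0 \<le> u x" if "dist x0 x < R / 2" for x
          proof -
            have "(norm (x - x0))\<^sup>2 \<le> (R / 2)\<^sup>2"
              using that by (intro power_mono) (auto simp: dist_norm norm_minus_commute)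
            then have "c0 \<le> \<eta> * (R\<^sup>2 - (norm (x - x0))\<^sup>2) powr s"
              unfolding c0_def using \<eta> s \<open>0 < R\<^sup>2 - (R / 2)\<^sup>2\<close> by (intro mult_left_mono powr_mono2) auto
            also have "\<dots> \<le> u x" using that R by (intro comp RR disj) auto
            finally show ?thesis .
          qed
        qed (use R in auto)
        then show ?thesis using R(1) by (intro exI[of _ "R / 2"]) auto
      next
        case False
        then have fr: "x0 \<in> frontier \<Omega>" using x0 op by (simp add: frontier_def interior_open)
        obtain R c \<delta> where R: "0 < R" "R \<le> \<rho>" "0 < c" "0 < \<delta>"
          and balls: "\<And>x. x \<in> \<Omega> \<Longrightarrow> dist x0 x < \<delta> \<Longrightarrow> \<exists>z. ball z R \<subseteq> \<Omega> \<inter> ball x0 \<rho> \<and> x \<in> ball z R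
             \<and> c * bdist \<Omega> x \<le> R\<^sup>2 - (norm (x - z))\<^sup>2"
          using interior_balls_near_boundary_point[OF op C11 fr \<rho>(1)] by metis
        have disj: "ball x0 \<rho> \<inter> ball x1 \<rho> = {}"
        proof (rule ccontr)
          assume "ball x0 \<rho> \<inter> ball x1 \<rho> \<noteq> {}"
          then obtain y where "dist x0 y < \<rho>" "dist x1 y < \<rho>" by auto
          then show False using dist_triangle[of x1 x0 y] far by (simp add: dist_commute)
        qed
        have "\<eta> * c powr s * bdist \<Omega> x powr s \<le> u x" if x: "x \<in> \<Omega>" "dist x0 x < \<delta>" for x
        proof -
          obtain z where z: "ball z R \<subseteq> \<Omega> \<inter> ball x0 \<rho>" "x \<in> ball z R"
            "c * bdist \<Omega> x \<le> R\<^sup>2 - (norm (x - z))\<^sup>2"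
            using balls[OF x] by blast
          have "\<eta> * c powr s * bdist \<Omega> x powr s = \<eta> * (c * bdist \<Omega> x) powr s" by (simp add: powr_mult)
          also have "\<dots> \<le> \<eta> * (R\<^sup>2 - (norm (x - z))\<^sup>2) powr s"
            using z(3) \<eta> s R(3) infdist_nonneg[of x "- \<Omega>"] by (intro mult_left_mono powr_mono2) auto
          also have "\<dots> \<le> u x"
            using z R disj by (intro comp RR) auto
          finally show ?thesis .
        qed
        moreover have "0 < \<eta> * c powr s" using \<eta> R by simp
        ultimately show ?thesis using R(4) by blast
      qed
    qed
  qed simp
qed

theorem theorem2p6:
  fixes \<Omega> :: "'a::euclidean_space set"
    and p s :: real
    and g :: "real \<Rightarrow> real"
    and u :: "'a \<Rightarrow> real"
  assumes "DIM('a) \<ge> 2"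
    and "bounded_C11_domain \<Omega>"
    and "p \<ge> 2" and "0 < s" and "s < 1" and "p * s < real DIM('a)"
    and "continuous_on UNIV g" and "BV_loc g"
    and "u \<in> Wsp0 s p \<Omega>" and "continuous_on (closure \<Omega>) u"
    and "\<exists>x\<in>\<Omega>. u x \<noteq> 0"
    and "weak_supersolution s p \<Omega> g u"
    and "\<forall>x\<in>\<Omega>. 0 \<le> u x"
  shows "0 < (INF x\<in>\<Omega>. u x / bdist \<Omega> x powr s) \<and>
         (u \<in> C0s s \<Omega> \<longrightarrow> u \<in> int_C0s_pos s \<Omega>)"
proof -
  interpret frac_exponents s p using assms by unfold_locales auto
  have op: "open \<Omega>" and bd: "bounded \<Omega>" and ne: "\<Omega> \<noteq> {}"
    using assms(2) by (auto simp: bounded_C11_domain_def)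
  define u0 where "u0 = (\<lambda>x. indicator \<Omega> x * u x)"
  have u0_in: "u0 x = u x" if "x \<in> \<Omega>" for x using that by (simp add: u0_def)
  have u: "u \<in> Wsp s p" and u_out: "AE x in lebesgue. x \<notin> \<Omega> \<longrightarrow> u x = 0"
    using assms(9) by (auto simp: Wsp0_def)
  have um: "u \<in> borel_measurable lebesgue" using u by (simp add: Wsp_iff)
  have u0m: "u0 \<in> borel_measurable lebesgue"
    unfolding u0_def using um op by (intro borel_measurable_times borel_measurable_indicator) auto
  have ae: "AE x in lebesgue. u x = u0 x"
    using u_out by eventually_elim (auto simp: u0_def indicator_def)
  obtain x1 where x1: "x1 \<in> \<Omega>" "u0 x1 \<noteq> 0" using assms(11) u0_in by auto
  have "\<exists>c>0. \<forall>x\<in>\<Omega>. c * bdist \<Omega> x powr s \<le> u0 x"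
  proof (rule Hopf_lower_bound[where u = u0, OF assms(2,7) _ _ _ _ _ x1])
    show "u0 \<in> Wsp s p" using Wsp_cong_AE[OF u u0m ae] .
    show "x \<notin> \<Omega> \<Longrightarrow> u0 x = 0" for x by (simp add: u0_def)
    show "0 \<le> u0 x" for x using assms(13) by (auto simp: u0_def indicator_def)
    have "continuous_on \<Omega> u" using assms(10) closure_subset continuous_on_subset by blast
    then show "continuous_on \<Omega> u0" by (rule continuous_on_eq) (simp add: u0_in)
    show "weak_supersolution s p \<Omega> g u0"
      using weak_supersolution_cong[OF um u0m ae _ assms(12)] u0_in by simp
  qed
  then obtain c where c: "0 < c" "\<And>x. x \<in> \<Omega> \<Longrightarrow> c * bdist \<Omega> x powr s \<le> u x"
    using u0_in by auto
  have "c \<le> u x / bdist \<Omega> x powr s" if x: "x \<in> \<Omega>" for x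
    using c(2)[OF x] bdist_pos[OF op bd x] by (simp add: pos_le_divide_eq)
  then have "c \<le> (INF x\<in>\<Omega>. u x / bdist \<Omega> x powr s)" using ne by (intro cINF_greatest) auto
  with c(1) have pos: "0 < (INF x\<in>\<Omega>. u x / bdist \<Omega> x powr s)" by linarith
  have "u \<in> int_C0s_pos s \<Omega>" if "u \<in> C0s s \<Omega>"
  proof -
    have "0 \<le> u x" if "x \<in> closure \<Omega>" for x
      using continuous_ge_on_closure[OF assms(10) that, of 0] assms(13) by simp
    then have "u \<in> C0s_pos s \<Omega>" using that by (simp add: C0s_pos_def)
    then show ?thesis using pos int_C0s_pos_eq[OF op bd ne assms(4)] by simp
  qed
  with pos show ?thesis by blast
qed

end
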